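(* Let $D\subset\mathbb{R}^3$, $\omega$, $\epsilon^+$, $\mu^+$, the Hilbert space $X$, and the linear operator $\boldsymbol{J}$ be as defined in the context. Then $\boldsymbol{J}:X\to X$ is compact.
   Context: $D\subset\mathbb{R}^3$ is a bounded domain with smooth boundary $\partial D$, and $\boldsymbol{n}$ is the outward unit normal to $\partial D$; $\omega>0$, $\epsilon^+>0$, $\mu^+>0$ are constants. All functions and fields are complex valued; the dot is the bilinear dot product and $ds$ is surface measure. $X$ is the Hilbert space of pairs $(\boldsymbol{e},\boldsymbol{h})$ of vector fields $\boldsymbol{e},\boldsymbol{h}:\partial D\to\mathbb{C}^3$ such that $\boldsymbol{e}\times\boldsymbol{n},\ \boldsymbol{h}\times\boldsymbol{n}\in H^1(\partial D)^3$ and $\boldsymbol{e}\cdot\boldsymbol{n},\ \boldsymbol{h}\cdot\boldsymbol{n}\in L^2(\partial D)$, with norm $\|(\boldsymbol{e},\boldsymbol{h})\|_X^2=\|\boldsymbol{e}\times\boldsymbol{n}\|_{H^1(\partial D)^3}^2+\|\boldsymbol{h}\times\boldsymbol{n}\|_{H^1(\partial D)^3}^2+\|\boldsymbol{e}\cdot\boldsymbol{n}\|_{L^2(\partial D)}^2+\|\boldsymbol{h}\cdot\boldsymbol{n}\|_{L^2(\partial D)}^2$. For a scalar function $w$ and a vector field $\boldsymbol{w}$ on $\partial D$ let $\boldsymbol{S}w(\boldsymbol{x})=\frac{1}{4\pi}\int_{\partial D}\frac{w(\boldsymbol{y})}{|\boldsymbol{x}-\boldsymbol{y}|}\,ds(\boldsymbol{y})$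 and $\boldsymbol{D}\boldsymbol{w}(\boldsymbol{x})=\frac{1}{4\pi}\int_{\partial D}\Big[\nabla_{\boldsymbol{x}}\Big(\frac{1}{|\boldsymbol{x}-\boldsymbol{y}|}\Big)\times\boldsymbol{n}(\boldsymbol{y})\Big]\cdot\boldsymbol{w}(\boldsymbol{y})\,ds(\boldsymbol{y})$ for $\boldsymbol{x}\in\partial D$ (the latter in the Cauchy principal value sense). Then $$\boldsymbol{J}(\boldsymbol{e},\boldsymbol{h})=\Big(\big(\omega^2\epsilon^+\boldsymbol{S}(\boldsymbol{e}\cdot\boldsymbol{n})+i\omega\boldsymbol{D}\boldsymbol{h}\big)\boldsymbol{n},\ \big(\omega^2\mu^+\boldsymbol{S}(\boldsymbol{h}\cdot\boldsymbol{n})-i\omega\boldsymbol{D}\boldsymbol{e}\big)\boldsymbol{n}\Big).$$ *)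

theory Defs
  imports "HOL-Analysis.Analysis"
begin

section \<open>Domains with smooth boundary\<close>

primrec Ck_on :: "nat \<Rightarrow> 'a::euclidean_space set \<Rightarrow> ('a \<Rightarrow> 'b::real_normed_vector) \<Rightarrow> bool" where
  "Ck_on 0 U f \<longleftrightarrow> continuous_on U f"
| "Ck_on (Suc k) U f \<longleftrightarrow>
     (\<forall>x\<in>U. f differentiable (at x)) \<and>
     (\<forall>b\<in>Basis. Ck_on k U (\<lambda>x. frechet_derivative f (at x) b))"

definition smooth_on :: "'a::euclidean_space set \<Rightarrow> ('a \<Rightarrow> 'b::real_normed_vector) \<Rightarrow> bool" where
  "smooth_on U f \<longleftrightarrow> open U \<and> (\<forall>k. Ck_on k U f)"

definition grad :: "(real^3 \<Rightarrow> real) \<Rightarrow> real^3 \<Rightarrow> real^3" where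
  "grad f x = (\<chi> i. frechet_derivative f (at x) (axis i 1))"

text \<open>Near the boundary the domain is the sublevel set of a smooth function without critical
  points; in particular it lies locally on one side of its boundary.\<close>

definition local_defining_function :: "(real^3) set \<Rightarrow> (real^3) set \<Rightarrow> (real^3 \<Rightarrow> real) \<Rightarrow> bool" where
  "local_defining_function D U \<rho> \<longleftrightarrow>
     smooth_on U \<rho> \<and> (\<forall>x\<in>U. grad \<rho> x \<noteq> 0) \<and> D \<inter> U = {x\<in>U. \<rho> x < 0}"

definition bounded_smooth_domain :: "(real^3) set \<Rightarrow> bool" where
  "bounded_smooth_domain D \<longleftrightarrow>
     open D \<and> connected D \<and> D \<noteq> {} \<and> bounded D \<and>
     (\<forall>x\<in>frontier D. \<exists>U \<rho>. x \<in> U \<and> local_defining_function D U \<rho>)"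

definition outward_normal :: "(real^3) set \<Rightarrow> real^3 \<Rightarrow> real^3" where
  "outward_normal D x =
     (THE v. \<exists>U \<rho>. x \<in> U \<and> local_defining_function D U \<rho> \<and>
                   v = grad \<rho> x /\<^sub>R norm (grad \<rho> x))"

section \<open>Surface measure\<close>

definition area_element :: "(real^2 \<Rightarrow> real^3) \<Rightarrow> real^2 \<Rightarrow> real" where
  "area_element \<phi> u =
     norm (cross3 (frechet_derivative \<phi> (at u) (axis 1 1)) (frechet_derivative \<phi> (at u) (axis 2 1)))"

definition regular_parametrization :: "(real^3) set \<Rightarrow> (real^2) set \<Rightarrow> (real^2 \<Rightarrow> real^3) \<Rightarrow> bool" where
  "regular_parametrization S V \<phi> \<longleftrightarrow>
     smooth_on V \<phi> \<and> inj_on \<phi> V \<and> \<phi> ` V \<subseteq> S \<and> (\<forall>u\<in>V. area_element \<phi> u \<noteq> 0)"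

text \<open>The measure lives on the surface itself, so measurability and integrals never involve values
  of functions away from the surface.\<close>

definition is_surface_measure :: "(real^3) set \<Rightarrow> (real^3) measure \<Rightarrow> bool" where
  "is_surface_measure S \<sigma> \<longleftrightarrow>
     space \<sigma> = S \<and> sets \<sigma> = sets (restrict_space borel S) \<and>
     (\<forall>V \<phi> A. regular_parametrization S V \<phi> \<longrightarrow> A \<in> sets \<sigma> \<longrightarrow> A \<subseteq> \<phi> ` V \<longrightarrow>
        emeasure \<sigma> A =
          (\<integral>\<^sup>+u. indicator {u\<in>V. \<phi> u \<in> A} u * ennreal (area_element \<phi> u) \<partial>lborel))"

definition surface_measure :: "(real^3) set \<Rightarrow> (real^3) measure" where
  "surface_measure S = (THE \<sigma>. is_surface_measure S \<sigma>)"

abbreviation bdry_measure :: "(real^3) set \<Rightarrow> (real^3) measure" where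
  "bdry_measure D \<equiv> surface_measure (frontier D)"

section \<open>Complex vector fields\<close>

text \<open>The dot product is bilinear, without conjugation.\<close>

definition cdot :: "complex^3 \<Rightarrow> complex^3 \<Rightarrow> complex" where
  "cdot a b = (\<Sum>i\<in>UNIV. a $ i * b $ i)"

definition ccross :: "complex^3 \<Rightarrow> complex^3 \<Rightarrow> complex^3" where
  "ccross a b = vector [a$2 * b$3 - a$3 * b$2, a$3 * b$1 - a$1 * b$3, a$1 * b$2 - a$2 * b$1]"

definition cvec :: "real^3 \<Rightarrow> complex^3" where
  "cvec v = (\<chi> i. complex_of_real (v $ i))"

definition normal_part :: "(real^3) set \<Rightarrow> (real^3 \<Rightarrow> complex^3) \<Rightarrow> real^3 \<Rightarrow> complex" where
  "normal_part D e x = cdot (e x) (cvec (outward_normal D x))"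

definition cross_normal :: "(real^3) set \<Rightarrow> (real^3 \<Rightarrow> complex^3) \<Rightarrow> real^3 \<Rightarrow> complex^3" where
  "cross_normal D e x = ccross (e x) (cvec (outward_normal D x))"

section \<open>Function spaces on the boundary\<close>

text \<open>Elements of the function spaces are represented by functions; functions at seminorm distance
  \<open>0\<close> (that is, equal almost everywhere) represent the same element.\<close>

definition L2 :: "'a measure \<Rightarrow> ('a \<Rightarrow> 'b::real_normed_vector) \<Rightarrow> bool" where
  "L2 M f \<longleftrightarrow> f \<in> borel_measurable M \<and> integrable M (\<lambda>x. (norm (f x))\<^sup>2)"

definition L2_norm_sq :: "'a measure \<Rightarrow> ('a \<Rightarrow> 'b::real_normed_vector) \<Rightarrow> real" where
  "L2_norm_sq M f = (\<integral>x. (norm (f x))\<^sup>2 \<partial>M)"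

text \<open>The tangential trace of the derivative; on the boundary it depends only on the boundary
  values of \<open>\<psi>\<close>.\<close>

definition surface_div :: "(real^3) set \<Rightarrow> (real^3 \<Rightarrow> real^3) \<Rightarrow> real^3 \<Rightarrow> real" where
  "surface_div D \<psi> x =
     (\<Sum>i\<in>UNIV. frechet_derivative \<psi> (at x) (axis i 1) $ i)
       - frechet_derivative \<psi> (at x) (outward_normal D x) \<bullet> outward_normal D x"

text \<open>Since the test fields are tangential, the integration by parts formula carries no curvature
  term. Real test fields suffice by linearity.\<close>

definition weak_surface_gradient ::
    "(real^3) set \<Rightarrow> (real^3 \<Rightarrow> complex) \<Rightarrow> (real^3 \<Rightarrow> complex^3) \<Rightarrow> bool" where
  "weak_surface_gradient D u g \<longleftrightarrow>
     L2 (bdry_measure D) g \<and>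
     (AE x in bdry_measure D. normal_part D g x = 0) \<and>
     (\<forall>W \<psi>. frontier D \<subseteq> W \<longrightarrow> smooth_on W \<psi> \<longrightarrow>
            (\<forall>x\<in>frontier D. \<psi> x \<bullet> outward_normal D x = 0) \<longrightarrow>
        (\<integral>x. u x * complex_of_real (surface_div D \<psi> x) \<partial>bdry_measure D)
          = - (\<integral>x. cdot (g x) (cvec (\<psi> x)) \<partial>bdry_measure D))"

definition H1 :: "(real^3) set \<Rightarrow> (real^3 \<Rightarrow> complex) \<Rightarrow> bool" where
  "H1 D u \<longleftrightarrow> L2 (bdry_measure D) u \<and> (\<exists>g. weak_surface_gradient D u g)"

text \<open>The weak gradient is unique almost everywhere, so the choice does not affect the norm.\<close>

definition H1_norm_sq :: "(real^3) set \<Rightarrow> (real^3 \<Rightarrow> complex) \<Rightarrow> real" where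
  "H1_norm_sq D u =
     L2_norm_sq (bdry_measure D) u
       + L2_norm_sq (bdry_measure D) (SOME g. weak_surface_gradient D u g)"

definition H1_vec :: "(real^3) set \<Rightarrow> (real^3 \<Rightarrow> complex^3) \<Rightarrow> bool" where
  "H1_vec D w \<longleftrightarrow> (\<forall>i. H1 D (\<lambda>x. w x $ i))"

definition H1_vec_norm_sq :: "(real^3) set \<Rightarrow> (real^3 \<Rightarrow> complex^3) \<Rightarrow> real" where
  "H1_vec_norm_sq D w = (\<Sum>i\<in>UNIV. H1_norm_sq D (\<lambda>x. w x $ i))"

type_synonym field_pair = "(real^3 \<Rightarrow> complex^3) \<times> (real^3 \<Rightarrow> complex^3)"

definition X_space :: "(real^3) set \<Rightarrow> field_pair set" where
  "X_space D = {(e, h).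
     H1_vec D (cross_normal D e) \<and> H1_vec D (cross_normal D h) \<and>
     L2 (bdry_measure D) (normal_part D e) \<and> L2 (bdry_measure D) (normal_part D h)}"

definition X_norm :: "(real^3) set \<Rightarrow> field_pair \<Rightarrow> real" where
  "X_norm D = (\<lambda>(e, h). sqrt (
     H1_vec_norm_sq D (cross_normal D e) + H1_vec_norm_sq D (cross_normal D h)
     + L2_norm_sq (bdry_measure D) (normal_part D e)
     + L2_norm_sq (bdry_measure D) (normal_part D h)))"

definition lincomb :: "complex \<Rightarrow> field_pair \<Rightarrow> complex \<Rightarrow> field_pair \<Rightarrow> field_pair" where
  "lincomb a u b v =
     (\<lambda>x. a *s fst u x + b *s fst v x, \<lambda>x. a *s snd u x + b *s snd v x)"

definition X_dist :: "(real^3) set \<Rightarrow> field_pair \<Rightarrow> field_pair \<Rightarrow> real" where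
  "X_dist D u v = X_norm D (lincomb 1 u (- 1) v)"

text \<open>Identities between elements of \<open>X\<close> hold up to seminorm distance \<open>0\<close>. Compatibility of \<open>T\<close>
  with this identification follows from linearity and the compactness clause.\<close>

definition compact_linear_operator_on_X :: "(real^3) set \<Rightarrow> (field_pair \<Rightarrow> field_pair) \<Rightarrow> bool" where
  "compact_linear_operator_on_X D T \<longleftrightarrow>
     (\<forall>u\<in>X_space D. T u \<in> X_space D) \<and>
     (\<forall>a b. \<forall>u\<in>X_space D. \<forall>v\<in>X_space D.
        X_dist D (T (lincomb a u b v)) (lincomb a (T u) b (T v)) = 0) \<and>
     (\<forall>f :: nat \<Rightarrow> field_pair. (\<forall>k. f k \<in> X_space D) \<longrightarrow> (\<exists>C. \<forall>k. X_norm D (f k) \<le> C) \<longrightarrow>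
        (\<exists>r v. strict_mono r \<and> v \<in> X_space D \<and> (\<lambda>k. X_dist D (T (f (r k))) v) \<longlonglongrightarrow> 0))"

section \<open>The integral operators\<close>

definition S_op :: "(real^3) set \<Rightarrow> (real^3 \<Rightarrow> complex) \<Rightarrow> real^3 \<Rightarrow> complex" where
  "S_op D w x =
     1 / (4 * complex_of_real pi) * (\<integral>y. w y / complex_of_real (norm (x - y)) \<partial>bdry_measure D)"

definition D_kernel :: "(real^3) set \<Rightarrow> real^3 \<Rightarrow> real^3 \<Rightarrow> real^3" where
  "D_kernel D x y = cross3 (grad (\<lambda>z. 1 / norm (z - y)) x) (outward_normal D y)"

definition D_truncated :: "(real^3) set \<Rightarrow> (real^3 \<Rightarrow> complex^3) \<Rightarrow> real^3 \<Rightarrow> real \<Rightarrow> complex" where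
  "D_truncated D w x \<delta> =
     1 / (4 * complex_of_real pi) *
       (LINT y:{y. \<delta> < dist x y}|bdry_measure D. cdot (cvec (D_kernel D x y)) (w y))"

definition D_op :: "(real^3) set \<Rightarrow> (real^3 \<Rightarrow> complex^3) \<Rightarrow> real^3 \<Rightarrow> complex" where
  "D_op D w x = Lim (at_right 0) (D_truncated D w x)"

definition J_op :: "(real^3) set \<Rightarrow> real \<Rightarrow> real \<Rightarrow> real \<Rightarrow> field_pair \<Rightarrow> field_pair" where
  "J_op D \<omega> \<epsilon> \<mu> = (\<lambda>(e, h).
     (\<lambda>x. (complex_of_real (\<omega>\<^sup>2 * \<epsilon>) * S_op D (normal_part D e) x
            + \<i> * complex_of_real \<omega> * D_op D h x) *s cvec (outward_normal D x),
      \<lambda>x. (complex_of_real (\<omega>\<^sup>2 * \<mu>) * S_op D (normal_part D h) x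
            - \<i> * complex_of_real \<omega> * D_op D e x) *s cvec (outward_normal D x)))"

text \<open>The integrals and principal values entering \<open>J_op\<close> exist at \<open>x\<close>, so that the
  default values of \<open>lebesgue_integral\<close> and \<open>Lim\<close> are immaterial.\<close>

definition J_defined_at :: "(real^3) set \<Rightarrow> field_pair \<Rightarrow> real^3 \<Rightarrow> bool" where
  "J_defined_at D = (\<lambda>(e, h) x.
     (\<forall>w\<in>{normal_part D e, normal_part D h}.
        integrable (bdry_measure D) (\<lambda>y. w y / complex_of_real (norm (x - y)))) \<and>
     (\<forall>w\<in>{e, h}.
        (\<forall>\<delta>>0. set_integrable (bdry_measure D) {y. \<delta> < dist x y}
                 (\<lambda>y. cdot (cvec (D_kernel D x y)) (w y))) \<and>
        (\<exists>l. (D_truncated D w x \<longlongrightarrow> l) (at_right 0))))"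

end

theory Submission
  imports Defs "HOL-Complex_Analysis.Great_Picard" "HOL-Library.Diagonal_Subsequence"
begin

text \<open>
  The values of \<open>J\<close> are multiples of the normal, so only the scalar factor matters, and it has to be
  controlled in \<open>L\<^sup>2\<close>. The single layer operator has a weakly singular kernel and is compact on
  \<open>L\<^sup>2\<close>: truncating the kernel to \<open>1 / max \<delta> (dist x y)\<close> gives operators to which Arzela-Ascoli
  applies, and by the Schur test the truncation error is \<open>O(\<delta>)\<close> in operator norm.

  The strongly singular operator reduces to the single layer operator by integration by parts. Its
  integrand is \<open>w(y)\<close> dotted with the gradient of \<open>1 / dist x y\<close> in \<open>y\<close>, where \<open>w\<close> is the tangential
  \<open>H\<^sup>1\<close> field \<open>h \<times> n\<close>, and cutting off \<open>dist x y \<le> \<delta>\<close> leaves exactly the gradient of the Lipschitz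
  function \<open>1 / max \<delta> (dist x y)\<close>. So no boundary term arises: the truncated integral is minus the
  truncated single layer potential of the weak divergence of \<open>w\<close>, for every \<open>x\<close> and \<open>\<delta>\<close>.
\<close>

section \<open>Calculus of smooth functions\<close>

text \<open>Several notions in the statement are choices whose values have to be earned: normal and
  surface measure are given by \<open>THE\<close>, the principal value by \<open>Lim\<close>, the
  weak gradient in the H1 norm by \<open>SOME\<close>. Hence the surface measure is first
  constructed and shown unique, \<open>D_op\<close> has to be measurable even where its limit fails
  to exist, and a vanishing tangential part has H1 norm 0 only because weak gradients of 0 vanish
  almost everywhere. Geometry enters the kernel estimates through finiteness of the measure and one
  bound: over a ball of radius \<open>r\<close>, the kernel \<open>1 / dist x y\<close> has integral
  at most \<open>C * r\<close>. It holds because a patch is a graph over a plane and orthogonal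
  projection does not increase distances. Weak gradients may be tested only with smooth tangential
  fields. This forces a smooth extension of the normal to a neighbourhood of the boundary and a
  smooth approximation of the Lipschitz kernel before integration by parts is available.\<close>

lemma Ck_on_SucI:
  fixes f :: "'a::euclidean_space \<Rightarrow> 'b::real_normed_vector"
  assumes "\<And>x. x \<in> U \<Longrightarrow> (f has_derivative f' x) (at x)"
    and "\<And>b. b \<in> Basis \<Longrightarrow> Ck_on k U (\<lambda>x. f' x b)"
    and cong: "\<And>g h :: 'a \<Rightarrow> 'b. (\<And>x. x \<in> U \<Longrightarrow> g x = h x) \<Longrightarrow> Ck_on k U g \<Longrightarrow> Ck_on k U h"
  shows "Ck_on (Suc k) U f"
proof -
  have "f' x = frechet_derivative f (at x)" if "x \<in> U" for x
    using assms(1)[OF that] by (rule frechet_derivative_at)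
  then have "Ck_on k U (\<lambda>x. frechet_derivative f (at x) b)" if "b \<in> Basis" for b
    using cong[OF _ assms(2)[OF that], of "\<lambda>x. frechet_derivative f (at x) b"] by simp
  then show ?thesis
    using assms(1) by (auto simp: differentiable_def)
qed

lemma Ck_on_Suc_has_derivative:
  assumes "Ck_on (Suc k) U f" "x \<in> U"
  shows "(f has_derivative frechet_derivative f (at x)) (at x)"
  using assms frechet_derivative_works by auto

text \<open>The derivative at a point of the open set \<open>U\<close> sees only values in
  \<open>U\<close>. This congruence appears as a premise of \<open>Ck_on_SucI\<close> because that
  rule is already needed in the induction proving it; \<open>Ck_on_Suc_intro\<close> then discharges
  the premise.\<close>

lemma Ck_on_cong_imp:
  assumes "open U" "\<And>x. x \<in> U \<Longrightarrow> f x = g x" "Ck_on k U f"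
  shows "Ck_on k U g"
  using assms(2,3)
proof (induction k arbitrary: f g)
  case 0
  then show ?case by (simp cong: continuous_on_cong)
next
  case (Suc k)
  have "(g has_derivative frechet_derivative f (at x)) (at x)" if "x \<in> U" for x
    using Ck_on_Suc_has_derivative[OF Suc.prems(2) that] Suc.prems(1)
    by (rule has_derivative_transform_within_open[OF _ assms(1) that])
  then show ?case
    using Suc by (intro Ck_on_SucI[where f' = "\<lambda>x. frechet_derivative f (at x)"]) auto
qed

lemma Ck_on_Suc_intro:
  assumes "open U" "\<And>x. x \<in> U \<Longrightarrow> (f has_derivative f' x) (at x)"
    and "\<And>b. b \<in> Basis \<Longrightarrow> Ck_on k U (\<lambda>x. f' x b)"
  shows "Ck_on (Suc k) U f"
  using assms Ck_on_cong_imp[OF assms(1)] by (intro Ck_on_SucI) blast+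

lemma Ck_on_SucD: "Ck_on (Suc k) U f \<Longrightarrow> Ck_on k U f"
proof (induction k arbitrary: f)
  case 0
  then show ?case
    by (auto intro!: continuous_at_imp_continuous_on differentiable_imp_continuous_within)
qed auto

lemma Ck_on_imp_continuous_on: "Ck_on k U f \<Longrightarrow> continuous_on U f"
  by (induction k) (auto intro!: continuous_at_imp_continuous_on differentiable_imp_continuous_within)

lemma Ck_on_subset: "Ck_on k U f \<Longrightarrow> V \<subseteq> U \<Longrightarrow> Ck_on k V f"
  by (induction k arbitrary: f) (auto intro: continuous_on_subset)

lemma Ck_on_const: "open U \<Longrightarrow> Ck_on k U (\<lambda>x. c)"
proof (induction k arbitrary: c)
  case (Suc k)
  then show ?case
    by (intro Ck_on_Suc_intro[where f' = "\<lambda>x h. 0"]) auto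
qed simp

lemma Ck_on_linear:
  assumes "open U" "bounded_linear L" "Ck_on k U f"
  shows "Ck_on k U (\<lambda>x. L (f x))"
  using assms(3)
proof (induction k arbitrary: f)
  case 0
  then show ?case
    by (simp add: bounded_linear.continuous_on[OF assms(2)])
next
  case (Suc k)
  show ?case
    using Suc.IH Suc.prems Ck_on_Suc_has_derivative[OF Suc.prems]
    by (intro Ck_on_Suc_intro[OF assms(1), where f' = "\<lambda>x h. L (frechet_derivative f (at x) h)"])
      (auto intro!: bounded_linear.has_derivative[OF assms(2)])
qed

lemma Ck_on_id: "open U \<Longrightarrow> Ck_on k U (\<lambda>x. x)"
  by (cases k) (auto intro!: Ck_on_Suc_intro[where f' = "\<lambda>x h. h"] Ck_on_const)

lemma Ck_on_bounded_linear: "open U \<Longrightarrow> bounded_linear L \<Longrightarrow> Ck_on k U L"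
  using Ck_on_linear[OF _ _ Ck_on_id] by blast

lemma Ck_on_add:
  assumes "open U" "Ck_on k U f" "Ck_on k U g"
  shows "Ck_on k U (\<lambda>x. f x + g x)"
  using assms(2,3)
proof (induction k arbitrary: f g)
  case 0
  then show ?case by (simp add: continuous_on_add)
next
  case (Suc k)
  show ?case
    using Suc.IH Suc.prems has_derivative_add[OF Suc.prems[THEN Ck_on_Suc_has_derivative]]
    by (intro Ck_on_Suc_intro[OF assms(1), where f' = "\<lambda>x h. frechet_derivative f (at x) h + frechet_derivative g (at x) h"])
      auto
qed

lemma Ck_on_sum:
  assumes "open U" "\<And>i. i \<in> I \<Longrightarrow> Ck_on k U (f i)"
  shows "Ck_on k U (\<lambda>x. \<Sum>i\<in>I. f i x)"
  using assms(2)
  by (induction I rule: infinite_finite_induct) (auto simp: Ck_on_const Ck_on_add assms(1))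

lemma Ck_on_bilinear:
  assumes "open U" "bounded_bilinear B" "Ck_on k U f" "Ck_on k U g"
  shows "Ck_on k U (\<lambda>x. B (f x) (g x))"
  using assms(3,4)
proof (induction k arbitrary: f g)
  case 0
  then show ?case by (simp add: bounded_bilinear.continuous_on[OF assms(2)])
next
  case (Suc k)
  show ?case
    using Suc.IH Suc.prems Ck_on_SucD[OF Suc.prems(1)] Ck_on_SucD[OF Suc.prems(2)]
      bounded_bilinear.FDERIV[OF assms(2) Suc.prems[THEN Ck_on_Suc_has_derivative]]
    by (intro Ck_on_Suc_intro[OF assms(1),
          where f' = "\<lambda>x h. B (f x) (frechet_derivative g (at x) h) + B (frechet_derivative f (at x) h) (g x)"]
        Ck_on_add[OF assms(1)]) auto
qed

lemmas Ck_on_mult = Ck_on_bilinear[OF _ bounded_bilinear_mult]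
lemmas Ck_on_scaleR = Ck_on_bilinear[OF _ bounded_bilinear_scaleR]
lemmas Ck_on_inner = Ck_on_bilinear[OF _ bounded_bilinear_inner]

lemma Ck_on_uminus: "open U \<Longrightarrow> Ck_on k U f \<Longrightarrow> Ck_on k U (\<lambda>x. - f x)"
  using Ck_on_linear[OF _ bounded_linear_minus[OF bounded_linear_ident]] by fastforce

lemma Ck_on_diff: "open U \<Longrightarrow> Ck_on k U f \<Longrightarrow> Ck_on k U g \<Longrightarrow> Ck_on k U (\<lambda>x. f x - g x)"
  using Ck_on_add[of U k f "\<lambda>x. - g x"] Ck_on_uminus[of U k g] by simp

lemma Ck_on_prod:
  fixes f :: "'i \<Rightarrow> 'a::euclidean_space \<Rightarrow> real"
  assumes "open U" "\<And>i. i \<in> I \<Longrightarrow> Ck_on k U (f i)"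
  shows "Ck_on k U (\<lambda>x. \<Prod>i\<in>I. f i x)"
  using assms(2)
  by (induction I rule: infinite_finite_induct) (auto simp: Ck_on_const Ck_on_mult assms(1))

lemma linear_expand_Basis:
  fixes L :: "'a::euclidean_space \<Rightarrow> 'b::real_normed_vector"
  assumes "linear L"
  shows "L v = (\<Sum>c\<in>Basis. (v \<bullet> c) *\<^sub>R L c)"
  by (subst euclidean_representation[of v, symmetric])
    (simp add: linear_sum[OF assms] linear_cmul[OF assms])

text \<open>In the chain rule the direction in which \<open>f\<close> is differentiated varies with
  the point, so the derivative is not itself a composition with \<phi>. Expanding the direction in
  the basis gives a sum of products of partial derivatives of \<phi> with compositions, to which the
  induction hypothesis applies.\<close>

lemma Ck_on_compose:
  fixes \<phi> :: "'a::euclidean_space \<Rightarrow> 'b::euclidean_space" and f :: "'b \<Rightarrow> 'c::real_normed_vector"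
  assumes "open V" "open U" "\<phi> ` V \<subseteq> U" "Ck_on k V \<phi>" "Ck_on k U f"
  shows "Ck_on k V (\<lambda>x. f (\<phi> x))"
  using assms(4,5)
proof (induction k arbitrary: f)
  case 0
  then show ?case
    using assms(3) by (auto intro: continuous_on_compose2)
next
  case (Suc k)
  let ?f' = "\<lambda>y. frechet_derivative f (at y)" and ?\<phi>' = "\<lambda>x. frechet_derivative \<phi> (at x)"
  have expand: "?f' (\<phi> x) (?\<phi>' x h) = (\<Sum>c\<in>Basis. (?\<phi>' x h \<bullet> c) *\<^sub>R ?f' (\<phi> x) c)" if "x \<in> V" for x h
    using Ck_on_Suc_has_derivative[OF Suc.prems(2)] that assms(3)
    by (intro linear_expand_Basis has_derivative_linear) blast
  have "((\<lambda>x. f (\<phi> x)) has_derivative (\<lambda>h. ?f' (\<phi> x) (?\<phi>' x h))) (at x)" if "x \<in> V" for x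
    using Ck_on_Suc_has_derivative[OF Suc.prems(2), of "\<phi> x"]
      Ck_on_Suc_has_derivative[OF Suc.prems(1) that] that assms(3)
    by (auto intro!: has_derivative_compose[where f = \<phi> and g = f])
  moreover have "Ck_on k V (\<lambda>x. ?f' (\<phi> x) (?\<phi>' x b))" if "b \<in> Basis" for b
  proof (rule Ck_on_cong_imp[OF assms(1)])
    show "Ck_on k V (\<lambda>x. \<Sum>c\<in>Basis. (?\<phi>' x b \<bullet> c) *\<^sub>R ?f' (\<phi> x) c)"
      using Suc.prems that
      by (intro Ck_on_sum Ck_on_scaleR Ck_on_inner Ck_on_const assms(1)
          Suc.IH[OF Ck_on_SucD[OF Suc.prems(1)], where f = "\<lambda>y. ?f' y c" for c]) auto
  qed (simp add: expand)
  ultimately show ?case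
    by (intro Ck_on_Suc_intro[OF assms(1)])
qed

text \<open>The exponent is arbitrary because differentiation lowers it. Reciprocals and inverse
  square roots are later written as powers to fall under this one rule.\<close>

lemma Ck_on_powr: "Ck_on k {0<..} (\<lambda>t::real. t powr a)"
proof (induction k arbitrary: a)
  case 0
  then show ?case by (auto intro!: continuous_intros)
next
  case (Suc k)
  show ?case
  proof (rule Ck_on_Suc_intro[where f' = "\<lambda>t h. h * (a * t powr (a - 1))"])
    show "((\<lambda>t. t powr a) has_derivative (\<lambda>h. h * (a * t powr (a - 1)))) (at t)" if "t \<in> {0<..}" for t :: real
      using that has_real_derivative_powr[of t a] by (simp add: has_field_derivative_def mult_commute_abs)
    show "Ck_on k {0<..} (\<lambda>t. b * (a * t powr (a - 1)))" for b :: real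
      by (intro Ck_on_mult Ck_on_const Suc) auto
  qed auto
qed

text \<open>The derivatives of the standard flat function \<open>exp (- 1 / t)\<close> are combinations of these.\<close>

definition flat_pow :: "nat \<Rightarrow> real \<Rightarrow> real" where
  "flat_pow m t = (if t > 0 then inverse t ^ m * exp (- inverse t) else 0)"

lemma flat_pow_tendsto_0: "(flat_pow m \<longlongrightarrow> 0) (at 0)"
proof -
  have "((\<lambda>t::real. inverse t ^ m / exp (inverse t)) \<longlongrightarrow> 0) (at_right 0)"
    using filterlim_compose[OF tendsto_power_div_exp_0 filterlim_inverse_at_top_right] .
  then have "(flat_pow m \<longlongrightarrow> 0) (at_right 0)"
    by (rule Lim_transform_eventually)
      (auto simp: flat_pow_def exp_minus field_simps eventually_at_right_less intro!: eventually_at_rightI[of 0 1])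
  moreover have "(flat_pow m \<longlongrightarrow> 0) (at_left 0)"
    by (rule Lim_transform_eventually[OF tendsto_const])
      (auto simp: flat_pow_def intro!: eventually_at_leftI[of "-1" 0])
  ultimately show ?thesis
    by (simp add: filterlim_at_split)
qed

lemma has_derivative_flat_pow:
  "(flat_pow m has_real_derivative (flat_pow (m + 2) t - real m * flat_pow (m + 1) t)) (at t)"
proof (cases t "0 :: real" rule: linorder_cases)
  case less
  have "((\<lambda>t. 0) has_real_derivative 0) (at t)" by simp
  then show ?thesis
    using less by (subst DERIV_cong_ev[OF refl _ refl, where g = "\<lambda>t. 0"])
      (auto simp: flat_pow_def intro!: eventually_nhds_in_open[of "{..<0}", THEN eventually_mono])
next
  case equal
  \<comment> \<open>The difference quotient at 0 is \<open>flat_pow (Suc m)\<close>, again a member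
    of the family, so its limit is already known.\<close>
  have "((\<lambda>h. flat_pow m h / h) \<longlongrightarrow> 0) (at 0)"
    by (rule Lim_transform_eventually[OF flat_pow_tendsto_0[of "Suc m"]])
      (auto simp: flat_pow_def field_simps)
  then show ?thesis
    using equal by (auto simp: DERIV_def flat_pow_def)
next
  case greater
  have "((\<lambda>t. inverse t ^ m * exp (- inverse t)) has_real_derivative
      (flat_pow (m + 2) t - real m * flat_pow (m + 1) t)) (at t)"
  proof -
    have inv: "(inverse has_real_derivative - (inverse t ^ 2)) (at t)"
      using DERIV_inverse[of t] greater by (simp add: numeral_2_eq_2)
    have pow: "((\<lambda>t. inverse t ^ m) has_real_derivative - real m * inverse t ^ (m + 1)) (at t)"
      using DERIV_power[OF inv, of m] by (cases m) (auto simp: algebra_simps power2_eq_square)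
    have "((\<lambda>t. exp (- inverse t)) has_real_derivative exp (- inverse t) * inverse t ^ 2) (at t)"
      using DERIV_fun_exp[OF DERIV_minus[OF inv]] by simp
    from DERIV_mult[OF pow this] show ?thesis
      using greater by (simp add: flat_pow_def algebra_simps power2_eq_square)
  qed
  then show ?thesis
    using greater by (subst DERIV_cong_ev[OF refl _ refl, where g = "\<lambda>t. inverse t ^ m * exp (- inverse t)"])
      (auto simp: flat_pow_def intro!: eventually_nhds_in_open[of "{0<..}", THEN eventually_mono])
qed

lemma Ck_on_flat_pow: "Ck_on k UNIV (flat_pow m)"
proof (induction k arbitrary: m)
  case 0
  then show ?case
    using has_derivative_flat_pow by (auto intro!: DERIV_continuous_on)
next
  case (Suc k)
  show ?case
    using has_derivative_flat_pow
    by (intro Ck_on_Suc_intro[where f' = "\<lambda>t h. h * (flat_pow (m + 2) t - real m * flat_pow (m + 1) t)"]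
        Ck_on_mult Ck_on_diff Ck_on_const Suc)
      (auto simp: has_field_derivative_def mult_commute_abs)
qed

definition flat :: "real \<Rightarrow> real" where
  "flat t = (if t > 0 then exp (- inverse t) else 0)"

lemma Ck_on_flat: "open U \<Longrightarrow> Ck_on k U f \<Longrightarrow> Ck_on k U (\<lambda>x. flat (f x))"
proof -
  have "flat = flat_pow 0" by (auto simp: flat_def flat_pow_def)
  then show "open U \<Longrightarrow> Ck_on k U f \<Longrightarrow> Ck_on k U (\<lambda>x. flat (f x))"
    using Ck_on_compose[of U UNIV f k flat] Ck_on_flat_pow[of k 0] by simp
qed

lemma flat_bounds: "0 \<le> flat t" "flat t \<le> 1"
  by (auto simp: flat_def)

lemma flat_pos_iff: "flat t > 0 \<longleftrightarrow> t > 0"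
  by (auto simp: flat_def)

text \<open>Since \<open>flat\<close> vanishes at 0, the limit is the indicator of the open
  half-line at every point, including 0. Products of such functions therefore approximate open boxes
  everywhere.\<close>

lemma flat_mult_tendsto: "(\<lambda>n. flat (real (Suc n) * t)) \<longlonglongrightarrow> indicator {0<..} t"
proof (cases "t > 0")
  case True
  have "(\<lambda>n. inverse (real (Suc n)) * inverse t) \<longlonglongrightarrow> 0"
    using tendsto_mult_right[OF LIMSEQ_inverse_real_of_nat, of "inverse t"] by simp
  then have "(\<lambda>n. exp (- (inverse (real (Suc n)) * inverse t))) \<longlonglongrightarrow> exp (- 0)"
    by (intro tendsto_intros)
  then show ?thesis
    using True by (simp add: flat_def inverse_mult_distrib del: of_nat_Suc)
next
  case False
  then show ?thesis
    by (simp add: flat_def zero_less_mult_iff del: of_nat_Suc)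
qed

lemma Ck_on_powr_compose:
  fixes f :: "'a::euclidean_space \<Rightarrow> real"
  assumes "open U" "Ck_on k U f" "\<And>x. x \<in> U \<Longrightarrow> f x > 0"
  shows "Ck_on k U (\<lambda>x. f x powr a)"
  using Ck_on_compose[OF assms(1) _ _ assms(2) Ck_on_powr[of k a]] assms(3) by auto

lemma Ck_on_Un:
  assumes "open U" "open V" "Ck_on k U f" "Ck_on k V f"
  shows "Ck_on k (U \<union> V) f"
  using assms(3,4)
proof (induction k arbitrary: f)
  case 0
  then show ?case using continuous_on_open_Un[OF assms(1,2)] by simp
next
  case (Suc k)
  then show ?case by (simp add: ball_Un)
qed

text \<open>\<open>U\<close> and the complement of \<open>C\<close> are open sets covering the
  space, and the extended function is zero on the second.\<close>

lemma Ck_on_extend_by_0: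
  assumes "open U" "closed C" "C \<subseteq> U" "Ck_on k U f" "\<And>x. x \<in> U - C \<Longrightarrow> f x = 0"
  shows "Ck_on k UNIV (\<lambda>x. if x \<in> U then f x else 0)"
proof -
  have "Ck_on k U (\<lambda>x. if x \<in> U then f x else 0)"
    by (rule Ck_on_cong_imp[OF assms(1) _ assms(4)]) auto
  moreover have "Ck_on k (- C) (\<lambda>x. if x \<in> U then f x else 0)"
    using assms(2,5) by (intro Ck_on_cong_imp[OF _ _ Ck_on_const[of _ _ 0]]) auto
  ultimately have "Ck_on k (U \<union> - C) (\<lambda>x. if x \<in> U then f x else 0)"
    using assms(1,2) by (intro Ck_on_Un) auto
  moreover have "U \<union> - C = UNIV" using assms(3) by auto
  ultimately show ?thesis by simp
qed

section \<open>The boundary surface\<close>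

lemma frechet_derivative_grad:
  assumes "f differentiable (at x)"
  shows "frechet_derivative f (at x) h = grad f x \<bullet> h"
proof -
  have lin: "linear (frechet_derivative f (at x))"
    using assms by (rule linear_frechet_derivative)
  have "frechet_derivative f (at x) h = frechet_derivative f (at x) (\<Sum>i\<in>UNIV. h $ i *\<^sub>R axis i 1)"
    using basis_expansion[of h] by (simp add: scalar_mult_eq_scaleR)
  also have "\<dots> = (\<Sum>i\<in>UNIV. h $ i * frechet_derivative f (at x) (axis i 1))"
    by (simp add: linear_sum[OF lin] linear_cmul[OF lin])
  finally show ?thesis
    by (simp add: grad_def inner_vec_def mult.commute)
qed

lemma has_derivative_grad:
  "f differentiable (at x) \<Longrightarrow> (f has_derivative (\<lambda>h. grad f x \<bullet> h)) (at x)"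
  using frechet_derivative_grad[of f x] frechet_derivative_works[of f "at x"] by (metis (no_types, lifting) ext)

lemma grad_unique:
  assumes "(f has_derivative (\<lambda>h. g \<bullet> h)) (at x)"
  shows "grad f x = g"
  using frechet_derivative_at[OF assms, symmetric]
  by (simp add: grad_def vec_eq_iff inner_axis)

lemma Ck_on_grad:
  assumes "open U" "Ck_on (Suc k) U f"
  shows "Ck_on k U (grad f)"
proof -
  have "Ck_on k U (\<lambda>x. \<Sum>i\<in>UNIV. frechet_derivative f (at x) (axis i 1) *\<^sub>R (axis i 1 :: real^3))"
    using assms by (intro Ck_on_sum Ck_on_scaleR Ck_on_const) (auto simp: axis_in_Basis_iff)
  moreover have "(\<Sum>i\<in>UNIV. frechet_derivative f (at x) (axis i 1) *\<^sub>R (axis i 1 :: real^3)) = grad f x" for x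
    by (simp add: vec_eq_iff grad_def axis_def if_distrib cong: if_cong)
  ultimately show ?thesis by simp
qed

lemma descent_direction:
  assumes "f differentiable (at x)" "grad f x \<bullet> v < 0"
  shows "\<exists>d>0. \<forall>t. 0 < t \<longrightarrow> t < d \<longrightarrow> f (x + t *\<^sub>R v) < f x"
proof -
  have "((\<lambda>t. x + t *\<^sub>R v) has_derivative (\<lambda>t. t *\<^sub>R v)) (at 0)"
    by (auto intro!: derivative_eq_intros)
  then have "((\<lambda>t. f (x + t *\<^sub>R v)) has_derivative (\<lambda>t. grad f x \<bullet> (t *\<^sub>R v))) (at 0)"
    by (rule has_derivative_compose) (use has_derivative_grad[OF assms(1)] in simp)
  then have "((\<lambda>t. f (x + t *\<^sub>R v)) has_real_derivative (grad f x \<bullet> v)) (at 0)"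
    by (simp add: has_field_derivative_def mult_commute_abs)
  from DERIV_neg_dec_right[OF this assms(2)] show ?thesis by auto
qed

lemma eventually_segment_in_open:
  fixes x v :: "'a::real_normed_vector"
  assumes "open U" "x \<in> U"
  shows "\<exists>d>0. \<forall>t. 0 < t \<longrightarrow> t < d \<longrightarrow> x + t *\<^sub>R v \<in> U"
proof -
  have "((\<lambda>t. x + t *\<^sub>R v) \<longlongrightarrow> x + 0 *\<^sub>R v) (at_right 0)"
    by (intro tendsto_intros)
  then have "\<forall>\<^sub>F t in at_right 0. x + t *\<^sub>R v \<in> U"
    using assms by (auto dest: topological_tendstoD)
  then show ?thesis by (auto simp: eventually_at_right[of 0 1])
qed

lemma local_defining_functionD:
  assumes "local_defining_function D U \<rho>" "x \<in> U"
  shows "open U" "\<rho> differentiable (at x)" "grad \<rho> x \<noteq> 0" "x \<in> D \<longleftrightarrow> \<rho> x < 0" "Ck_on k U \<rho>"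
proof -
  show "open U" "grad \<rho> x \<noteq> 0" "x \<in> D \<longleftrightarrow> \<rho> x < 0" "Ck_on k U \<rho>"
    using assms by (auto simp: local_defining_function_def smooth_on_def)
  have "Ck_on (Suc 0) U \<rho>"
    using assms by (auto simp: local_defining_function_def smooth_on_def simp del: Ck_on.simps)
  then show "\<rho> differentiable (at x)"
    using assms by auto
qed

text \<open>The definition only gives the sign of \<rho> on \<open>D\<close> and off it. Continuity
  rules out frontier points with positive value; a zero is a limit of points of \<open>D\<close>
  because \<rho> decreases along its negative gradient, which does not vanish.\<close>

lemma frontier_iff_defining_zero:
  assumes "open D" "local_defining_function D U \<rho>" "x \<in> U"
  shows "x \<in> frontier D \<longleftrightarrow> \<rho> x = 0"
proof -
  note ldf = local_defining_functionD[OF assms(2)]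
  have U: "open U" using ldf(1)[OF assms(3)] .
  have front: "x \<in> frontier D \<longleftrightarrow> x \<in> closure D \<and> x \<notin> D"
    using assms(1) by (simp add: frontier_def interior_open)
  show ?thesis
  proof
    assume x: "x \<in> frontier D"
    then have "\<rho> x \<ge> 0" using front ldf(4)[OF assms(3)] by auto
    moreover have False if "\<rho> x > 0"
    proof -
      have "continuous_on U \<rho>" using ldf(5)[OF assms(3)] by (rule Ck_on_imp_continuous_on)
      then have "open (U \<inter> \<rho> -` {0<..})"
        using U by (intro continuous_open_preimage) auto
      moreover have "x \<in> U \<inter> \<rho> -` {0<..}" using that assms(3) by auto
      moreover have "(U \<inter> \<rho> -` {0<..}) \<inter> D = {}"
        using ldf(4) by fastforce
      ultimately show False
        using x front open_Int_closure_eq_empty[of "U \<inter> \<rho> -` {0<..}" D] by blast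
    qed
    ultimately show "\<rho> x = 0" by fastforce
  next
    assume 0: "\<rho> x = 0"
    let ?v = "- grad \<rho> x"
    obtain d1 where d1: "d1 > 0" "\<And>t. 0 < t \<Longrightarrow> t < d1 \<Longrightarrow> \<rho> (x + t *\<^sub>R ?v) < \<rho> x"
      using descent_direction[OF ldf(2)[OF assms(3)], of ?v] ldf(3)[OF assms(3)] by auto
    obtain d2 where d2: "d2 > 0" "\<And>t. 0 < t \<Longrightarrow> t < d2 \<Longrightarrow> x + t *\<^sub>R ?v \<in> U"
      using eventually_segment_in_open[OF U assms(3)] by blast
    have "x \<in> closure D"
    proof (subst closure_approachable, intro allI impI)
      fix e :: real assume "e > 0"
      define d3 where "d3 = e / norm ?v"
      have "d3 > 0" using \<open>e > 0\<close> ldf(3)[OF assms(3)] by (simp add: d3_def)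
      define t where "t = min (min d1 d2) d3 / 2"
      have t: "0 < t" "t < d1" "t < d2" "t < d3"
        using d1(1) d2(1) \<open>d3 > 0\<close> by (auto simp: t_def min_def)
      then have "x + t *\<^sub>R ?v \<in> D"
        using d1(2)[OF t(1,2)] d2(2)[OF t(1,3)] ldf(4) 0 by auto
      moreover have "dist (x + t *\<^sub>R ?v) x < e"
        using t ldf(3)[OF assms(3)] by (simp add: dist_norm d3_def field_simps)
      ultimately show "\<exists>y\<in>D. dist y x < e" by blast
    qed
    then show "x \<in> frontier D" using front ldf(4)[OF assms(3)] 0 by simp
  qed
qed

text \<open>For distinct unit gradients \<open>n1\<close> and \<open>n2\<close>, the direction
  \<open>n2 - n1\<close> makes an obtuse angle with \<open>n1\<close> and an acute one with
  \<open>n2\<close>. A short step along it would lie inside \<open>D\<close> according to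
  \<open>\<rho>1\<close> and outside according to \<open>\<rho>2\<close>. This makes the description
  in \<open>outward_normal\<close> definite.\<close>

lemma unit_normal_unique:
  assumes D: "open D" and x: "x \<in> frontier D" and "x \<in> U1" "x \<in> U2"
    and ldf: "local_defining_function D U1 \<rho>1" "local_defining_function D U2 \<rho>2"
  shows "grad \<rho>1 x /\<^sub>R norm (grad \<rho>1 x) = grad \<rho>2 x /\<^sub>R norm (grad \<rho>2 x)"
proof (rule ccontr)
  note l1 = local_defining_functionD[OF ldf(1)] and l2 = local_defining_functionD[OF ldf(2)]
  let ?g1 = "grad \<rho>1 x" and ?g2 = "grad \<rho>2 x"
  define n1 where "n1 = ?g1 /\<^sub>R norm ?g1"
  define n2 where "n2 = ?g2 /\<^sub>R norm ?g2"
  assume "?g1 /\<^sub>R norm ?g1 \<noteq> ?g2 /\<^sub>R norm ?g2"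
  then have ne: "n1 \<noteq> n2" by (simp add: n1_def n2_def)
  have g: "?g1 \<noteq> 0" "?g2 \<noteq> 0" using l1(3) l2(3) assms by auto
  have unit: "n1 \<bullet> n1 = 1" "n2 \<bullet> n2 = 1"
    using g by (auto simp: n1_def n2_def dot_square_norm power2_eq_square divide_simps)
  have "(n2 - n1) \<bullet> (n2 - n1) > 0" using ne by simp
  then have lt1: "n1 \<bullet> n2 < 1"
    using unit by (simp add: inner_diff inner_commute)
  let ?v = "n2 - n1"
  have g_n: "?g1 = norm ?g1 *\<^sub>R n1" "?g2 = norm ?g2 *\<^sub>R n2"
    using g by (auto simp: n1_def n2_def)
  have neg1: "?g1 \<bullet> ?v < 0"
    using g lt1 unit by (subst g_n(1)) (simp add: inner_diff_right mult_pos_neg)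
  have neg2: "?g2 \<bullet> (- ?v) < 0"
    using g lt1 unit by (subst g_n(2)) (simp add: inner_diff_right inner_commute mult_pos_neg)
  have "(\<lambda>y. - \<rho>2 y) differentiable (at x)" "grad (\<lambda>y. - \<rho>2 y) x = - ?g2"
    using has_derivative_minus[OF has_derivative_grad[OF l2(2)[OF assms(4)]]]
    by (auto simp: differentiable_def intro!: grad_unique)
  then obtain d2 where d2: "d2 > 0" "\<And>t. 0 < t \<Longrightarrow> t < d2 \<Longrightarrow> - \<rho>2 (x + t *\<^sub>R ?v) < - \<rho>2 x"
    using descent_direction[of "\<lambda>y. - \<rho>2 y" x ?v] neg2 by (auto simp: inner_diff_right)
  obtain d1 where d1: "d1 > 0" "\<And>t. 0 < t \<Longrightarrow> t < d1 \<Longrightarrow> \<rho>1 (x + t *\<^sub>R ?v) < \<rho>1 x"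
    using descent_direction[OF l1(2)[OF assms(3)] neg1] by auto
  obtain d3 where d3: "d3 > 0" "\<And>t. 0 < t \<Longrightarrow> t < d3 \<Longrightarrow> x + t *\<^sub>R ?v \<in> U1 \<inter> U2"
    using eventually_segment_in_open[of "U1 \<inter> U2" x ?v] l1(1) l2(1) assms(3,4) by blast
  define t where "t = min (min d1 d2) d3 / 2"
  have t: "0 < t" "t < d1" "t < d2" "t < d3"
    using d1(1) d2(1) d3(1) by (auto simp: t_def min_def)
  have "\<rho>1 x = 0" "\<rho>2 x = 0"
    using frontier_iff_defining_zero[OF D ldf(1) assms(3)] frontier_iff_defining_zero[OF D ldf(2) assms(4)] x by auto
  then have "x + t *\<^sub>R ?v \<in> D" "x + t *\<^sub>R ?v \<notin> D"
    using d1(2)[OF t(1,2)] d2(2)[OF t(1,3)] d3(2)[OF t(1,4)] l1(4) l2(4) by force+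
  then show False by simp
qed

lemma outward_normal_eq:
  assumes "open D" "x \<in> frontier D" "x \<in> U" "local_defining_function D U \<rho>"
  shows "outward_normal D x = grad \<rho> x /\<^sub>R norm (grad \<rho> x)"
  unfolding outward_normal_def
  using assms unit_normal_unique[OF assms(1,2)] by (intro the_equality) blast+

text \<open>Average the normalized gradients of local defining functions with bump functions.\<close>

lemma smooth_normal_extension:
  assumes "bounded_smooth_domain D"
  obtains W N where "open W" "frontier D \<subseteq> W" "smooth_on W N"
    "\<And>y. y \<in> frontier D \<Longrightarrow> N y = outward_normal D y"
proof -
  have D: "open D" "bounded D" and
    "\<forall>x\<in>frontier D. \<exists>U \<rho>. x \<in> U \<and> local_defining_function D U \<rho>"
    using assms by (auto simp: bounded_smooth_domain_def)
  then obtain U \<rho> where U: "\<And>x. x \<in> frontier D \<Longrightarrow> x \<in> U x"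
    "\<And>x. x \<in> frontier D \<Longrightarrow> local_defining_function D (U x) (\<rho> x)"
    by metis
  have opU: "open (U x)" if "x \<in> frontier D" for x
    using U that local_defining_functionD(1) by blast
  have "\<exists>r>0. cball x r \<subseteq> U x" if "x \<in> frontier D" for x
    using opU[OF that] U(1)[OF that] open_contains_cball by blast
  then obtain r where r: "\<And>x. x \<in> frontier D \<Longrightarrow> r x > 0" "\<And>x. x \<in> frontier D \<Longrightarrow> cball x (r x) \<subseteq> U x"
    by metis
  have comp: "compact (frontier D)" using D(2) by (rule compact_frontier_bounded)
  have cover: "frontier D \<subseteq> (\<Union>x\<in>frontier D. ball x (r x))" using r(1) by auto
  obtain F where F: "F \<subseteq> frontier D" "finite F" "frontier D \<subseteq> (\<Union>x\<in>F. ball x (r x))"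
    by (rule compactE_image[OF comp _ cover]) auto
  define bump where "bump x y = flat ((r x)\<^sup>2 - (y - x) \<bullet> (y - x))" for x y
  \<comment> \<open>The reciprocal of the norm is written as a power of the inner product, to which
    the calculus rules apply. The bump vanishes off \<open>cball x (r x)\<close>, a closed subset of
    \<open>U x\<close>, so the extension by 0 is smooth.\<close>
  define n where "n x y = (if y \<in> U x then bump x y *\<^sub>R
      ((grad (\<rho> x) y \<bullet> grad (\<rho> x) y) powr (- 1 / 2)) *\<^sub>R grad (\<rho> x) y else 0)" for x y
  define wt where "wt y = (\<Sum>x\<in>F. bump x y)" for y
  define N where "N y = (wt y powr (- 1)) *\<^sub>R (\<Sum>x\<in>F. n x y)" for y
  have bump_pos: "bump x y > 0 \<longleftrightarrow> y \<in> ball x (r x)" if "x \<in> frontier D" for x y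
  proof -
    have "bump x y > 0 \<longleftrightarrow> (norm (y - x))\<^sup>2 < (r x)\<^sup>2"
      by (simp add: bump_def flat_pos_iff dot_square_norm)
    also have "\<dots> \<longleftrightarrow> norm (y - x) < r x"
      using r(1)[OF that] by (meson less_eq_real_def norm_ge_zero power2_less_imp_less power_strict_mono zero_less_numeral)
    finally show ?thesis by (simp add: dist_norm norm_minus_commute)
  qed
  have bump_nonneg: "bump x y \<ge> 0" for x y by (simp add: bump_def flat_bounds)
  have Ck_bump: "Ck_on k UNIV (bump x)" for k x
    unfolding bump_def by (intro Ck_on_flat Ck_on_diff Ck_on_const Ck_on_inner Ck_on_id) auto
  have Ck_n: "Ck_on k UNIV (n x)" if x: "x \<in> frontier D" for k x
    unfolding n_def
  proof (rule Ck_on_extend_by_0[OF opU[OF x] closed_cball r(2)[OF x]])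
    have "Ck_on k (U x) (grad (\<rho> x))"
      using Ck_on_grad[OF opU[OF x]] local_defining_functionD(5)[OF U(2) U(1)] x by blast
    then show "Ck_on k (U x) (\<lambda>y. bump x y *\<^sub>R
        ((grad (\<rho> x) y \<bullet> grad (\<rho> x) y) powr (- 1 / 2)) *\<^sub>R grad (\<rho> x) y)"
      using opU[OF x] local_defining_functionD(3)[OF U(2)] x
      by (intro Ck_on_scaleR Ck_on_powr_compose Ck_on_inner Ck_on_subset[OF Ck_bump]) auto
    show "bump x y *\<^sub>R ((grad (\<rho> x) y \<bullet> grad (\<rho> x) y) powr (- 1 / 2)) *\<^sub>R grad (\<rho> x) y = 0"
      if "y \<in> U x - cball x (r x)" for y
      using bump_pos[OF x, of y] bump_nonneg[of x y] that by force
  qed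
  have n_front: "n x y = bump x y *\<^sub>R outward_normal D y" if x: "x \<in> frontier D" and y: "y \<in> frontier D" for x y
  proof (cases "y \<in> U x")
    case True
    let ?g = "grad (\<rho> x) y"
    have "?g \<bullet> ?g = norm ?g powr 2"
      by (simp add: dot_square_norm)
    then have "(?g \<bullet> ?g) powr (- 1 / 2) = inverse (norm ?g)"
      by (simp add: powr_powr powr_minus)
    then show ?thesis
      using outward_normal_eq[OF D(1) y True U(2)[OF x]] True by (simp add: n_def)
  next
    case False
    then have "bump x y = 0"
      using bump_pos[OF x, of y] bump_nonneg[of x y] r(2)[OF x] by force
    then show ?thesis using False by (simp add: n_def)
  qed
  define W where "W = wt -` {0<..}"
  have Ck_wt: "Ck_on k UNIV wt" for k
    unfolding wt_def by (intro Ck_on_sum Ck_bump) auto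
  have opW: "open W"
    using open_vimage[OF open_greaterThan Ck_on_imp_continuous_on[OF Ck_wt]] by (auto simp: W_def)
  show ?thesis
  proof
    show "open W" by (rule opW)
    show sub: "frontier D \<subseteq> W"
    proof
      fix y assume "y \<in> frontier D"
      then obtain x where "x \<in> F" "bump x y > 0" using F bump_pos by blast
      then have "wt y > 0" unfolding wt_def using F(2) bump_nonneg by (intro sum_pos2[where i = x]) auto
      then show "y \<in> W" by (simp add: W_def)
    qed
    show "smooth_on W N"
      unfolding smooth_on_def N_def using opW F(1)
      by (intro conjI allI Ck_on_scaleR Ck_on_powr_compose Ck_on_sum Ck_on_subset[OF Ck_wt]
          Ck_on_subset[OF Ck_n]) (auto simp: W_def)
    show "N y = outward_normal D y" if y: "y \<in> frontier D" for y
    proof -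
      have "(\<Sum>x\<in>F. n x y) = wt y *\<^sub>R outward_normal D y"
        unfolding wt_def scaleR_sum_left using F(1) y by (intro sum.cong n_front) auto
      moreover have "wt y > 0" using sub y by (auto simp: W_def)
      ultimately show ?thesis by (simp add: N_def powr_minus)
    qed
  qed
qed

lemma norm_outward_normal:
  assumes "bounded_smooth_domain D" "x \<in> frontier D"
  shows "norm (outward_normal D x) = 1"
proof -
  obtain U \<rho> where "x \<in> U" "local_defining_function D U \<rho>" "open D"
    using assms unfolding bounded_smooth_domain_def by blast
  then show ?thesis
    using outward_normal_eq[of D x U \<rho>] local_defining_functionD(3)[of D U \<rho> x] assms by simp
qed

section \<open>Graph patches\<close>

definition proj2 :: "real^3 \<Rightarrow> real^3 \<Rightarrow> real^3 \<Rightarrow> real^2" where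
  "proj2 a b x = vector [x \<bullet> a, x \<bullet> b]"

text \<open>A graph over the plane spanned by \<open>a\<close> and \<open>b\<close>: the chart is
  inverted by the restriction of an orthogonal projection, which is linear and does not increase
  distances. Boundedness of \<open>V\<close> and of the area element makes the area of each patch
  finite.\<close>

definition graph_patch ::
    "(real^3) set \<Rightarrow> (real^3) set \<Rightarrow> (real^2) set \<Rightarrow> (real^2 \<Rightarrow> real^3) \<Rightarrow> real^3 \<Rightarrow> real^3 \<Rightarrow> bool" where
  "graph_patch S B V \<phi> a b \<longleftrightarrow>
     open B \<and> bounded V \<and> smooth_on V \<phi> \<and> \<phi> ` V = S \<inter> B \<and>
     norm a = 1 \<and> norm b = 1 \<and> a \<bullet> b = 0 \<and> (\<forall>u\<in>V. proj2 a b (\<phi> u) = u) \<and>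
     (\<exists>C. \<forall>u\<in>V. area_element \<phi> u \<le> C)"

lemma proj2_nth [simp]: "proj2 a b x $ 1 = x \<bullet> a" "proj2 a b x $ 2 = x \<bullet> b"
  by (simp_all add: proj2_def)

lemma bounded_linear_proj2: "bounded_linear (proj2 a b)"
  by (intro linear_conv_bounded_linear[THEN iffD1] linearI)
    (simp_all add: vec_eq_iff forall_2 inner_left_distrib)

text \<open>Bessel's inequality for the orthonormal pair \<open>a\<close>, \<open>b\<close>. It
  bounds distances on a patch from below by distances in the parameter plane.\<close>

lemma dist_proj2_le:
  assumes "norm a = 1" "norm b = 1" "a \<bullet> b = 0"
  shows "dist (proj2 a b x) (proj2 a b y) \<le> dist x y"
proof -
  define z where "z = x - y"
  have aa: "a \<bullet> a = 1" "b \<bullet> b = 1" "b \<bullet> a = 0"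
    using assms by (simp_all add: dot_square_norm inner_commute)
  have "0 \<le> (z - (z \<bullet> a) *\<^sub>R a - (z \<bullet> b) *\<^sub>R b) \<bullet> (z - (z \<bullet> a) *\<^sub>R a - (z \<bullet> b) *\<^sub>R b)"
    by simp
  also have "\<dots> = z \<bullet> z - (z \<bullet> a)\<^sup>2 - (z \<bullet> b)\<^sup>2"
    using aa assms(3) by (simp add: inner_diff inner_commute power2_eq_square algebra_simps)
  finally have "(z \<bullet> a)\<^sup>2 + (z \<bullet> b)\<^sup>2 \<le> (norm z)\<^sup>2"
    by (simp add: dot_square_norm)
  moreover have "(norm (proj2 a b z))\<^sup>2 = (z \<bullet> a)\<^sup>2 + (z \<bullet> b)\<^sup>2"
    unfolding power2_norm_eq_inner inner_vec_def[of "proj2 a b z"] by (simp add: sum_2 power2_eq_square)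
  ultimately have "norm (proj2 a b z) \<le> norm z"
    by (simp add: power2_le_imp_le)
  then show ?thesis
    by (simp add: z_def dist_norm linear_diff[OF bounded_linear.linear[OF bounded_linear_proj2], symmetric])
qed

text \<open>The Binet-Cauchy identity.\<close>

lemma dot_cross_cross: "cross3 x y \<bullet> cross3 z w = (x \<bullet> z) * (y \<bullet> w) - (x \<bullet> w) * (y \<bullet> z)"
  by (simp add: cross3_simps)

lemma smooth_on_has_derivative:
  assumes "smooth_on V \<phi>" "u \<in> V"
  shows "(\<phi> has_derivative frechet_derivative \<phi> (at u)) (at u)"
  using assms Ck_on_Suc_has_derivative[of 0 V \<phi> u] by (auto simp: smooth_on_def simp del: Ck_on.simps)

lemma graph_patchD:
  assumes "graph_patch S B V \<phi> a b"
  shows "open B" "open V" "bounded V" "smooth_on V \<phi>" "\<phi> ` V = S \<inter> B" "inj_on \<phi> V"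
    "norm a = 1" "norm b = 1" "a \<bullet> b = 0" "\<And>u. u \<in> V \<Longrightarrow> proj2 a b (\<phi> u) = u"
    "\<And>y. y \<in> S \<inter> B \<Longrightarrow> proj2 a b y \<in> V \<and> \<phi> (proj2 a b y) = y"
    "continuous_on V \<phi>"
proof -
  show "open B" "open V" "bounded V" "smooth_on V \<phi>" "\<phi> ` V = S \<inter> B"
    "norm a = 1" "norm b = 1" "a \<bullet> b = 0"
    using assms by (auto simp: graph_patch_def smooth_on_def)
  show pr: "proj2 a b (\<phi> u) = u" if "u \<in> V" for u
    using assms that by (auto simp: graph_patch_def)
  show "inj_on \<phi> V" by (metis pr inj_onI)
  show "proj2 a b y \<in> V \<and> \<phi> (proj2 a b y) = y" if "y \<in> S \<inter> B" for y
    using assms that pr by (force simp: graph_patch_def)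
  have "Ck_on 0 V \<phi>"
    using assms unfolding graph_patch_def smooth_on_def by blast
  then show "continuous_on V \<phi>" by simp
qed

text \<open>Differentiating the identity \<open>proj2 a b (\<phi> u) = u\<close> fixes the
  \<open>a\<close> and \<open>b\<close> components of the partial derivatives. By the Binet-Cauchy
  identity their cross product then has inner product 1 with \<open>cross3 a b\<close>.\<close>

lemma graph_patch_regular:
  assumes "graph_patch S B V \<phi> a b"
  shows "regular_parametrization S V \<phi>"
proof -
  note g = graph_patchD[OF assms]
  have "area_element \<phi> u \<noteq> 0" if u: "u \<in> V" for u
  proof -
    let ?\<phi>' = "frechet_derivative \<phi> (at u)"
    have "((\<lambda>v. proj2 a b (\<phi> v)) has_derivative (\<lambda>h. proj2 a b (?\<phi>' h))) (at u)"
      by (rule bounded_linear.has_derivative[OF bounded_linear_proj2 smooth_on_has_derivative[OF g(4) u]])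
    then have "((\<lambda>v. v) has_derivative (\<lambda>h. proj2 a b (?\<phi>' h))) (at u)"
      by (rule has_derivative_transform_within_open[OF _ g(2) u g(10)])
    then have id: "(\<lambda>h. proj2 a b (?\<phi>' h)) = (\<lambda>h. h)"
      by (rule has_derivative_unique) (rule has_derivative_ident)
    have "?\<phi>' h \<bullet> a = h $ 1" "?\<phi>' h \<bullet> b = h $ 2" for h
      using fun_cong[OF id, of h] by (metis proj2_nth)+
    then have "cross3 (?\<phi>' (axis 1 1)) (?\<phi>' (axis 2 1)) \<bullet> cross3 a b = 1"
      by (simp add: dot_cross_cross axis_def)
    then show ?thesis by (auto simp: area_element_def)
  qed
  then show ?thesis
    using g by (auto simp: regular_parametrization_def)
qed

lemma adapted_frame:
  fixes g :: "real^3"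
  assumes "g \<noteq> 0"
  obtains a b c where "norm a = 1" "norm b = 1" "norm c = 1" "a \<bullet> b = 0" "a \<bullet> c = 0" "b \<bullet> c = 0"
    "g \<bullet> c > 0" "\<And>x. x = (x \<bullet> a) *\<^sub>R a + (x \<bullet> b) *\<^sub>R b + (x \<bullet> c) *\<^sub>R c"
proof -
  obtain i j k :: 3 where ijk: "g $ i \<noteq> 0" "i \<noteq> j" "i \<noteq> k" "j \<noteq> k" "\<And>l. l = i \<or> l = j \<or> l = k"
  proof -
    obtain i where i: "g $ i \<noteq> 0" using assms by (auto simp: vec_eq_iff)
    consider "i = 1" | "i = 2" | "i = 3" using exhaust_3 by blast
    then show ?thesis
    proof cases
      case 1
      then show ?thesis using i exhaust_3 by (intro that[of 1 2 3]) auto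
    next
      case 2
      then show ?thesis using i exhaust_3 by (intro that[of 2 3 1]) auto
    next
      case 3
      then show ?thesis using i exhaust_3 by (intro that[of 3 1 2]) auto
    qed
  qed
  \<comment> \<open>A coordinate axis along which \<open>g\<close> has a nonzero component serves as
    height direction, with the sign that makes \<open>g \<bullet> c\<close> positive; the other two
    axes complete the frame.\<close>
  let ?a = "axis j 1 :: real^3" and ?b = "axis k 1 :: real^3" and ?c = "sgn (g $ i) *\<^sub>R axis i 1 :: real^3"
  have "x = (x \<bullet> ?a) *\<^sub>R ?a + (x \<bullet> ?b) *\<^sub>R ?b + (x \<bullet> ?c) *\<^sub>R ?c" for x
  proof -
    have *: "x \<bullet> ?a = x $ j" "x \<bullet> ?b = x $ k" "x \<bullet> ?c = sgn (g $ i) * x $ i"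
      by (simp_all add: inner_axis)
    have "x $ l = ((x \<bullet> ?a) *\<^sub>R ?a + (x \<bullet> ?b) *\<^sub>R ?b + (x \<bullet> ?c) *\<^sub>R ?c) $ l" for l
      using ijk(5)[of l] ijk(1-4) unfolding * by (auto simp: axis_def sgn_real_def)
    then show ?thesis by (simp add: vec_eq_iff)
  qed
  moreover have "axis j 1 $ k = (0 :: real)" "axis j 1 $ i = (0 :: real)" "axis k 1 $ i = (0 :: real)"
    using ijk by (simp_all add: axis_def)
  ultimately show ?thesis
    using ijk by (intro that[of ?a ?b ?c])
      (auto simp: norm_axis_1 inner_axis_axis abs_sgn_eq inner_axis sgn_real_def)
qed

text \<open>The map \<open>F\<close> keeps the two planar coordinates and replaces the height by
  \<rho>, whose height derivative is positive near \<open>p\<close>. Its local inverse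
  \<open>G\<close> therefore carries a piece of the coordinate plane onto a piece of the zero set of
  \<rho>, that is, of the boundary.\<close>

lemma local_graph:
  assumes D: "open D" and p: "p \<in> frontier D" "p \<in> U" and ldf: "local_defining_function D U \<rho>"
  shows "\<exists>B V \<phi> a b. graph_patch (frontier D) B V \<phi> a b \<and> p \<in> B"
proof -
  note l = local_defining_functionD[OF ldf]
  have opU: "open U" using l(1)[OF p(2)] .
  obtain a b c where orth: "norm a = 1" "norm b = 1" "norm c = 1" "a \<bullet> b = 0" "a \<bullet> c = 0" "b \<bullet> c = 0"
    and gc: "grad \<rho> p \<bullet> c > 0" and rep: "\<And>x. x = (x \<bullet> a) *\<^sub>R a + (x \<bullet> b) *\<^sub>R b + (x \<bullet> c) *\<^sub>R c"
    using adapted_frame[OF l(3)[OF p(2)]] by blast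
  have orth': "a \<bullet> a = 1" "b \<bullet> b = 1" "c \<bullet> c = 1" "b \<bullet> a = 0" "c \<bullet> a = 0" "c \<bullet> b = 0"
    using orth by (simp_all add: dot_square_norm inner_commute)
  note inner_simps = inner_add_left inner_scaleR_left orth(4-6) orth'
  have Ck_\<rho>: "Ck_on k U \<rho>" and Ck_g: "Ck_on k U (grad \<rho>)" for k
    using l(5)[OF p(2)] Ck_on_grad[OF opU] by blast+
  define U0 where "U0 = U \<inter> (\<lambda>x. grad \<rho> x \<bullet> c) -` {0<..}"
  have opU0: "open U0"
    unfolding U0_def using Ck_on_imp_continuous_on[OF Ck_g]
    by (intro continuous_open_preimage opU continuous_intros) auto
  have pU0: "p \<in> U0" using p gc by (simp add: U0_def)
  have U0: "U0 \<subseteq> U" "\<And>x. x \<in> U0 \<Longrightarrow> grad \<rho> x \<bullet> c > 0" by (auto simp: U0_def)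
  define F where "F x = (x \<bullet> a) *\<^sub>R a + (x \<bullet> b) *\<^sub>R b + \<rho> x *\<^sub>R c" for x
  define F' where "F' x h = (h \<bullet> a) *\<^sub>R a + (h \<bullet> b) *\<^sub>R b + (grad \<rho> x \<bullet> h) *\<^sub>R c" for x h
  \<comment> \<open>\<open>R x\<close> inverts \<open>F' x\<close>: it solves
    \<open>F' x h = e\<close>, where the \<open>c\<close> component is found by dividing by
    \<open>grad \<rho> x \<bullet> c\<close>, positive on \<open>U0\<close>. The reciprocal is a
    power so that smoothness in \<open>x\<close> follows from the calculus rules.\<close>
  define R where "R x e = (e \<bullet> a) *\<^sub>R a + (e \<bullet> b) *\<^sub>R b +
    ((e \<bullet> c - (e \<bullet> a) * (grad \<rho> x \<bullet> a) - (e \<bullet> b) * (grad \<rho> x \<bullet> b)) * (grad \<rho> x \<bullet> c) powr (- 1)) *\<^sub>R c" for x e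
  have bl: "bounded_linear (F' x)" "bounded_linear (R x)" for x
    unfolding F'_def R_def by (intro linear_conv_bounded_linear[THEN iffD1] linearI; simp add: algebra_simps inner_simps add_divide_distrib diff_divide_distrib)+
  have F'R: "F' x (R x e) = e" if "x \<in> U0" for x e
  proof -
    have "grad \<rho> x \<bullet> R x e = e \<bullet> c"
      using U0(2)[OF that] by (simp add: R_def inner_add_right powr_minus algebra_simps)
    moreover have "R x e \<bullet> a = e \<bullet> a" "R x e \<bullet> b = e \<bullet> b"
      by (simp_all add: R_def inner_simps)
    ultimately show ?thesis using rep[of e] by (simp add: F'_def)
  qed
  have RF': "R x (F' x h) = h" if "x \<in> U0" for x h
  proof -
    have "F' x h \<bullet> a = h \<bullet> a" "F' x h \<bullet> b = h \<bullet> b" "F' x h \<bullet> c = grad \<rho> x \<bullet> h"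
      by (simp_all add: F'_def inner_simps)
    moreover have "grad \<rho> x \<bullet> h = (h \<bullet> a) * (grad \<rho> x \<bullet> a) + (h \<bullet> b) * (grad \<rho> x \<bullet> b) + (h \<bullet> c) * (grad \<rho> x \<bullet> c)"
      by (subst rep[of h]) (simp add: inner_add_right)
    ultimately have "R x (F' x h) = (h \<bullet> a) *\<^sub>R a + (h \<bullet> b) *\<^sub>R b + (h \<bullet> c) *\<^sub>R c"
      using U0(2)[OF that] by (simp add: R_def powr_minus field_simps)
    then show ?thesis using rep[of h] by simp
  qed
  have F_deriv: "(F has_derivative F' x) (at x)" if "x \<in> U0" for x
    unfolding F_def F'_def using that U0(1)
    by (auto intro!: derivative_eq_intros has_derivative_grad l(2))
  define f' where "f' x = Blinfun (F' x)" for x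
  have f': "blinfun_apply (f' x) = F' x" for x
    by (simp add: f'_def bounded_linear_Blinfun_apply bl)
  have "continuous_on U0 f'"
    using Ck_on_imp_continuous_on[OF Ck_g] U0(1)
    by (intro continuous_on_blinfun_componentwise)
      (auto simp: f' F'_def intro!: continuous_intros intro: continuous_on_subset)
  moreover have "Blinfun (R p) o\<^sub>L f' p = id_blinfun"
    by (intro blinfun_eqI) (simp add: f' bounded_linear_Blinfun_apply bl RF' pU0)
  ultimately obtain U' V' G G' where UV: "open U'" "U' \<subseteq> U0" "p \<in> U'" "open V'" "F p \<in> V'"
      "homeomorphism U' V' F G" "\<And>y. y \<in> V' \<Longrightarrow> (G has_derivative G' y) (at y)"
      "\<And>y. y \<in> V' \<Longrightarrow> G' y = inv (blinfun_apply (f' (G y)))"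
    using inverse_function_theorem[OF opU0, of F f' p "Blinfun (R p)"] F_deriv f' pU0 by metis
  have GV: "G y \<in> U'" "F (G y) = y" if "y \<in> V'" for y
    using UV(6) that by (auto simp: homeomorphism_def)
  have G_deriv: "(G has_derivative R (G y)) (at y)" if "y \<in> V'" for y
  proof -
    have "G y \<in> U0" using GV(1)[OF that] UV(2) by blast
    then have "inv (F' (G y)) = R (G y)"
      using RF' F'R by (intro inv_unique_comp) (auto simp: fun_eq_iff)
    then show ?thesis using UV(7,8)[OF that] by (simp add: f')
  qed
  have Ck_R: "Ck_on k U0 (\<lambda>x. R x e)" for k e
    unfolding R_def using U0(2) opU0
    by (intro Ck_on_add Ck_on_scaleR Ck_on_mult Ck_on_diff Ck_on_const Ck_on_powr_compose Ck_on_inner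
        Ck_on_subset[OF Ck_g U0(1)]) auto
  \<comment> \<open>Bootstrapping: the derivative of \<open>G\<close> is \<open>R\<close> evaluated
    at \<open>G\<close> itself, so it is as smooth as \<open>G\<close> is known to be, and
    \<open>G\<close> gains one order.\<close>
  have Ck_G: "Ck_on k V' G" for k
  proof (induction k)
    case 0
    then show ?case using UV(6) by (simp add: homeomorphism_def)
  next
    case (Suc k)
    show ?case
      using GV(1) UV(2)
      by (intro Ck_on_Suc_intro[OF UV(4) G_deriv] Ck_on_compose[OF UV(4) opU0 _ Suc Ck_R]) auto
  qed
  define \<iota> :: "real^2 \<Rightarrow> real^3" where "\<iota> u = (u $ 1) *\<^sub>R a + (u $ 2) *\<^sub>R b" for u
  define V1 where "V1 = \<iota> -` V'"
  define \<phi> where "\<phi> u = G (\<iota> u)" for u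
  have bl\<iota>: "bounded_linear \<iota>"
    unfolding \<iota>_def by (intro linear_conv_bounded_linear[THEN iffD1] linearI) (simp_all add: algebra_simps)
  have opV1: "open V1"
    unfolding V1_def using open_vimage[OF UV(4) bounded_linear.continuous_on[OF bl\<iota> continuous_on_id]] by simp
  have smooth: "Ck_on k V1 \<phi>" for k
    unfolding \<phi>_def
    by (rule Ck_on_compose[OF opV1 UV(4) _ Ck_on_bounded_linear[OF opV1 bl\<iota>] Ck_G]) (auto simp: V1_def)
  have \<rho>_iff: "x \<in> frontier D \<longleftrightarrow> \<rho> x = 0" if "x \<in> U0" for x
    using frontier_iff_defining_zero[OF D ldf] that U0(1) by blast
  have F_inner: "F x \<bullet> a = x \<bullet> a" "F x \<bullet> b = x \<bullet> b" "F x \<bullet> c = \<rho> x" for x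
    by (simp_all add: F_def inner_simps)
  have F_front: "F x = \<iota> (proj2 a b x)" if "x \<in> frontier D" "x \<in> U0" for x
    using \<rho>_iff[OF that(2)] that(1) by (simp add: F_def \<iota>_def)
  have pr\<phi>: "proj2 a b (\<phi> u) = u" and \<phi>: "\<phi> u \<in> frontier D \<inter> U'" if "u \<in> V1" for u
  proof -
    have V': "\<iota> u \<in> V'" using that by (simp add: V1_def)
    have "F (\<phi> u) = \<iota> u" using GV(2)[OF V'] by (simp add: \<phi>_def)
    then have "\<phi> u \<bullet> a = \<iota> u \<bullet> a" "\<phi> u \<bullet> b = \<iota> u \<bullet> b" "\<rho> (\<phi> u) = \<iota> u \<bullet> c"
      using F_inner[of "\<phi> u"] by simp_all
    then have *: "\<phi> u \<bullet> a = u $ 1" "\<phi> u \<bullet> b = u $ 2" "\<rho> (\<phi> u) = 0"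
      by (simp_all add: \<iota>_def inner_simps)
    then show "proj2 a b (\<phi> u) = u" by (simp add: vec_eq_iff forall_2)
    have "\<phi> u \<in> U'" using GV(1)[OF V'] by (simp add: \<phi>_def)
    then show "\<phi> u \<in> frontier D \<inter> U'" using * \<rho>_iff UV(2) by blast
  qed
  have \<phi>_inv: "proj2 a b x \<in> V1" "\<phi> (proj2 a b x) = x" if "x \<in> frontier D" "x \<in> U'" for x
  proof -
    have eq: "F x = \<iota> (proj2 a b x)" using F_front that UV(2) by blast
    have "F x \<in> V'" "G (F x) = x" using UV(6) that(2) by (auto simp: homeomorphism_def)
    then show "proj2 a b x \<in> V1" "\<phi> (proj2 a b x) = x" by (simp_all add: V1_def \<phi>_def eq)
  qed
  \<comment> \<open>A closed ball inside \<open>V1\<close> is compact, so the area element is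
    bounded on it; this is why the parameter domain shrinks to the open ball.\<close>
  obtain r where r: "r > 0" "cball (proj2 a b p) r \<subseteq> V1"
    using opV1 \<phi>_inv(1)[OF p(1) UV(3)] open_contains_cball by blast
  define V where "V = ball (proj2 a b p) r"
  define B where "B = U' \<inter> proj2 a b -` V"
  have VV1: "V \<subseteq> V1" using r(2) by (auto simp: V_def)
  have "continuous_on V1 (\<lambda>u. frechet_derivative \<phi> (at u) (axis i 1))" for i
    using smooth[of "Suc 0"] by (auto simp: axis_in_Basis_iff)
  then have "continuous_on (cball (proj2 a b p) r) (area_element \<phi>)"
    unfolding area_element_def
    by (intro continuous_intros continuous_on_cross) (use r(2) in \<open>auto intro: continuous_on_subset\<close>)
  then have "bounded (area_element \<phi> ` cball (proj2 a b p) r)"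
    by (intro compact_imp_bounded compact_continuous_image) auto
  then obtain C where "\<forall>u\<in>V. area_element \<phi> u \<le> C"
    unfolding bounded_iff V_def by (metis abs_le_D1 ball_subset_cball imageI real_norm_def subsetD)
  moreover have "\<phi> ` V = frontier D \<inter> B"
  proof
    show "\<phi> ` V \<subseteq> frontier D \<inter> B" using \<phi> pr\<phi> VV1 by (force simp: B_def)
    show "frontier D \<inter> B \<subseteq> \<phi> ` V"
    proof
      fix x assume "x \<in> frontier D \<inter> B"
      then have "\<phi> (proj2 a b x) = x" "proj2 a b x \<in> V" using \<phi>_inv(2) by (auto simp: B_def)
      then show "x \<in> \<phi> ` V" by (metis imageI)
    qed
  qed
  moreover have "open B"
    unfolding B_def V_def
    by (intro open_Int UV(1) open_vimage bounded_linear.continuous_on[OF bounded_linear_proj2] continuous_on_id open_ball)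
  moreover have "smooth_on V \<phi>"
    unfolding smooth_on_def using Ck_on_subset[OF smooth VV1] by (auto simp: V_def)
  moreover have "p \<in> B" using UV(3) r(1) by (simp add: B_def V_def)
  ultimately have "graph_patch (frontier D) B V \<phi> a b \<and> p \<in> B"
    using orth pr\<phi> VV1 by (auto simp: graph_patch_def V_def)
  then show ?thesis by blast
qed

section \<open>Existence and uniqueness of the surface measure\<close>

text \<open>For absolutely integrable functions, integrability on the source side is a conclusion of
  the change of variables theorem, so finiteness is assumed on the image side only. Completion does
  not alter nonnegative integrals of Borel functions, which allows passing between
  \<open>lebesgue\<close> and \<open>lborel\<close>.\<close>

lemma nn_integral_change_of_variables:
  fixes f :: "real^2 \<Rightarrow> real" and \<tau> :: "real^2 \<Rightarrow> real^2"
  assumes T: "T \<in> sets borel"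
    and deriv: "\<And>u. u \<in> T \<Longrightarrow> (\<tau> has_derivative \<tau>' u) (at u within T)" and inj: "inj_on \<tau> T"
    and nonneg: "\<And>v. v \<in> \<tau> ` T \<Longrightarrow> 0 \<le> f v"
    and meas: "(\<lambda>v. indicator (\<tau> ` T) v * f v) \<in> borel_measurable borel"
    and fin: "(\<integral>\<^sup>+v. ennreal (indicator (\<tau> ` T) v * f v) \<partial>lborel) < \<infinity>"
    and meas': "(\<lambda>u. indicator T u * (\<bar>det (matrix (\<tau>' u))\<bar> * f (\<tau> u))) \<in> borel_measurable borel"
  shows "(\<integral>\<^sup>+u. ennreal (indicator T u * (\<bar>det (matrix (\<tau>' u))\<bar> * f (\<tau> u))) \<partial>lborel)
    = (\<integral>\<^sup>+v. ennreal (indicator (\<tau> ` T) v * f v) \<partial>lborel)"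
proof -
  define h where "h v = indicator (\<tau> ` T) v * f v" for v
  define H where "H u = indicator T u * (\<bar>det (matrix (\<tau>' u))\<bar> * f (\<tau> u))" for u
  \<comment> \<open>The theorem concerns functions with values in some \<open>real^'n\<close>;
    multiplying by the unit vector of \<open>real^1\<close> brings the scalar integrands into that
    form.\<close>
  define e :: "real^1" where "e = 1"
  have e: "e \<bullet> e = 1" by (simp add: e_def inner_vec_def)
  let ?g = "\<lambda>v. f v *\<^sub>R e" and ?G = "\<lambda>u. \<bar>det (matrix (\<tau>' u))\<bar> *\<^sub>R (f (\<tau> u) *\<^sub>R e)"
  have [measurable]: "h \<in> borel_measurable borel" "H \<in> borel_measurable borel"
    using meas meas' by (simp_all add: h_def[abs_def] H_def[abs_def])
  have h_nonneg: "h v \<ge> 0" for v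
    using nonneg[of v] by (auto simp: h_def indicator_def)
  have H_nonneg: "H u \<ge> 0" for u
    using nonneg[of "\<tau> u"] by (auto simp: H_def indicator_def)
  have leb: "h \<in> borel_measurable lebesgue" "H \<in> borel_measurable lebesgue"
    by (auto intro!: measurable_completion)
  have nn: "(\<integral>\<^sup>+v. ennreal (h v) \<partial>lebesgue) = (\<integral>\<^sup>+v. ennreal (h v) \<partial>lborel)"
    "(\<integral>\<^sup>+v. ennreal (H v) \<partial>lebesgue) = (\<integral>\<^sup>+v. ennreal (H v) \<partial>lborel)"
    by (auto intro!: nn_integral_completion)
  have int_h: "integrable lebesgue h"
    using fin nn(1) h_nonneg leb(1) by (intro integrableI_nonneg) (auto simp: h_def)
  have "integrable lebesgue (\<lambda>v. h v *\<^sub>R e)"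
    using int_h by simp
  then have g: "set_integrable lebesgue (\<tau> ` T) ?g"
    by (simp add: set_integrable_def h_def)
  then have "?G absolutely_integrable_on T \<and> integral T ?G = integral (\<tau> ` T) ?g"
    using has_absolute_integral_change_of_variables[of T \<tau> \<tau>' ?g "integral (\<tau> ` T) ?g"] T deriv inj
    by auto
  then have G: "set_integrable lebesgue T ?G" "integral T ?G = integral (\<tau> ` T) ?g" by auto
  have G': "indicator T u *\<^sub>R ?G u = H u *\<^sub>R e" for u by (simp add: H_def mult.assoc)
  have g': "indicator (\<tau> ` T) v *\<^sub>R ?g v = h v *\<^sub>R e" for v by (simp add: h_def)
  have int_He: "integrable lebesgue (\<lambda>u. H u *\<^sub>R e)"
    using G(1) unfolding set_integrable_def G' .
  then have "integrable lebesgue (\<lambda>u. (H u *\<^sub>R e) \<bullet> e)" by (rule integrable_inner_left)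
  then have int_H: "integrable lebesgue H" by (simp add: e)
  have "(LINT u|lebesgue. H u *\<^sub>R e) = (LINT v|lebesgue. h v *\<^sub>R e)"
    using set_lebesgue_integral_eq_integral(2)[OF G(1)] set_lebesgue_integral_eq_integral(2)[OF g] G(2)
    unfolding set_lebesgue_integral_def G' g' by simp
  then have "(LINT u|lebesgue. H u) *\<^sub>R e = (LINT v|lebesgue. h v) *\<^sub>R e"
    using int_H int_h by (simp add: integral_scaleR_left)
  then have "(LINT u|lebesgue. H u) = (LINT v|lebesgue. h v)"
    using e by (metis scaleR_cancel_right inner_zero_left zero_neq_one)
  then show ?thesis
    using nn_integral_eq_integral[OF int_h] nn_integral_eq_integral[OF int_H] h_nonneg H_nonneg nn
    by (simp add: h_def[symmetric] H_def[symmetric])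
qed

lemma smooth_on_continuous:
  assumes "smooth_on V \<phi>"
  shows "open V" "continuous_on V \<phi>" "continuous_on V (\<lambda>u. frechet_derivative \<phi> (at u) (axis i 1))"
    "continuous_on V (area_element \<phi>)"
proof -
  have "Ck_on 0 V \<phi>" "Ck_on (Suc 0) V \<phi>"
    using assms unfolding smooth_on_def by blast+
  then have *: "continuous_on V \<phi>" "\<And>i. continuous_on V (\<lambda>u. frechet_derivative \<phi> (at u) (axis i 1))"
    by (auto simp: axis_in_Basis_iff)
  show "open V" "continuous_on V \<phi>" using assms * by (simp_all add: smooth_on_def)
  show "continuous_on V (\<lambda>u. frechet_derivative \<phi> (at u) (axis i 1))" by (rule *)
  show "continuous_on V (area_element \<phi>)"
    unfolding area_element_def by (intro continuous_intros continuous_on_cross *)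
qed

lemma measurable_preimage_on:
  assumes "V \<in> sets borel" "continuous_on V \<phi>" "A \<in> sets borel"
  shows "{u\<in>V. \<phi> u \<in> A} \<in> sets borel"
proof -
  have "\<phi> -` A \<inter> space (restrict_space borel V) \<in> sets (restrict_space borel V)"
    using borel_measurable_continuous_on_restrict[OF assms(2)] assms(3) by (rule measurable_sets)
  then have "\<phi> -` A \<inter> V \<in> sets borel"
    using assms(1) by (simp add: sets_restrict_space_iff space_restrict_space)
  moreover have "\<phi> -` A \<inter> V = {u\<in>V. \<phi> u \<in> A}" by auto
  ultimately show ?thesis by simp
qed

lemma sets_restrict_closed:
  "closed S \<Longrightarrow> A \<in> sets (restrict_space borel S) \<longleftrightarrow> A \<subseteq> S \<and> A \<in> sets borel"
  by (subst sets_restrict_space_iff) auto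

section \<open>Independence of the area integral from the parametrization\<close>

definition param_integral :: "(real^2) set \<Rightarrow> (real^2 \<Rightarrow> real^3) \<Rightarrow> (real^3) set \<Rightarrow> ennreal" where
  "param_integral V \<phi> A =
     (\<integral>\<^sup>+u. indicator {u\<in>V. \<phi> u \<in> A} u * ennreal (area_element \<phi> u) \<partial>lborel)"

text \<open>Locally \<open>\<phi>\<close> is \<open>\<phi>k\<close> composed with the transition
  map, so the chain rule factors its derivative through \<open>\<tau>'\<close>.\<close>

lemma transition_derivative:
  assumes P: "graph_patch S B Vk \<phi>k a b" and R: "regular_parametrization S V \<phi>"
    and u: "u \<in> V" "\<phi> u \<in> B"
  defines "\<tau>' \<equiv> \<lambda>h. proj2 a b (frechet_derivative \<phi> (at u) h)"
  shows "((\<lambda>v. proj2 a b (\<phi> v)) has_derivative \<tau>') (at u)"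
    and "\<bar>det (matrix \<tau>')\<bar> * area_element \<phi>k (proj2 a b (\<phi> u)) = area_element \<phi> u"
proof -
  note p = graph_patchD[OF P]
  have sm: "smooth_on V \<phi>" "\<phi> ` V \<subseteq> S" using R by (auto simp: regular_parametrization_def)
  note sc = smooth_on_continuous[OF sm(1)]
  let ?\<tau> = "\<lambda>v. proj2 a b (\<phi> v)"
  let ?v = "?\<tau> u" let ?\<phi>' = "frechet_derivative \<phi> (at u)"
  let ?\<phi>k' = "frechet_derivative \<phi>k (at ?v)"
  show \<tau>: "(?\<tau> has_derivative \<tau>') (at u)"
    unfolding \<tau>'_def
    by (rule bounded_linear.has_derivative[OF bounded_linear_proj2 smooth_on_has_derivative[OF sm(1) u(1)]])
  have v: "?v \<in> Vk" using p(11) u sm(2) by blast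
  have "((\<lambda>x. \<phi>k (?\<tau> x)) has_derivative (\<lambda>h. ?\<phi>k' (\<tau>' h))) (at u)"
    by (rule has_derivative_compose[OF \<tau> smooth_on_has_derivative[OF p(4) v]])
  moreover have "open (V \<inter> \<phi> -` B)"
    using sc(1,2) p(1) by (intro continuous_open_preimage) auto
  ultimately have "(\<phi> has_derivative (\<lambda>h. ?\<phi>k' (\<tau>' h))) (at u)"
    by (rule has_derivative_transform_within_open) (use u p(11) sm(2) in auto)
  then have eq: "?\<phi>' = (\<lambda>h. ?\<phi>k' (\<tau>' h))"
    using frechet_derivative_at by metis
  define m where "m i j = \<tau>' (axis j 1) $ i" for i j
  have lin: "linear ?\<phi>k'"
    using smooth_on_has_derivative[OF p(4) v] has_derivative_linear by blast
  have expand: "?\<phi>k' w = w $ 1 *\<^sub>R ?\<phi>k' (axis 1 1) + w $ 2 *\<^sub>R ?\<phi>k' (axis 2 1)" for w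
  proof -
    have "w = w $ 1 *\<^sub>R axis 1 1 + w $ 2 *\<^sub>R axis 2 1"
      by (simp add: vec_eq_iff forall_2 axis_def)
    then show ?thesis
      by (metis linear_add[OF lin] linear_cmul[OF lin])
  qed
  \<comment> \<open>The cross product is bilinear and alternating, so changing the two vectors
    within their span multiplies it by the determinant of the coefficients.\<close>
  have *: "cross3 (x1 *\<^sub>R p + x2 *\<^sub>R q) (y1 *\<^sub>R p + y2 *\<^sub>R q) = (x1 * y2 - y1 * x2) *\<^sub>R cross3 p q"
    for p q x1 x2 y1 y2
    by (simp add: cross3_def vec_eq_iff forall_3 algebra_simps)
  have "cross3 (?\<phi>' (axis 1 1)) (?\<phi>' (axis 2 1)) =
      (m 1 1 * m 2 2 - m 1 2 * m 2 1) *\<^sub>R cross3 (?\<phi>k' (axis 1 1)) (?\<phi>k' (axis 2 1))"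
    unfolding eq m_def by (subst expand[of "\<tau>' (axis 1 1)"], subst expand[of "\<tau>' (axis 2 1)"], subst *) simp
  moreover have "det (matrix \<tau>') = m 1 1 * m 2 2 - m 1 2 * m 2 1"
    by (simp add: det_2 matrix_def m_def)
  ultimately show "\<bar>det (matrix \<tau>')\<bar> * area_element \<phi>k ?v = area_element \<phi> u"
    by (simp add: area_element_def)
qed

lemma area_element_nonneg: "area_element \<phi> u \<ge> 0"
  by (simp add: area_element_def)

lemma measurable_area_on:
  assumes "smooth_on V \<phi>" "T \<in> sets borel" "T \<subseteq> V"
  shows "(\<lambda>u. indicator T u * area_element \<phi> u) \<in> borel_measurable borel"
  using borel_measurable_continuous_on_indicator[OF assms(2) continuous_on_subset[OF smooth_on_continuous(4)[OF assms(1)] assms(3)]]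
  by simp

lemma patch_param_integral_finite:
  assumes "graph_patch S B V \<phi> a b"
  shows "param_integral V \<phi> A < \<infinity>"
proof -
  obtain C where C: "\<And>u. u \<in> V \<Longrightarrow> area_element \<phi> u \<le> C"
    using assms by (auto simp: graph_patch_def)
  note p = graph_patchD[OF assms]
  have "param_integral V \<phi> A \<le> (\<integral>\<^sup>+u. ennreal \<bar>C\<bar> * indicator V u \<partial>lborel)"
    unfolding param_integral_def
    by (intro nn_integral_mono) (auto simp: indicator_def intro!: ennreal_leI order_trans[OF C])
  also have "\<dots> = ennreal \<bar>C\<bar> * emeasure lborel V"
    using p(2) by (intro nn_integral_cmult_indicator) auto
  also have "\<dots> < \<infinity>"
    using emeasure_bounded_finite[OF p(3)] by (simp add: ennreal_mult_less_top)
  finally show ?thesis .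
qed

text \<open>The Jacobian of the transition map is exactly the quotient of the two area elements. One
  of the two parametrizations is a graph patch: its inverse is a projection defined on all of space,
  and its integral is finite, as the change of variables demands.\<close>

lemma param_integral_transition:
  assumes P: "graph_patch S B Vk \<phi>k a b" and R: "regular_parametrization S V \<phi>"
    and A: "A \<in> sets borel" "A \<subseteq> \<phi> ` V" "A \<subseteq> B"
  shows "param_integral Vk \<phi>k A = param_integral V \<phi> A"
proof -
  note p = graph_patchD[OF P]
  have sm: "smooth_on V \<phi>" "\<phi> ` V \<subseteq> S" "inj_on \<phi> V" using R by (auto simp: regular_parametrization_def)
  note sc = smooth_on_continuous[OF sm(1)]
  define T where "T = {u\<in>V. \<phi> u \<in> A}"
  define \<tau> where "\<tau> u = proj2 a b (\<phi> u)" for u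
  define \<tau>' where "\<tau>' u h = proj2 a b (frechet_derivative \<phi> (at u) h)" for u h
  have T: "T \<in> sets borel" "T \<subseteq> V" unfolding T_def
    using sc(1,2) A(1) by (auto intro!: measurable_preimage_on)
  have \<phi>k\<tau>: "\<phi>k (\<tau> u) = \<phi> u" "\<tau> u \<in> Vk" if "u \<in> T" for u
    using p(11)[of "\<phi> u"] that sm(2) A(3) by (auto simp: \<tau>_def T_def)
  have image: "\<tau> ` T = {v\<in>Vk. \<phi>k v \<in> A}"
  proof
    show "\<tau> ` T \<subseteq> {v\<in>Vk. \<phi>k v \<in> A}" using \<phi>k\<tau> by (auto simp: T_def)
    show "{v\<in>Vk. \<phi>k v \<in> A} \<subseteq> \<tau> ` T"
    proof
      fix v assume v: "v \<in> {v\<in>Vk. \<phi>k v \<in> A}"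
      then obtain u where "u \<in> V" "\<phi> u = \<phi>k v" using A(2) by force
      moreover then have "\<tau> u = v" using v p(10) by (simp add: \<tau>_def)
      ultimately show "v \<in> \<tau> ` T" using v by (force simp: T_def)
    qed
  qed
  then have im_borel: "\<tau> ` T \<in> sets borel" "\<tau> ` T \<subseteq> Vk"
    using measurable_preimage_on[of Vk \<phi>k A] p(2,12) A(1) by auto
  have jac: "\<bar>det (matrix (\<tau>' u))\<bar> * area_element \<phi>k (\<tau> u) = area_element \<phi> u" if "u \<in> T" for u
    using transition_derivative(2)[OF P R, of u] that A(3) by (auto simp: T_def \<tau>_def \<tau>'_def[abs_def])
  have indT: "indicator T u * (\<bar>det (matrix (\<tau>' u))\<bar> * area_element \<phi>k (\<tau> u)) = indicator T u * area_element \<phi> u" for u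
    using jac[of u] by (auto simp: indicator_def)
  have lhs: "param_integral Vk \<phi>k A = (\<integral>\<^sup>+v. ennreal (indicator (\<tau> ` T) v * area_element \<phi>k v) \<partial>lborel)"
    unfolding param_integral_def image by (intro nn_integral_cong) (auto simp: indicator_def)
  have "(\<integral>\<^sup>+u. ennreal (indicator T u * (\<bar>det (matrix (\<tau>' u))\<bar> * area_element \<phi>k (\<tau> u))) \<partial>lborel)
      = (\<integral>\<^sup>+v. ennreal (indicator (\<tau> ` T) v * area_element \<phi>k v) \<partial>lborel)"
  proof (rule nn_integral_change_of_variables[OF T(1)])
    show "(\<tau> has_derivative \<tau>' u) (at u within T)" if "u \<in> T" for u
    proof -
      have "u \<in> V" "\<phi> u \<in> B" using that A(3) by (auto simp: T_def)
      from transition_derivative(1)[OF P R this] show ?thesis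
        unfolding \<tau>_def[abs_def] \<tau>'_def[abs_def] by (rule has_derivative_at_withinI)
    qed
    show "inj_on \<tau> T"
    proof (rule inj_onI)
      fix u v assume "u \<in> T" "v \<in> T" "\<tau> u = \<tau> v"
      then have "\<phi> u = \<phi> v" using \<phi>k\<tau>(1) by metis
      then show "u = v" using sm(3) T(2) \<open>u \<in> T\<close> \<open>v \<in> T\<close> by (auto dest: inj_onD)
    qed
    show "(\<lambda>v. indicator (\<tau> ` T) v * area_element \<phi>k v) \<in> borel_measurable borel"
      using p(4) im_borel by (rule measurable_area_on)
    show "(\<integral>\<^sup>+v. ennreal (indicator (\<tau> ` T) v * area_element \<phi>k v) \<partial>lborel) < \<infinity>"
      using patch_param_integral_finite[OF P, of A] by (simp add: lhs)
    show "(\<lambda>u. indicator T u * (\<bar>det (matrix (\<tau>' u))\<bar> * area_element \<phi>k (\<tau> u))) \<in> borel_measurable borel"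
      unfolding indT using sm(1) T by (rule measurable_area_on)
  qed (simp add: area_element_nonneg)
  moreover have "ennreal (indicator T u * area_element \<phi> u) = indicator T u * ennreal (area_element \<phi> u)" for u
    by (simp add: indicator_def)
  ultimately show ?thesis
    unfolding lhs indT by (simp add: param_integral_def T_def[symmetric])
qed

text \<open>The area density is restricted to \<open>V\<close> before being pushed forward, because
  \<open>\<phi>\<close> is regular only there and may fail to be measurable outside.\<close>

definition param_measure :: "(real^3) set \<Rightarrow> (real^2) set \<Rightarrow> (real^2 \<Rightarrow> real^3) \<Rightarrow> (real^3) measure" where
  "param_measure S V \<phi> =
     distr (density (restrict_space lborel V) (\<lambda>u. ennreal (area_element \<phi> u))) (restrict_space borel S) \<phi>"

lemma sets_param_measure [simp]: "sets (param_measure S V \<phi>) = sets (restrict_space borel S)"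
  and space_param_measure [simp]: "space (param_measure S V \<phi>) = S"
  by (simp_all add: param_measure_def space_restrict_space)

lemma nn_integral_param_measure:
  assumes R: "regular_parametrization S V \<phi>" and f: "f \<in> borel_measurable (restrict_space borel S)"
  shows "(\<integral>\<^sup>+x. f x \<partial>param_measure S V \<phi>) =
    (\<integral>\<^sup>+u. ennreal (area_element \<phi> u) * f (\<phi> u) * indicator V u \<partial>lborel)"
proof -
  have sm: "smooth_on V \<phi>" "\<phi> ` V \<subseteq> S" using R by (auto simp: regular_parametrization_def)
  note sc = smooth_on_continuous[OF sm(1)]
  have [measurable]: "\<phi> \<in> measurable (restrict_space lborel V) (restrict_space borel S)"
  proof (rule measurable_restrict_space2)
    show "\<phi> \<in> space (restrict_space lborel V) \<rightarrow> S" using sm(2) by (auto simp: space_restrict_space)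
    show "\<phi> \<in> borel_measurable (restrict_space lborel V)"
      using borel_measurable_continuous_on_restrict[OF sc(2)]
      by (subst measurable_cong_sets[OF _ refl, of _ "restrict_space borel V"]) (auto intro!: sets_restrict_space_cong)
  qed
  have [measurable]: "(\<lambda>u. ennreal (area_element \<phi> u)) \<in> borel_measurable (restrict_space lborel V)"
    using borel_measurable_continuous_on_restrict[OF sc(4)]
    by (subst measurable_cong_sets[OF _ refl, of _ "restrict_space borel V"]) (auto intro!: sets_restrict_space_cong)
  note f[measurable]
  show ?thesis
    unfolding param_measure_def using sc(1)
    by (subst nn_integral_distr) (simp_all add: nn_integral_density nn_integral_restrict_space)
qed

lemma emeasure_param_measure:
  assumes "regular_parametrization S V \<phi>" "A \<in> sets (restrict_space borel S)"
  shows "emeasure (param_measure S V \<phi>) A = param_integral V \<phi> A"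
proof -
  have "emeasure (param_measure S V \<phi>) A = (\<integral>\<^sup>+x. indicator A x \<partial>param_measure S V \<phi>)"
    using assms(2) by simp
  also have "\<dots> = param_integral V \<phi> A"
    unfolding param_integral_def using assms
    by (subst nn_integral_param_measure) (auto intro!: nn_integral_cong simp: indicator_def)
  finally show ?thesis .
qed

section \<open>Finite atlases and the gluing of the surface measure\<close>

definition patch_atlas where
  "patch_atlas S n B V \<phi> a b \<longleftrightarrow>
     closed S \<and> (\<forall>i<n. graph_patch S (B i) (V i) (\<phi> i) (a i) (b i)) \<and> S \<subseteq> (\<Union>i<(n::nat). B i)"

lemma exists_patch_atlas:
  assumes "bounded_smooth_domain D"
  shows "\<exists>n B V \<phi> a b. patch_atlas (frontier D) n B V \<phi> a b"
proof -
  have D: "open D" "bounded D" "\<And>x. x \<in> frontier D \<Longrightarrow> \<exists>U \<rho>. x \<in> U \<and> local_defining_function D U \<rho>"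
    using assms by (auto simp: bounded_smooth_domain_def)
  have "\<exists>B V \<phi> a b. graph_patch (frontier D) B V \<phi> a b \<and> x \<in> B" if "x \<in> frontier D" for x
    using D(3)[OF that] local_graph[OF D(1) that] by blast
  then obtain B V \<phi> a b where P: "\<And>x. x \<in> frontier D \<Longrightarrow> graph_patch (frontier D) (B x) (V x) (\<phi> x) (a x) (b x)"
    "\<And>x. x \<in> frontier D \<Longrightarrow> x \<in> B x"
    by metis
  have cover: "frontier D \<subseteq> (\<Union>x\<in>frontier D. B x)" using P(2) by blast
  obtain F where F: "F \<subseteq> frontier D" "finite F" "frontier D \<subseteq> (\<Union>x\<in>F. B x)"
    using compactE_image[OF compact_frontier_bounded[OF D(2)] _ cover] graph_patchD(1)[OF P(1)] by metis
  obtain e where e: "bij_betw e {0..<card F} F"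
    using ex_bij_betw_nat_finite[OF F(2)] by blast
  have "patch_atlas (frontier D) (card F) (B \<circ> e) (V \<circ> e) (\<phi> \<circ> e) (a \<circ> e) (b \<circ> e)"
  proof -
    have "e ` {..<card F} = F" using e by (simp add: bij_betw_def lessThan_atLeast0)
    then have "frontier D \<subseteq> (\<Union>i<card F. B (e i))" using F(3) by force
    moreover have "e i \<in> frontier D" if "i < card F" for i
      using \<open>e ` {..<card F} = F\<close> F(1) that by blast
    ultimately show ?thesis using P(1) by (auto simp: patch_atlas_def)
  qed
  then show ?thesis by blast
qed

definition atlas_piece :: "(nat \<Rightarrow> 'a set) \<Rightarrow> nat \<Rightarrow> 'a set" where
  "atlas_piece B i = B i - (\<Union>j<i. B j)"

lemma atlas_piece_disjoint: "i \<noteq> j \<Longrightarrow> atlas_piece B i \<inter> atlas_piece B j = {}"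
  by (cases i j rule: linorder_cases) (auto simp: atlas_piece_def)

lemma atlas_piece_cover:
  assumes "x \<in> (\<Union>i<n. B i)"
  shows "\<exists>i<n. x \<in> atlas_piece B i"
proof -
  have "\<exists>i. i < n \<and> x \<in> B i" using assms by auto
  then obtain i where "i < n \<and> x \<in> B i" "\<forall>j<i. \<not> (j < n \<and> x \<in> B j)"
    using exists_least_iff[of "\<lambda>i. i < n \<and> x \<in> B i"] by blast
  then show ?thesis by (force simp: atlas_piece_def)
qed

lemma emeasure_split_pieces:
  assumes M: "sets M = sets (restrict_space borel S)" and atl: "patch_atlas S n B V \<phi> a b"
    and A: "A \<in> sets M"
  shows "emeasure M A = (\<Sum>i<n. emeasure M (A \<inter> atlas_piece B i))"
proof -
  have cl: "closed S" and opB: "\<And>i. i < n \<Longrightarrow> open (B i)" and cov: "S \<subseteq> (\<Union>i<n. B i)"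
    using atl graph_patchD(1) by (auto simp: patch_atlas_def)
  have AS: "A \<subseteq> S" "A \<in> sets borel" using A M sets_restrict_closed[OF cl] by auto
  have "A \<inter> atlas_piece B i \<in> sets M" if "i < n" for i
    unfolding M sets_restrict_closed[OF cl] atlas_piece_def using AS opB that
    by (auto intro!: sets.Int sets.Diff sets.finite_UN)
  then have "(\<Sum>i<n. emeasure M (A \<inter> atlas_piece B i)) = emeasure M (\<Union>i<n. A \<inter> atlas_piece B i)"
    using atlas_piece_disjoint[of _ _ B]
    by (intro sum_emeasure) (auto simp: disjoint_family_on_def Int_assoc Int_left_commute)
  also have "(\<Union>i<n. A \<inter> atlas_piece B i) = A"
    using AS cov atlas_piece_cover[of _ B n] by blast
  finally show ?thesis by simp
qed

lemma is_surface_measureD: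
  assumes "is_surface_measure S \<sigma>"
  shows "space \<sigma> = S" "sets \<sigma> = sets (restrict_space borel S)"
    "regular_parametrization S V \<phi> \<Longrightarrow> A \<in> sets \<sigma> \<Longrightarrow> A \<subseteq> \<phi> ` V \<Longrightarrow> emeasure \<sigma> A = param_integral V \<phi> A"
  using assms unfolding is_surface_measure_def param_integral_def by blast+

text \<open>Each piece of a measurable set lies in the image of one patch, where the defining
  property of a surface measure prescribes its value; finite additivity does the rest. Together with
  existence this makes the description in \<open>surface_measure\<close> definite.\<close>

lemma surface_measure_unique:
  assumes atl: "patch_atlas S n B V \<phi> a b" and "is_surface_measure S \<sigma>1" "is_surface_measure S \<sigma>2"
  shows "\<sigma>1 = \<sigma>2"
proof (rule measure_eqI)
  note s1 = is_surface_measureD[OF assms(2)] and s2 = is_surface_measureD[OF assms(3)]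
  show "sets \<sigma>1 = sets \<sigma>2" using s1(2) s2(2) by simp
  fix A assume A: "A \<in> sets \<sigma>1"
  have cl: "closed S" using atl by (simp add: patch_atlas_def)
  have "emeasure \<sigma>1 (A \<inter> atlas_piece B i) = emeasure \<sigma>2 (A \<inter> atlas_piece B i)" if i: "i < n" for i
  proof -
    have P: "graph_patch S (B i) (V i) (\<phi> i) (a i) (b i)" "\<And>j. j < n \<Longrightarrow> open (B j)"
      using atl i graph_patchD(1) by (auto simp: patch_atlas_def)
    have "A \<subseteq> S" "A \<in> sets borel" using A s1(2) sets_restrict_closed[OF cl] by auto
    then have "A \<inter> atlas_piece B i \<in> sets (restrict_space borel S)"
      unfolding sets_restrict_closed[OF cl] atlas_piece_def using P(2) i
      by (auto intro!: sets.Int sets.Diff sets.finite_UN)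
    moreover have "A \<inter> atlas_piece B i \<subseteq> \<phi> i ` V i"
      using graph_patchD(5)[OF P(1)] \<open>A \<subseteq> S\<close> by (auto simp: atlas_piece_def)
    ultimately show ?thesis
      using s1(2,3) s2(2,3) graph_patch_regular[OF P(1)] by metis
  qed
  then show "emeasure \<sigma>1 A = emeasure \<sigma>2 A"
    using emeasure_split_pieces[OF s1(2) atl A] emeasure_split_pieces[OF s2(2) atl, of A] A s1(2) s2(2) by simp
qed

text \<open>The patch measures are glued along the disjoint pieces, so countable additivity is
  inherited termwise. For an arbitrary parametrization the value on each piece is converted by
  \<open>param_integral_transition\<close>, and additivity of its own push-forward measure
  reassembles the pieces.\<close>

lemma surface_measure_exists:
  assumes atl: "patch_atlas S n B V \<phi> a b"
  shows "\<exists>\<sigma>. is_surface_measure S \<sigma>"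
proof -
  let ?M = "sets (restrict_space borel S)"
  have cl: "closed S" using atl by (simp add: patch_atlas_def)
  have P: "graph_patch S (B i) (V i) (\<phi> i) (a i) (b i)" if "i < n" for i
    using atl that by (simp add: patch_atlas_def)
  have piece: "A \<inter> atlas_piece B i \<in> ?M" if "A \<in> ?M" "i < n" for A i
    using that graph_patchD(1)[OF P] unfolding sets_restrict_closed[OF cl] atlas_piece_def
    by (auto intro!: sets.Int sets.Diff sets.finite_UN)
  define \<mu> where "\<mu> i = param_measure S (V i) (\<phi> i)" for i
  have \<mu>: "emeasure (\<mu> i) A = param_integral (V i) (\<phi> i) A" if "i < n" "A \<in> ?M" for i A
    unfolding \<mu>_def using graph_patch_regular[OF P[OF that(1)]] that(2) by (rule emeasure_param_measure)
  define m where "m A = (\<Sum>i<n. emeasure (\<mu> i) (A \<inter> atlas_piece B i))" for A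
  define \<sigma> where "\<sigma> = measure_of S ?M m"
  have sa: "sigma_algebra S ?M"
    using sets.sigma_algebra_axioms[of "restrict_space borel S"] by (simp add: space_restrict_space)
  have "countably_additive ?M m"
  proof (rule countably_additiveI)
    fix A :: "nat \<Rightarrow> (real^3) set"
    assume A: "range A \<subseteq> ?M" "disjoint_family A" "(\<Union>k. A k) \<in> ?M"
    have "(\<Sum>k. m (A k)) = (\<Sum>i<n. \<Sum>k. emeasure (\<mu> i) (A k \<inter> atlas_piece B i))"
      unfolding m_def by (intro suminf_sum) simp
    also have "\<dots> = (\<Sum>i<n. emeasure (\<mu> i) (\<Union>k. A k \<inter> atlas_piece B i))"
    proof (intro sum.cong refl suminf_emeasure)
      fix i assume "i \<in> {..<n}"
      then show "range (\<lambda>k. A k \<inter> atlas_piece B i) \<subseteq> sets (\<mu> i)"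
        using A(1) piece by (auto simp: \<mu>_def)
      show "disjoint_family (\<lambda>k. A k \<inter> atlas_piece B i)"
        using A(2) by (auto simp: disjoint_family_on_def)
    qed
    also have "\<dots> = m (\<Union>k. A k)"
      by (simp add: m_def)
    finally show "(\<Sum>k. m (A k)) = m (\<Union>k. A k)" .
  qed
  moreover have "positive ?M m"
    by (simp add: positive_def m_def)
  ultimately have em: "emeasure \<sigma> A = m A" if "A \<in> ?M" for A
    unfolding \<sigma>_def using sa that by (intro emeasure_measure_of_sigma)
  have sets: "sets \<sigma> = ?M" and space: "space \<sigma> = S"
    unfolding \<sigma>_def using sa by (simp_all add: sigma_algebra.sets_measure_of_eq space_measure_of_conv)
  have "emeasure \<sigma> A = param_integral W \<psi> A"
    if R: "regular_parametrization S W \<psi>" and A: "A \<in> ?M" "A \<subseteq> \<psi> ` W" for W \<psi> A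
  proof -
    have sm: "smooth_on W \<psi>" using R by (simp add: regular_parametrization_def)
    have "emeasure \<sigma> A = (\<Sum>i<n. param_integral W \<psi> (A \<inter> atlas_piece B i))"
      unfolding em[OF A(1)] m_def
    proof (intro sum.cong refl)
      fix i assume i: "i \<in> {..<n}"
      have "A \<inter> atlas_piece B i \<in> sets borel"
        using piece[OF A(1)] i sets_restrict_closed[OF cl] by blast
      then show "emeasure (\<mu> i) (A \<inter> atlas_piece B i) = param_integral W \<psi> (A \<inter> atlas_piece B i)"
        using \<mu>[OF _ piece[OF A(1)]] i A(2) param_integral_transition[OF P R, of i "A \<inter> atlas_piece B i"]
        by (auto simp: atlas_piece_def le_infI1)
    qed
    also have "\<dots> = (\<Sum>i<n. emeasure (param_measure S W \<psi>) (A \<inter> atlas_piece B i))"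
      using piece[OF A(1)] by (intro sum.cong refl emeasure_param_measure[OF R, symmetric]) auto
    also have "\<dots> = emeasure (param_measure S W \<psi>) A"
      using A(1) by (intro emeasure_split_pieces[OF _ atl, symmetric]) auto
    also have "\<dots> = param_integral W \<psi> A"
      using R A(1) by (rule emeasure_param_measure)
    finally show ?thesis .
  qed
  then have "is_surface_measure S \<sigma>"
    unfolding is_surface_measure_def param_integral_def[symmetric] using sets space by blast
  then show ?thesis by blast
qed

lemma is_surface_measure_bdry:
  assumes "bounded_smooth_domain D"
  shows "is_surface_measure (frontier D) (bdry_measure D)"
proof -
  obtain n B V \<phi> a b where "patch_atlas (frontier D) n B V \<phi> a b"
    using exists_patch_atlas[OF assms] by blast
  then have "\<exists>!\<sigma>. is_surface_measure (frontier D) \<sigma>"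
    using surface_measure_exists surface_measure_unique by blast
  then show ?thesis
    unfolding surface_measure_def by (rule theI')
qed

section \<open>The singular kernel on the boundary\<close>

lemma ennreal_inverse_antimono:
  assumes "a \<le> b"
  shows "inverse b \<le> (inverse a :: ennreal)"
proof (cases "a = 0 \<or> b = top")
  case False
  then obtain r s where "a = ennreal r" "0 < r" "b = ennreal s" "0 \<le> s"
    using assms by (cases a; cases b) (auto simp: less_le top_unique)
  moreover then have "r \<le> s" using assms by simp
  ultimately show ?thesis
    by (simp add: inverse_ennreal ennreal_leI le_imp_inverse_le)
qed auto

lemma sets_borel_ball [measurable]: "ball (x :: 'a::metric_space) r \<in> sets borel"
  by simp

text \<open>Dyadic comparison: where \<open>dist c u\<close> lies between
  \<open>r / 2 ^ Suc n\<close> and \<open>r / 2 ^ n\<close>, the integrand is at most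
  \<open>2 ^ Suc n / r\<close>. Integrating this bound over the whole ball of radius
  \<open>r / 2 ^ n\<close> gives \<open>2 * unit_ball_vol 2 * r / 2 ^ n\<close>, and the geometric
  series doubles the leading term.\<close>

lemma nn_integral_planar_singularity:
  fixes c :: "real^2"
  assumes r: "r > 0"
  shows "(\<integral>\<^sup>+u. indicator (ball c r) u * inverse (ennreal (dist c u)) \<partial>lborel)
    \<le> ennreal (4 * unit_ball_vol 2 * r)"
proof -
  let ?K = "unit_ball_vol 2"
  let ?t = "\<lambda>n u. ennreal (2 ^ Suc n / r) * indicator (ball c (r / 2 ^ n)) u"
  have pointwise: "indicator (ball c r) u * inverse (ennreal (dist c u)) \<le> (\<Sum>n. ?t n u)" if "u \<noteq> c" for u
  proof (cases "u \<in> ball c r")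
    case True
    define d where "d = dist c u"
    have d: "0 < d" "d < r" using True that by (auto simp: d_def)
    obtain k where "r / d < 2 ^ k" using real_arch_pow[of 2 "r / d"] by auto
    then have "r / 2 ^ Suc k \<le> d" using d r by (simp add: field_simps)
    then obtain n where n: "r / 2 ^ Suc n \<le> d" and least: "\<forall>m<n. \<not> r / 2 ^ Suc m \<le> d"
      using exists_least_iff[of "\<lambda>n. r / 2 ^ Suc n \<le> d"] by blast
    have "d < r / 2 ^ n"
      using d least by (cases n) (auto simp: not_le)
    then have "?t n u = ennreal (2 ^ Suc n / r)" by (simp add: d_def)
    moreover have "inverse (ennreal d) \<le> ennreal (2 ^ Suc n / r)"
      using d r n by (subst inverse_ennreal) (auto intro!: ennreal_leI simp: field_simps)
    moreover have "?t n u \<le> (\<Sum>n. ?t n u)"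
    proof -
      have "?t n u = (\<Sum>m\<in>{n}. ?t m u)" by (subst sum.insert) simp_all
      also have "\<dots> \<le> (\<Sum>n. ?t n u)" by (intro sum_le_suminf) auto
      finally show ?thesis .
    qed
    ultimately show ?thesis using True by (simp add: d_def)
  qed simp
  have "(\<integral>\<^sup>+u. indicator (ball c r) u * inverse (ennreal (dist c u)) \<partial>lborel) \<le> (\<integral>\<^sup>+u. (\<Sum>n. ?t n u) \<partial>lborel)"
    using pointwise AE_lborel_singleton[of c] by (intro nn_integral_mono_AE) auto
  also have "\<dots> = (\<Sum>n. \<integral>\<^sup>+u. ?t n u \<partial>lborel)"
    by (intro nn_integral_suminf) measurable
  also have "\<dots> = (\<Sum>n. ennreal (2 * ?K * r * (1 / 2) ^ n))"
  proof (intro suminf_cong)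
    fix n
    have "(\<integral>\<^sup>+u. ?t n u \<partial>lborel) = ennreal (2 ^ Suc n / r) * emeasure lborel (ball c (r / 2 ^ n))"
      by (intro nn_integral_cmult_indicator) auto
    also have "emeasure lborel (ball c (r / 2 ^ n)) = ennreal (?K * (r / 2 ^ n)\<^sup>2)"
      using r emeasure_ball[of "r / 2 ^ n" c] by simp
    also have "ennreal (2 ^ Suc n / r) * ennreal (?K * (r / 2 ^ n)\<^sup>2) = ennreal (2 * ?K * r * (1 / 2) ^ n)"
      using r by (simp add: ennreal_mult[symmetric] power2_eq_square power_divide field_simps)
    finally show "(\<integral>\<^sup>+u. ?t n u \<partial>lborel) = ennreal (2 * ?K * r * (1 / 2) ^ n)" .
  qed
  also have "\<dots> = ennreal (2 * ?K * r * 2)"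
    using r sums_mult[OF geometric_sums[of "1/2 :: real"], of "2 * ?K * r"]
    by (intro suminf_ennreal_eq) auto
  finally show ?thesis by (simp add: mult_ac)
qed

text \<open>Both measures are evaluated through \<open>A \<inter> B\<close>, which lies in the image
  of the patch, so the defining property of the surface measure applies. This turns surface
  integrals over \<open>B\<close> into planar ones.\<close>

lemma param_measure_eq_density:
  assumes s: "is_surface_measure S \<sigma>" and cl: "closed S" and P: "graph_patch S B V \<phi> a b"
  shows "param_measure S V \<phi> = density \<sigma> (indicator B)"
proof (rule measure_eqI)
  note sD = is_surface_measureD[OF s] and R = graph_patch_regular[OF P] and p = graph_patchD[OF P]
  show "sets (param_measure S V \<phi>) = sets (density \<sigma> (indicator B))" using sD(2) by simp
  fix A assume "A \<in> sets (param_measure S V \<phi>)"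
  then have A: "A \<in> sets (restrict_space borel S)" by simp
  then have AB: "A \<inter> B \<in> sets (restrict_space borel S)"
    using p(1) by (auto simp: sets_restrict_closed[OF cl])
  have [measurable]: "indicator B \<in> borel_measurable \<sigma>"
    using p(1) sD(2) by (subst measurable_cong_sets[OF sD(2) refl]) (auto intro!: measurable_restrict_space1)
  have "emeasure (param_measure S V \<phi>) A = param_integral V \<phi> (A \<inter> B)"
  proof -
    have "{u \<in> V. \<phi> u \<in> A} = {u \<in> V. \<phi> u \<in> A \<inter> B}" using p(5) by blast
    then show ?thesis using emeasure_param_measure[OF R A] by (simp add: param_integral_def)
  qed
  also have "\<dots> = emeasure \<sigma> (A \<inter> B)"
    using p(5) A AB sD(2) by (intro sD(3)[OF R, symmetric]) (auto simp: sets_restrict_closed[OF cl])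
  also have "\<dots> = emeasure (density \<sigma> (indicator B)) A"
  proof -
    have "emeasure (density \<sigma> (indicator B)) A = (\<integral>\<^sup>+x. indicator (A \<inter> B) x \<partial>\<sigma>)"
      using A sD(2) by (subst emeasure_density) (auto intro!: nn_integral_cong simp: indicator_def)
    then show ?thesis using AB sD(2) by simp
  qed
  finally show "emeasure (param_measure S V \<phi>) A = emeasure (density \<sigma> (indicator B)) A" .
qed

text \<open>Overlapping patches are counted with multiplicity, hence an inequality, which suffices
  for upper bounds.\<close>

lemma nn_integral_surface_le:
  assumes s: "is_surface_measure S \<sigma>" and atl: "patch_atlas S n B V \<phi> a b"
    and f: "f \<in> borel_measurable (restrict_space borel S)"
  shows "(\<integral>\<^sup>+x. f x \<partial>\<sigma>) \<le> (\<Sum>i<n. \<integral>\<^sup>+u. ennreal (area_element (\<phi> i) u) * f (\<phi> i u) * indicator (V i) u \<partial>lborel)"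
proof -
  note sD = is_surface_measureD[OF s]
  have cl: "closed S" and cov: "S \<subseteq> (\<Union>i<n. B i)" using atl by (simp_all add: patch_atlas_def)
  have P: "graph_patch S (B i) (V i) (\<phi> i) (a i) (b i)" if "i < n" for i
    using atl that by (simp add: patch_atlas_def)
  have f': "f \<in> borel_measurable \<sigma>" using f by (subst measurable_cong_sets[OF sD(2) refl])
  have ind: "indicator (B i) \<in> borel_measurable \<sigma>" if "i < n" for i
    using graph_patchD(1)[OF P[OF that]]
    by (subst measurable_cong_sets[OF sD(2) refl]) (auto intro!: measurable_restrict_space1)
  have "(\<integral>\<^sup>+x. f x \<partial>\<sigma>) \<le> (\<integral>\<^sup>+x. (\<Sum>i<n. indicator (B i) x * f x) \<partial>\<sigma>)"
  proof (rule nn_integral_mono)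
    fix x assume "x \<in> space \<sigma>"
    then obtain j where j: "j < n" "x \<in> B j" using cov sD(1) by blast
    have "f x = indicator (B j) x * f x" using j by simp
    also have "\<dots> \<le> (\<Sum>i<n. indicator (B i) x * f x)"
      using j(1) by (intro member_le_sum) auto
    finally show "f x \<le> (\<Sum>i<n. indicator (B i) x * f x)" .
  qed
  also have "\<dots> = (\<Sum>i<n. \<integral>\<^sup>+x. indicator (B i) x * f x \<partial>\<sigma>)"
    using f' ind by (intro nn_integral_sum borel_measurable_times_ennreal) auto
  also have "\<dots> = (\<Sum>i<n. \<integral>\<^sup>+x. f x \<partial>param_measure S (V i) (\<phi> i))"
    using param_measure_eq_density[OF s cl P] nn_integral_density[OF ind f']
    by (intro sum.cong refl) simp
  also have "\<dots> = (\<Sum>i<n. \<integral>\<^sup>+u. ennreal (area_element (\<phi> i) u) * f (\<phi> i u) * indicator (V i) u \<partial>lborel)"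
    using P by (intro sum.cong refl nn_integral_param_measure[OF graph_patch_regular f]) auto
  finally show ?thesis .
qed

lemma surface_measure_finite:
  assumes "is_surface_measure S \<sigma>" "patch_atlas S n B V \<phi> a b"
  shows "emeasure \<sigma> S < \<infinity>"
proof -
  have P: "graph_patch S (B i) (V i) (\<phi> i) (a i) (b i)" if "i < n" for i
    using assms that by (simp add: patch_atlas_def)
  have "emeasure \<sigma> S = (\<integral>\<^sup>+x. 1 \<partial>\<sigma>)"
    using is_surface_measureD(1)[OF assms(1)] by simp
  also have "\<dots> \<le> (\<Sum>i<n. \<integral>\<^sup>+u. ennreal (area_element (\<phi> i) u) * 1 * indicator (V i) u \<partial>lborel)"
    by (rule nn_integral_surface_le[OF assms]) simp
  also have "\<dots> = (\<Sum>i<n. param_integral (V i) (\<phi> i) S)"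
  proof (intro sum.cong refl)
    fix i assume "i \<in> {..<n}"
    then have "{u \<in> V i. \<phi> i u \<in> S} = V i" using graph_patchD(5)[OF P, of i] by blast
    then show "(\<integral>\<^sup>+u. ennreal (area_element (\<phi> i) u) * 1 * indicator (V i) u \<partial>lborel) = param_integral (V i) (\<phi> i) S"
      by (simp add: param_integral_def mult.commute)
  qed
  also have "\<dots> < \<infinity>"
    using patch_param_integral_finite[OF P] by simp
  finally show ?thesis .
qed

text \<open>On a patch the projection does not increase distances, so ball and kernel are dominated
  by their planar counterparts about the projection of \<open>x\<close>. The constant collects the
  bounds on the area elements and is uniform in \<open>x\<close>, which may be any point of
  space.\<close>

lemma surface_measure_singular_bound:
  assumes s: "is_surface_measure S \<sigma>" and atl: "patch_atlas S n B V \<phi> a b"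
  shows "\<exists>C\<ge>0. \<forall>x r. 0 < r \<longrightarrow>
    (\<integral>\<^sup>+y. indicator (ball x r) y * inverse (ennreal (dist x y)) \<partial>\<sigma>) \<le> ennreal (C * r)"
proof -
  have P: "graph_patch S (B i) (V i) (\<phi> i) (a i) (b i)" if "i < n" for i
    using atl that by (simp add: patch_atlas_def)
  have "\<exists>C\<ge>0. \<forall>u\<in>V i. area_element (\<phi> i) u \<le> C" if i: "i < n" for i
  proof -
    obtain C where "\<forall>u\<in>V i. area_element (\<phi> i) u \<le> C"
      using P[OF i] by (auto simp: graph_patch_def)
    then show ?thesis by (intro exI[of _ "\<bar>C\<bar>"]) (auto intro: order_trans)
  qed
  then obtain C where C: "\<And>i. i < n \<Longrightarrow> C i \<ge> 0" "\<And>i u. i < n \<Longrightarrow> u \<in> V i \<Longrightarrow> area_element (\<phi> i) u \<le> C i"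
    by metis
  let ?K = "4 * unit_ball_vol 2"
  have "(\<integral>\<^sup>+y. indicator (ball x r) y * inverse (ennreal (dist x y)) \<partial>\<sigma>) \<le> ennreal (((\<Sum>i<n. C i) * ?K) * r)"
    if r: "r > 0" for x r
  proof -
    let ?f = "\<lambda>y. indicator (ball x r) y * inverse (ennreal (dist x y)) :: ennreal"
    have "(\<integral>\<^sup>+y. ?f y \<partial>\<sigma>) \<le> (\<Sum>i<n. \<integral>\<^sup>+u. ennreal (area_element (\<phi> i) u) * ?f (\<phi> i u) * indicator (V i) u \<partial>lborel)"
      by (rule nn_integral_surface_le[OF s atl]) (intro measurable_restrict_space1, measurable)
    also have "\<dots> \<le> (\<Sum>i<n. ennreal (C i * ?K * r))"
    proof (rule sum_mono)
      fix i assume "i \<in> {..<n}"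
      then have i: "i < n" by simp
      note p = graph_patchD[OF P[OF i]]
      let ?c = "proj2 (a i) (b i) x"
      have "(\<integral>\<^sup>+u. ennreal (area_element (\<phi> i) u) * ?f (\<phi> i u) * indicator (V i) u \<partial>lborel)
          \<le> (\<integral>\<^sup>+u. ennreal (C i) * (indicator (ball ?c r) u * inverse (ennreal (dist ?c u))) \<partial>lborel)"
      proof (rule nn_integral_mono)
        fix u
        show "ennreal (area_element (\<phi> i) u) * ?f (\<phi> i u) * indicator (V i) u
          \<le> ennreal (C i) * (indicator (ball ?c r) u * inverse (ennreal (dist ?c u)))"
        proof (cases "u \<in> V i")
          case True
          have "dist ?c u \<le> dist x (\<phi> i u)"
            using dist_proj2_le[OF p(7-9), of x "\<phi> i u"] p(10)[OF True] by simp
          then have "?f (\<phi> i u) \<le> indicator (ball ?c r) u * inverse (ennreal (dist ?c u))"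
            by (auto simp: indicator_def intro!: ennreal_inverse_antimono ennreal_leI)
          then show ?thesis
            using C(2)[OF i True] True by (auto intro!: mult_mono ennreal_leI)
        qed simp
      qed
      also have "\<dots> = ennreal (C i) * (\<integral>\<^sup>+u. indicator (ball ?c r) u * inverse (ennreal (dist ?c u)) \<partial>lborel)"
        by (rule nn_integral_cmult) simp
      also have "\<dots> \<le> ennreal (C i) * ennreal (?K * r)"
        using nn_integral_planar_singularity[OF r] by (intro mult_left_mono) auto
      also have "\<dots> = ennreal (C i * ?K * r)"
        using C(1)[OF i] r by (simp add: ennreal_mult[symmetric] mult.assoc)
      finally show "(\<integral>\<^sup>+u. ennreal (area_element (\<phi> i) u) * ?f (\<phi> i u) * indicator (V i) u \<partial>lborel)
        \<le> ennreal (C i * ?K * r)" .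
    qed
    also have "\<dots> = ennreal (((\<Sum>i<n. C i) * ?K) * r)"
      using C(1) r by (subst sum_ennreal) (auto simp: sum_distrib_right)
    finally show ?thesis .
  qed
  moreover have "(\<Sum>i<n. C i) * ?K \<ge> 0"
    using C(1) by (auto intro!: sum_nonneg mult_nonneg_nonneg)
  ultimately show ?thesis by blast
qed

section \<open>Square integrable functions\<close>

text \<open>Norms are handled in squared form from here on; this replaces the triangle inequality at
  the cost of factors 2.\<close>

lemma norm_add_sq_le: "(norm (a + b))\<^sup>2 \<le> 2 * (norm a)\<^sup>2 + 2 * (norm b)\<^sup>2"
proof -
  have "(norm (a + b))\<^sup>2 \<le> (norm a + norm b)\<^sup>2"
    by (intro power_mono norm_triangle_ineq) auto
  also have "\<dots> \<le> 2 * (norm a)\<^sup>2 + 2 * (norm b)\<^sup>2"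
    using sum_squares_bound[of "norm a" "norm b"] by (simp add: power2_sum)
  finally show ?thesis .
qed

lemma L2_norm_sq_nonneg: "L2_norm_sq M f \<ge> 0"
  by (simp add: L2_norm_sq_def)

lemma L2_add:
  fixes f g :: "'a \<Rightarrow> 'b::{banach, second_countable_topology}"
  assumes "L2 M f" "L2 M g"
  shows "L2 M (\<lambda>x. f x + g x)" and "L2_norm_sq M (\<lambda>x. f x + g x) \<le> 2 * L2_norm_sq M f + 2 * L2_norm_sq M g"
proof -
  have [measurable]: "f \<in> borel_measurable M" "g \<in> borel_measurable M"
    and int: "integrable M (\<lambda>x. (norm (f x))\<^sup>2)" "integrable M (\<lambda>x. (norm (g x))\<^sup>2)"
    using assms by (auto simp: L2_def)
  have dom: "integrable M (\<lambda>x. 2 * (norm (f x))\<^sup>2 + 2 * (norm (g x))\<^sup>2)"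
    using int by auto
  have int_sum: "integrable M (\<lambda>x. (norm (f x + g x))\<^sup>2)"
    by (rule Bochner_Integration.integrable_bound[OF dom]) (auto simp: norm_add_sq_le)
  then show "L2 M (\<lambda>x. f x + g x)"
    by (simp add: L2_def)
  have "L2_norm_sq M (\<lambda>x. f x + g x) \<le> (\<integral>x. 2 * (norm (f x))\<^sup>2 + 2 * (norm (g x))\<^sup>2 \<partial>M)"
    unfolding L2_norm_sq_def by (intro integral_mono int_sum dom norm_add_sq_le)
  then show "L2_norm_sq M (\<lambda>x. f x + g x) \<le> 2 * L2_norm_sq M f + 2 * L2_norm_sq M g"
    using int by (simp add: L2_norm_sq_def)
qed

lemma L2_cmult:
  fixes f :: "'a \<Rightarrow> complex"
  assumes "L2 M f"
  shows "L2 M (\<lambda>x. c * f x)" and "L2_norm_sq M (\<lambda>x. c * f x) = (norm c)\<^sup>2 * L2_norm_sq M f"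
  using assms by (auto simp: L2_def L2_norm_sq_def norm_mult power_mult_distrib)

lemma L2_uminus:
  fixes f :: "'a \<Rightarrow> 'b::{banach, second_countable_topology}"
  shows "L2 M f \<Longrightarrow> L2 M (\<lambda>x. - f x)" and "L2_norm_sq M (\<lambda>x. - f x) = L2_norm_sq M f"
  by (auto simp: L2_def L2_norm_sq_def)

lemma L2_diff:
  fixes f g :: "'a \<Rightarrow> 'b::{banach, second_countable_topology}"
  assumes "L2 M f" "L2 M g"
  shows "L2 M (\<lambda>x. f x - g x)" and "L2_norm_sq M (\<lambda>x. f x - g x) \<le> 2 * L2_norm_sq M f + 2 * L2_norm_sq M g"
  using L2_add[OF assms(1) L2_uminus(1)[OF assms(2)]] by (simp_all add: L2_uminus(2))

lemma L2_cong_AE: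
  assumes "L2 M f" "g \<in> borel_measurable M" "AE x in M. f x = g x"
  shows "L2 M g" and "L2_norm_sq M g = L2_norm_sq M f"
proof -
  have ae: "AE x in M. (norm (f x))\<^sup>2 = (norm (g x))\<^sup>2"
    using assms(3) by eventually_elim simp
  have m: "(\<lambda>x. (norm (f x))\<^sup>2) \<in> borel_measurable M" "(\<lambda>x. (norm (g x))\<^sup>2) \<in> borel_measurable M"
    using assms(1,2) by (auto simp: L2_def)
  show "L2 M g"
    using assms(1,2) integrable_cong_AE[OF m ae] by (simp add: L2_def)
  show "L2_norm_sq M g = L2_norm_sq M f"
    unfolding L2_norm_sq_def using integral_cong_AE[OF m ae] by simp
qed

lemma L2_iff_nn_integral:
  "L2 M f \<longleftrightarrow> f \<in> borel_measurable M \<and> (\<integral>\<^sup>+x. ennreal ((norm (f x))\<^sup>2) \<partial>M) < \<infinity>"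
  by (auto simp: L2_def integrable_iff_bounded)

lemma nn_integral_L2_norm_sq:
  "L2 M f \<Longrightarrow> (\<integral>\<^sup>+x. ennreal ((norm (f x))\<^sup>2) \<partial>M) = ennreal (L2_norm_sq M f)"
  by (simp add: L2_def L2_norm_sq_def nn_integral_eq_integral)

lemma L2_norm_sq_leI:
  assumes "f \<in> borel_measurable M" "(\<integral>\<^sup>+x. ennreal ((norm (f x))\<^sup>2) \<partial>M) \<le> ennreal B" "B \<ge> 0"
  shows "L2 M f" "L2_norm_sq M f \<le> B"
proof -
  show L: "L2 M f" using assms(1) le_less_trans[OF assms(2)] by (simp add: L2_iff_nn_integral)
  show "L2_norm_sq M f \<le> B"
    using assms(2,3) unfolding nn_integral_L2_norm_sq[OF L] by simp
qed

context finite_measure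
begin

text \<open>Cauchy-Schwarz against the constant 1, whose square integral is the total mass.\<close>

lemma L2_imp_integrable:
  fixes f :: "'a \<Rightarrow> 'b::{banach, second_countable_topology}"
  assumes "L2 M f"
  shows "integrable M f"
    and "(\<integral>x. norm (f x) \<partial>M)\<^sup>2 \<le> measure M (space M) * L2_norm_sq M f"
proof -
  have [measurable]: "f \<in> borel_measurable M" using assms by (simp add: L2_def)
  have "(\<integral>\<^sup>+x. 1 * ennreal (norm (f x)) \<partial>M)\<^sup>2 \<le> (\<integral>\<^sup>+x. 1\<^sup>2 \<partial>M) * (\<integral>\<^sup>+x. (ennreal (norm (f x)))\<^sup>2 \<partial>M)"
    by (intro Cauchy_Schwarz_nn_integral) auto
  also have "\<dots> = ennreal (measure M (space M) * L2_norm_sq M f)"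
    using nn_integral_L2_norm_sq[OF assms]
    by (simp add: ennreal_power emeasure_eq_measure ennreal_mult[symmetric] L2_norm_sq_nonneg)
  finally have *: "(\<integral>\<^sup>+x. ennreal (norm (f x)) \<partial>M)\<^sup>2 \<le> ennreal (measure M (space M) * L2_norm_sq M f)"
    by simp
  then have "(\<integral>\<^sup>+x. ennreal (norm (f x)) \<partial>M)\<^sup>2 < \<infinity>"
    using le_less_trans ennreal_less_top by (metis infinity_ennreal_def)
  then show int: "integrable M f"
    by (simp add: integrable_iff_bounded power_less_top_ennreal)
  then have "(\<integral>\<^sup>+x. ennreal (norm (f x)) \<partial>M) = ennreal (\<integral>x. norm (f x) \<partial>M)"
    by (intro nn_integral_eq_integral) auto
  then show "(\<integral>x. norm (f x) \<partial>M)\<^sup>2 \<le> measure M (space M) * L2_norm_sq M f"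
    using * by (simp add: ennreal_power L2_norm_sq_nonneg)
qed

text \<open>The Riesz-Fischer argument: over a finite measure a Cauchy sequence in the square norm
  is Cauchy in mean, so a subsequence converges almost everywhere, and Fatou's lemma carries the
  Cauchy bound over to the limit.\<close>

lemma L2_complete:
  fixes f :: "nat \<Rightarrow> 'a \<Rightarrow> 'b::{banach, second_countable_topology}"
  assumes L: "\<And>n. L2 M (f n)"
    and cauchy: "\<And>e. e > 0 \<Longrightarrow> \<exists>N. \<forall>m\<ge>N. \<forall>n\<ge>N. L2_norm_sq M (\<lambda>x. f m x - f n x) < e"
  shows "\<exists>v. L2 M v \<and> (\<lambda>n. L2_norm_sq M (\<lambda>x. f n x - v x)) \<longlonglongrightarrow> 0"
proof -
  have [measurable]: "\<And>n. f n \<in> borel_measurable M" using L by (simp add: L2_def)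
  have int: "integrable M (f n)" for n using L2_imp_integrable(1)[OF L] .
  let ?m = "measure M (space M)"
  have cauchy_L1: "\<exists>N. \<forall>i\<ge>N. \<forall>j\<ge>N. LINT x|M. norm (f i x - f j x) < e" if e: "e > 0" for e
  proof -
    \<comment> \<open>The summand 1 keeps the denominator positive when the measure is zero.\<close>
    have pos: "e\<^sup>2 / (?m + 1) > 0" using e by (auto intro!: divide_pos_pos add_nonneg_pos)
    obtain N where N: "\<forall>m\<ge>N. \<forall>n\<ge>N. L2_norm_sq M (\<lambda>x. f m x - f n x) < e\<^sup>2 / (?m + 1)"
      using cauchy[OF pos] by blast
    have "LINT x|M. norm (f i x - f j x) < e" if "i \<ge> N" "j \<ge> N" for i j
    proof -
      let ?d = "L2_norm_sq M (\<lambda>x. f i x - f j x)"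
      have "(LINT x|M. norm (f i x - f j x))\<^sup>2 \<le> ?m * ?d"
        using L2_imp_integrable(2)[OF L2_diff(1)[OF L L]] .
      also have "\<dots> \<le> (?m + 1) * ?d" by (intro mult_right_mono L2_norm_sq_nonneg) simp
      also have "\<dots> < (?m + 1) * (e\<^sup>2 / (?m + 1))"
        using N that by (intro mult_strict_left_mono) (auto intro: add_nonneg_pos)
      also have "\<dots> = e\<^sup>2"
      proof -
        have "?m + 1 > 0" by (simp add: add_nonneg_pos)
        then show ?thesis by simp
      qed
      finally show ?thesis using e by (meson less_imp_le power2_less_imp_less)
    qed
    then show ?thesis by blast
  qed
  obtain r where r: "strict_mono r" and ae: "AE x in M. Cauchy (\<lambda>i. f (r i) x)"
    using cauchy_L1_AE_cauchy_subseq[where s = f, OF int cauchy_L1] by blast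
  define v where "v x = lim (\<lambda>i. f (r i) x)" for x
  have [measurable]: "v \<in> borel_measurable M" unfolding v_def by measurable
  have conv: "AE x in M. (\<lambda>i. f (r i) x) \<longlonglongrightarrow> v x"
    using ae by eventually_elim (simp add: v_def Cauchy_convergent_iff convergent_LIMSEQ_iff)
  \<comment> \<open>Fatou's lemma is applied in the second index along the subsequence; since
    \<open>r i \<ge> i\<close>, the indices stay beyond \<open>N\<close>.\<close>
  have bound: "L2 M (\<lambda>x. f n x - v x) \<and> L2_norm_sq M (\<lambda>x. f n x - v x) \<le> e"
    if e: "e \<ge> 0" and N: "\<forall>m\<ge>N. \<forall>n\<ge>N. L2_norm_sq M (\<lambda>x. f m x - f n x) < e" "n \<ge> N" for e N n
  proof -
    have "(\<integral>\<^sup>+x. ennreal ((norm (f n x - v x))\<^sup>2) \<partial>M)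
        = (\<integral>\<^sup>+x. liminf (\<lambda>i. ennreal ((norm (f n x - f (r i) x))\<^sup>2)) \<partial>M)"
    proof (rule nn_integral_cong_AE, use conv in eventually_elim)
      case (elim x)
      have "(\<lambda>i. ennreal ((norm (f n x - f (r i) x))\<^sup>2)) \<longlonglongrightarrow> ennreal ((norm (f n x - v x))\<^sup>2)"
        by (intro tendsto_intros tendsto_ennrealI elim)
      then show ?case using lim_imp_Liminf by (metis trivial_limit_sequentially)
    qed
    also have "\<dots> \<le> liminf (\<lambda>i. \<integral>\<^sup>+x. ennreal ((norm (f n x - f (r i) x))\<^sup>2) \<partial>M)"
      by (rule nn_integral_liminf) measurable
    also have "\<dots> \<le> liminf (\<lambda>i. ennreal e)"
    proof (rule Liminf_mono, rule eventually_sequentiallyI[of N])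
      fix i assume "i \<ge> N"
      then have "r i \<ge> N" using seq_suble[OF r, of i] by simp
      then show "(\<integral>\<^sup>+x. ennreal ((norm (f n x - f (r i) x))\<^sup>2) \<partial>M) \<le> ennreal e"
        using N unfolding nn_integral_L2_norm_sq[OF L2_diff(1)[OF L L]]
          by (intro ennreal_leI) (auto intro: less_imp_le)
    qed
    finally have "(\<integral>\<^sup>+x. ennreal ((norm (f n x - v x))\<^sup>2) \<partial>M) \<le> ennreal e"
      by (simp add: Liminf_const)
    then show ?thesis using L2_norm_sq_leI[of "\<lambda>x. f n x - v x" M e] e by auto
  qed
  have "L2 M v"
  proof -
    obtain N where "\<forall>m\<ge>N. \<forall>n\<ge>N. L2_norm_sq M (\<lambda>x. f m x - f n x) < 1" using cauchy[of 1] by auto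
    then have "L2 M (\<lambda>x. f N x - v x)" using bound[of 1 N N] by simp
    then have "L2 M (\<lambda>x. f N x - (f N x - v x))" by (rule L2_diff(1)[OF L])
    then show ?thesis by simp
  qed
  moreover have "(\<lambda>n. L2_norm_sq M (\<lambda>x. f n x - v x)) \<longlonglongrightarrow> 0"
  proof (rule LIMSEQ_I)
    fix e :: real assume e: "e > 0"
    then obtain N where N: "\<forall>m\<ge>N. \<forall>n\<ge>N. L2_norm_sq M (\<lambda>x. f m x - f n x) < e / 2"
      using cauchy[of "e / 2"] by auto
    then have "norm (L2_norm_sq M (\<lambda>x. f n x - v x) - 0) < e" if "n \<ge> N" for n
      using bound[OF _ N that] e L2_norm_sq_nonneg[of M "\<lambda>x. f n x - v x"] by simp
    then show "\<exists>N. \<forall>n\<ge>N. norm (L2_norm_sq M (\<lambda>x. f n x - v x) - 0) < e" by blast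
  qed
  ultimately show ?thesis by blast
qed

text \<open>Cauchy-Schwarz with respect to the measure with density \<open>k x\<close>.\<close>

lemma schur_test:
  fixes k :: "'a \<Rightarrow> 'a \<Rightarrow> ennreal" and g :: "'a \<Rightarrow> ennreal"
  assumes k[measurable]: "case_prod k \<in> borel_measurable (M \<Otimes>\<^sub>M M)" and g[measurable]: "g \<in> borel_measurable M"
    and A1: "\<And>x. x \<in> space M \<Longrightarrow> (\<integral>\<^sup>+y. k x y \<partial>M) \<le> A"
    and A2: "\<And>y. y \<in> space M \<Longrightarrow> (\<integral>\<^sup>+x. k x y \<partial>M) \<le> A"
  shows "(\<integral>\<^sup>+x. (\<integral>\<^sup>+y. k x y * g y \<partial>M)\<^sup>2 \<partial>M) \<le> A\<^sup>2 * (\<integral>\<^sup>+y. (g y)\<^sup>2 \<partial>M)"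
proof -
  interpret P: pair_sigma_finite M M by unfold_locales
  have "(\<integral>\<^sup>+y. k x y * g y \<partial>M)\<^sup>2 \<le> A * (\<integral>\<^sup>+y. k x y * (g y)\<^sup>2 \<partial>M)" if x: "x \<in> space M" for x
  proof -
    have [measurable]: "k x \<in> borel_measurable M"
      using measurable_compose[OF measurable_Pair1'[OF x] k] by simp
    have "(\<integral>\<^sup>+y. 1 * g y \<partial>density M (k x))\<^sup>2 \<le> (\<integral>\<^sup>+y. 1\<^sup>2 \<partial>density M (k x)) * (\<integral>\<^sup>+y. (g y)\<^sup>2 \<partial>density M (k x))"
      by (intro Cauchy_Schwarz_nn_integral) auto
    then have "(\<integral>\<^sup>+y. k x y * g y \<partial>M)\<^sup>2 \<le> (\<integral>\<^sup>+y. k x y \<partial>M) * (\<integral>\<^sup>+y. k x y * (g y)\<^sup>2 \<partial>M)"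
      by (simp add: nn_integral_density emeasure_density)
    also have "\<dots> \<le> A * (\<integral>\<^sup>+y. k x y * (g y)\<^sup>2 \<partial>M)"
      by (intro mult_right_mono A1 x) auto
    finally show ?thesis .
  qed
  then have "(\<integral>\<^sup>+x. (\<integral>\<^sup>+y. k x y * g y \<partial>M)\<^sup>2 \<partial>M) \<le> (\<integral>\<^sup>+x. A * (\<integral>\<^sup>+y. k x y * (g y)\<^sup>2 \<partial>M) \<partial>M)"
    by (intro nn_integral_mono)
  also have "\<dots> = A * (\<integral>\<^sup>+x. (\<integral>\<^sup>+y. k x y * (g y)\<^sup>2 \<partial>M) \<partial>M)"
    by (intro nn_integral_cmult) measurable
  also have "(\<integral>\<^sup>+x. (\<integral>\<^sup>+y. k x y * (g y)\<^sup>2 \<partial>M) \<partial>M) = (\<integral>\<^sup>+y. (\<integral>\<^sup>+x. k x y * (g y)\<^sup>2 \<partial>M) \<partial>M)"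
    by (rule P.Fubini'[symmetric]) measurable
  also have "\<dots> = (\<integral>\<^sup>+y. (\<integral>\<^sup>+x. k x y \<partial>M) * (g y)\<^sup>2 \<partial>M)"
  proof (rule nn_integral_cong)
    fix y assume y: "y \<in> space M"
    have [measurable]: "(\<lambda>x. k x y) \<in> borel_measurable M"
      using measurable_compose[OF measurable_Pair2'[OF y] k] by simp
    show "(\<integral>\<^sup>+x. k x y * (g y)\<^sup>2 \<partial>M) = (\<integral>\<^sup>+x. k x y \<partial>M) * (g y)\<^sup>2"
      by (rule nn_integral_multc) measurable
  qed
  also have "\<dots> \<le> (\<integral>\<^sup>+y. A * (g y)\<^sup>2 \<partial>M)"
    by (intro nn_integral_mono mult_right_mono A2) auto
  also have "\<dots> = A * (\<integral>\<^sup>+y. (g y)\<^sup>2 \<partial>M)"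
    by (intro nn_integral_cmult) measurable
  finally show ?thesis
    by (simp add: power2_eq_square mult.assoc mult_left_mono)
qed

end

section \<open>Weakly singular integral operators\<close>

text \<open>The boundary is abstracted to what the theory of weakly singular kernels uses: a finite
  measure on a compact set for which the kernel has mass at most linear in the radius, with centres
  anywhere in space.\<close>

locale singular_measure =
  fixes S :: "'a::euclidean_space set" and M :: "'a measure" and C :: real
  assumes compact: "compact S" and space: "space M = S" and sets: "sets M = sets (restrict_space borel S)"
    and finite: "emeasure M S < \<infinity>" and C_nonneg: "C \<ge> 0"
    and sing: "\<And>x r. 0 < r \<Longrightarrow>
      (\<integral>\<^sup>+y. indicator (ball x r) y * inverse (ennreal (dist x y)) \<partial>M) \<le> ennreal (C * r)"
begin

sublocale finite_measure M
  by (rule finite_measureI) (use finite space in auto)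

lemma borel_imp_measurable: "f \<in> borel_measurable borel \<Longrightarrow> f \<in> borel_measurable M"
  by (subst measurable_cong_sets[OF sets refl]) (rule measurable_restrict_space1)

lemma continuous_imp_measurable: "continuous_on S f \<Longrightarrow> f \<in> borel_measurable M"
  by (subst measurable_cong_sets[OF sets refl]) (rule borel_measurable_continuous_on_restrict)

lemma measurable_id_M [measurable]: "(\<lambda>x. x) \<in> borel_measurable M"
  by (rule borel_imp_measurable) simp

lemma measurable_fst_M [measurable]: "(\<lambda>p. fst p) \<in> borel_measurable (M \<Otimes>\<^sub>M M)"
  and measurable_snd_M [measurable]: "(\<lambda>p. snd p) \<in> borel_measurable (M \<Otimes>\<^sub>M M)"
  using measurable_compose[OF measurable_fst measurable_id_M, of M]
    measurable_compose[OF measurable_snd measurable_id_M, of M] by simp_all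

text \<open>An atom at \<open>x\<close> would make the integral in \<open>sing\<close> infinite,
  because in \<open>ennreal\<close> the kernel is infinite on the diagonal.\<close>

lemma AE_neq: "AE y in M. y \<noteq> x"
proof -
  let ?f = "\<lambda>y. indicator (ball x 1) y * inverse (ennreal (dist x y))"
  have "?f \<in> borel_measurable M"
    by (rule borel_imp_measurable, intro borel_measurable_times_ennreal borel_measurable_indicator) (simp, measurable)
  moreover have "(\<integral>\<^sup>+y. ?f y \<partial>M) \<noteq> \<infinity>"
    using sing[of 1 x] by (auto simp: top_unique)
  ultimately have "AE y in M. ?f y \<noteq> \<infinity>" by (rule nn_integral_PInf_AE)
  then show ?thesis by eventually_elim auto
qed

section \<open>The single layer operator and its truncation\<close>

definition potential :: "('a \<Rightarrow> complex) \<Rightarrow> 'a \<Rightarrow> complex" where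
  "potential f x = (\<integral>y. f y / complex_of_real (dist x y) \<partial>M)"

definition truncated :: "real \<Rightarrow> ('a \<Rightarrow> complex) \<Rightarrow> 'a \<Rightarrow> complex" where
  "truncated \<delta> f x = (\<integral>y. f y / complex_of_real (max \<delta> (dist x y)) \<partial>M)"

text \<open>On the diagonal this kernel is infinite, whereas the quotient in
  \<open>potential\<close> is 0 there by division by zero; as an upper bound it is valid at every
  point closer than \<open>r\<close>.\<close>

definition ker :: "real \<Rightarrow> 'a \<Rightarrow> 'a \<Rightarrow> ennreal" where
  "ker r x y = (if dist x y < r then inverse (ennreal (dist x y)) else 0)"

lemma ker_measurable [measurable]: "case_prod (ker r) \<in> borel_measurable (M \<Otimes>\<^sub>M M)"
  unfolding ker_def case_prod_beta by measurable

lemma ker_bound: "r > 0 \<Longrightarrow> (\<integral>\<^sup>+y. ker r x y \<partial>M) \<le> ennreal (C * r)" "r > 0 \<Longrightarrow> (\<integral>\<^sup>+x. ker r x y \<partial>M) \<le> ennreal (C * r)"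
proof -
  have eq: "ker r x = (\<lambda>y. indicator (ball x r) y * inverse (ennreal (dist x y)))"
    "(\<lambda>y. ker r y x) = ker r x" for x
    by (auto simp: ker_def dist_commute fun_eq_iff)
  show "r > 0 \<Longrightarrow> (\<integral>\<^sup>+y. ker r x y \<partial>M) \<le> ennreal (C * r)" "r > 0 \<Longrightarrow> (\<integral>\<^sup>+x. ker r x y \<partial>M) \<le> ennreal (C * r)"
    using sing[of r x] sing[of r y] eq(2)[of y] by (simp_all add: eq(1))
qed

text \<open>The kernel is symmetric, so the one bound \<open>C * r\<close> serves both conditions of
  the Schur test.\<close>

lemma ker_schur:
  assumes "r > 0" "L2 M f"
  shows "(\<integral>\<^sup>+x. (\<integral>\<^sup>+y. ker r x y * ennreal (norm (f y)) \<partial>M)\<^sup>2 \<partial>M) \<le> ennreal ((C * r)\<^sup>2 * L2_norm_sq M f)"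
proof -
  have [measurable]: "f \<in> borel_measurable M" using assms(2) by (simp add: L2_def)
  have "(\<integral>\<^sup>+x. (\<integral>\<^sup>+y. ker r x y * ennreal (norm (f y)) \<partial>M)\<^sup>2 \<partial>M)
      \<le> (ennreal (C * r))\<^sup>2 * (\<integral>\<^sup>+y. (ennreal (norm (f y)))\<^sup>2 \<partial>M)"
    using ker_bound[OF assms(1)] by (intro schur_test) auto
  also have "\<dots> = ennreal ((C * r)\<^sup>2 * L2_norm_sq M f)"
    using nn_integral_L2_norm_sq[OF assms(2)] assms(1) C_nonneg
    by (simp add: ennreal_power ennreal_mult[symmetric] L2_norm_sq_nonneg)
  finally show ?thesis .
qed

text \<open>For \<open>R\<close> beyond the diameter, \<open>ker R\<close> is the full kernel on
  \<open>S\<close>, so the estimates for \<open>ker\<close> also cover the untruncated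
  operator.\<close>

lemma diameter_bound: "\<exists>R>0. \<forall>x\<in>S. \<forall>y\<in>S. dist x y < R"
proof -
  obtain R where "\<forall>x\<in>S. \<forall>y\<in>S. dist x y \<le> R"
    using compact_imp_bounded[OF compact] bounded_two_points by blast
  then have "\<forall>x\<in>S. \<forall>y\<in>S. dist x y < \<bar>R\<bar> + 1" by fastforce
  then show ?thesis by (intro exI[of _ "\<bar>R\<bar> + 1"]) auto
qed

lemma ennreal_norm_divide_dist_le:
  fixes z :: complex
  assumes "d \<ge> 0"
  shows "ennreal (norm (z / complex_of_real d)) \<le> inverse (ennreal d) * ennreal (norm z)"
proof (cases "d = 0")
  case False
  then show ?thesis
    using assms by (simp add: inverse_ennreal ennreal_mult[symmetric] norm_divide field_simps)
qed simp

lemma measurable_potential [measurable]: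
  assumes [measurable]: "f \<in> borel_measurable M"
  shows "potential f \<in> borel_measurable M"
proof -
  have [measurable]: "(\<lambda>p. f (snd p)) \<in> borel_measurable (M \<Otimes>\<^sub>M M)" by measurable
  have "(\<lambda>(x, y). f y / complex_of_real (dist x y)) \<in> borel_measurable (M \<Otimes>\<^sub>M M)"
    unfolding case_prod_beta by measurable
  then show ?thesis unfolding potential_def[abs_def]
    by (rule borel_measurable_lebesgue_integral)
qed

text \<open>By the Schur test the potential of \<open>norm (f y)\<close> is square integrable, hence
  finite almost everywhere.\<close>

lemma AE_potential_integrable:
  assumes "L2 M f"
  shows "AE x in M. integrable M (\<lambda>y. f y / complex_of_real (dist x y))"
proof -
  have [measurable]: "f \<in> borel_measurable M" using assms by (simp add: L2_def)
  obtain R where R: "R > 0" "\<forall>x\<in>S. \<forall>y\<in>S. dist x y < R" using diameter_bound by blast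
  let ?g = "\<lambda>x. (\<integral>\<^sup>+y. ker R x y * ennreal (norm (f y)) \<partial>M)\<^sup>2"
  have "(\<integral>\<^sup>+x. ?g x \<partial>M) < \<infinity>"
    using le_less_trans[OF ker_schur[OF R(1) assms]] by simp
  moreover have "?g \<in> borel_measurable M" by measurable
  ultimately have "AE x in M. ?g x \<noteq> \<infinity>" by (intro nn_integral_PInf_AE) auto
  then show ?thesis
  proof (rule AE_mp, intro AE_I2 impI)
    fix x assume x: "x \<in> space M" "?g x \<noteq> \<infinity>"
    have "(\<integral>\<^sup>+y. ennreal (norm (f y / complex_of_real (dist x y))) \<partial>M) \<le> (\<integral>\<^sup>+y. ker R x y * ennreal (norm (f y)) \<partial>M)"
      using x R(2) ennreal_norm_divide_dist_le
      by (intro nn_integral_mono) (auto simp: ker_def space)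
    also have "\<dots> < \<infinity>" using x(2) by (simp add: power_eq_top_ennreal less_top[symmetric])
    finally show "integrable M (\<lambda>y. f y / complex_of_real (dist x y))"
      by (simp add: integrable_iff_bounded)
  qed
qed

lemma L2_potential:
  assumes "L2 M f"
  shows "L2 M (potential f)"
proof -
  have [measurable]: "f \<in> borel_measurable M" using assms by (simp add: L2_def)
  obtain R where R: "R > 0" "\<forall>x\<in>S. \<forall>y\<in>S. dist x y < R" using diameter_bound by blast
  let ?g = "\<lambda>x. \<integral>\<^sup>+y. ker R x y * ennreal (norm (f y)) \<partial>M"
  have "(\<integral>\<^sup>+x. ennreal ((norm (potential f x))\<^sup>2) \<partial>M) \<le> (\<integral>\<^sup>+x. (?g x)\<^sup>2 \<partial>M)"
  proof (rule nn_integral_mono_AE, use AE_potential_integrable[OF assms] AE_space in eventually_elim)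
    case (elim x)
    have "ennreal (norm (potential f x)) \<le> (\<integral>\<^sup>+y. ennreal (norm (f y / complex_of_real (dist x y))) \<partial>M)"
      unfolding potential_def by (rule integral_norm_bound_ennreal[OF elim(1)])
    also have "\<dots> \<le> ?g x"
      using elim(2) R(2) ennreal_norm_divide_dist_le
      by (intro nn_integral_mono) (auto simp: ker_def space)
    finally show ?case
      using power_mono[of "ennreal (norm (potential f x))" "?g x" 2] by (simp add: ennreal_power)
  qed
  also have "\<dots> < \<infinity>"
    using le_less_trans[OF ker_schur[OF R(1) assms]] by simp
  finally show ?thesis by (simp add: L2_iff_nn_integral)
qed

lemma integrable_truncated:
  assumes "integrable M f" "\<delta> > 0"
  shows "integrable M (\<lambda>y. f y / complex_of_real (max \<delta> (dist x y)))"
proof (rule Bochner_Integration.integrable_bound)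
  have [measurable]: "f \<in> borel_measurable M" using assms(1) by simp
  show "integrable M (\<lambda>y. inverse \<delta> * norm (f y))" using assms(1) by simp
  show "(\<lambda>y. f y / complex_of_real (max \<delta> (dist x y))) \<in> borel_measurable M" by measurable
  show "AE y in M. norm (f y / complex_of_real (max \<delta> (dist x y))) \<le> norm (inverse \<delta> * norm (f y))"
    using assms(2) by (intro AE_I2) (auto simp: norm_divide divide_simps max_def intro!: mult_left_mono)
qed

text \<open>Taking the maximum with \<delta> does not increase differences, and the reciprocal has
  slope at most \<open>1 / \<delta>\<^sup>2\<close> beyond \<delta>.\<close>

lemma abs_truncated_kernel_diff:
  assumes "\<delta> > 0"
  shows "\<bar>1 / max \<delta> (dist x y) - 1 / max \<delta> (dist x' y)\<bar> \<le> dist x x' / \<delta>\<^sup>2"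
proof -
  let ?a = "max \<delta> (dist x y)" and ?b = "max \<delta> (dist x' y)"
  have ab: "?a \<ge> \<delta>" "?b \<ge> \<delta>" by auto
  have "\<bar>dist x y - dist x' y\<bar> \<le> dist x x'"
    using abs_dist_diff_le[of x y x'] by (simp add: dist_commute)
  then have "\<bar>?b - ?a\<bar> \<le> dist x x'" by (auto simp: max_def)
  have "\<bar>1 / ?a - 1 / ?b\<bar> = \<bar>?b - ?a\<bar> / (?a * ?b)"
  proof -
    have "?a > 0" "?b > 0" using assms by auto
    then have "1 / ?a - 1 / ?b = (?b - ?a) / (?a * ?b)" by (simp add: field_simps)
    then show ?thesis using \<open>?a > 0\<close> \<open>?b > 0\<close> by (simp only: abs_divide abs_mult abs_of_pos)
  qed
  also have "\<dots> \<le> dist x x' / (\<delta> * \<delta>)"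
    using ab assms \<open>\<bar>?b - ?a\<bar> \<le> dist x x'\<close> by (intro frac_le mult_mono) auto
  finally show ?thesis by (simp add: power2_eq_square)
qed

lemma truncated_lipschitz:
  assumes f: "integrable M f" and \<delta>: "\<delta> > 0"
  shows "norm (truncated \<delta> f x - truncated \<delta> f x') \<le> dist x x' / \<delta>\<^sup>2 * (\<integral>y. norm (f y) \<partial>M)"
proof -
  note int = integrable_truncated[OF f \<delta>]
  have "norm (truncated \<delta> f x - truncated \<delta> f x')
      = norm (\<integral>y. f y / complex_of_real (max \<delta> (dist x y)) - f y / complex_of_real (max \<delta> (dist x' y)) \<partial>M)"
    by (simp add: truncated_def int)
  also have "\<dots> \<le> (\<integral>y. norm (f y / complex_of_real (max \<delta> (dist x y)) - f y / complex_of_real (max \<delta> (dist x' y))) \<partial>M)"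
    by (rule integral_norm_bound)
  also have "\<dots> \<le> (\<integral>y. dist x x' / \<delta>\<^sup>2 * norm (f y) \<partial>M)"
  proof (rule integral_mono)
    fix y
    have "f y / complex_of_real (max \<delta> (dist x y)) - f y / complex_of_real (max \<delta> (dist x' y))
        = f y * complex_of_real (1 / max \<delta> (dist x y) - 1 / max \<delta> (dist x' y))"
      by (simp add: right_diff_distrib)
    then have "norm (f y / complex_of_real (max \<delta> (dist x y)) - f y / complex_of_real (max \<delta> (dist x' y)))
        = norm (f y) * \<bar>1 / max \<delta> (dist x y) - 1 / max \<delta> (dist x' y)\<bar>"
      by (simp only: norm_mult norm_of_real)
    then show "norm (f y / complex_of_real (max \<delta> (dist x y)) - f y / complex_of_real (max \<delta> (dist x' y)))
        \<le> dist x x' / \<delta>\<^sup>2 * norm (f y)"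
      using mult_right_mono[OF abs_truncated_kernel_diff[OF \<delta>, of x y x'] norm_ge_zero[of "f y"]]
      by (simp only: mult.commute)
  qed (use int f in auto)
  finally show ?thesis using f by simp
qed

lemma truncated_bound:
  assumes f: "integrable M f" and \<delta>: "\<delta> > 0"
  shows "norm (truncated \<delta> f x) \<le> (\<integral>y. norm (f y) \<partial>M) / \<delta>"
proof -
  have "norm (truncated \<delta> f x) \<le> (\<integral>y. norm (f y / complex_of_real (max \<delta> (dist x y))) \<partial>M)"
    unfolding truncated_def by (rule integral_norm_bound)
  also have "\<dots> \<le> (\<integral>y. norm (f y) / \<delta> \<partial>M)"
    using f \<delta> by (intro integral_mono integrable_norm integrable_truncated)
      (auto simp: norm_divide max_def intro!: divide_left_mono mult_pos_pos)
  finally show ?thesis using f by simp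
qed

lemma truncated_continuous:
  assumes "integrable M f" "\<delta> > 0"
  shows "continuous_on A (truncated \<delta> f)"
proof -
  let ?L = "(\<integral>y. norm (f y) \<partial>M) / \<delta>\<^sup>2"
  have "?L-lipschitz_on A (truncated \<delta> f)"
    using truncated_lipschitz[OF assms] by (intro lipschitz_onI) (auto simp: dist_norm[symmetric] mult.commute)
  then show ?thesis by (rule lipschitz_on_continuous_on)
qed

lemma truncated_tendsto_potential:
  assumes int: "integrable M (\<lambda>y. f y / complex_of_real (dist x y))" and [measurable]: "f \<in> borel_measurable M"
  shows "((\<lambda>\<delta>. truncated \<delta> f x) \<longlongrightarrow> potential f x) (at_right 0)"
proof (rule tendsto_at_right_sequentially[of 0 1])
  fix s :: "nat \<Rightarrow> real" assume s: "\<And>n. 0 < s n" "s \<longlonglongrightarrow> 0"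
  show "(\<lambda>n. truncated (s n) f x) \<longlonglongrightarrow> potential f x"
    unfolding truncated_def potential_def
  proof (rule integral_dominated_convergence[where w = "\<lambda>y. norm (f y / complex_of_real (dist x y))"])
    \<comment> \<open>The diagonal has to be left out: there the truncated quotients
      \<open>f y / s n\<close> may blow up, while the limit kernel has the value 0 by division by
      zero.\<close>
    show "AE y in M. (\<lambda>n. f y / complex_of_real (max (s n) (dist x y))) \<longlonglongrightarrow> f y / complex_of_real (dist x y)"
      using AE_neq[of x]
    proof eventually_elim
      case (elim y)
      then have "(\<lambda>n. f y / complex_of_real (max (s n) (dist x y))) \<longlonglongrightarrow> f y / complex_of_real (max 0 (dist x y))"
        using s by (intro tendsto_intros) (auto simp: max_def)
      then show ?case by (simp add: max_absorb2)
    qed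
    show "AE y in M. norm (f y / complex_of_real (max (s n) (dist x y))) \<le> norm (f y / complex_of_real (dist x y))" for n
      using AE_neq[of x]
    proof eventually_elim
      case (elim y)
      then have "dist x y > 0" by simp
      then show ?case
        using s(1)[of n] by (auto simp: norm_divide max_def intro!: divide_left_mono mult_pos_pos)
    qed
  qed (use int in auto)
qed simp

text \<open>The two kernels agree from distance \<delta> on, and below it their difference lies
  between 0 and \<open>1 / dist x y\<close>. So the error is dominated by
  \<open>ker \<delta>\<close>, whose Schur bound is \<open>C * \<delta>\<close>.\<close>

lemma potential_truncated_diff:
  assumes L: "L2 M f" and \<delta>: "\<delta> > 0"
  shows "L2 M (\<lambda>x. potential f x - truncated \<delta> f x)"
    and "L2_norm_sq M (\<lambda>x. potential f x - truncated \<delta> f x) \<le> (C * \<delta>)\<^sup>2 * L2_norm_sq M f"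
proof -
  have [measurable]: "f \<in> borel_measurable M" using L by (simp add: L2_def)
  note int = L2_imp_integrable(1)[OF L]
  let ?g = "\<lambda>x. \<integral>\<^sup>+y. ker \<delta> x y * ennreal (norm (f y)) \<partial>M"
  have "(\<integral>\<^sup>+x. ennreal ((norm (potential f x - truncated \<delta> f x))\<^sup>2) \<partial>M) \<le> (\<integral>\<^sup>+x. (?g x)\<^sup>2 \<partial>M)"
  proof (rule nn_integral_mono_AE, use AE_potential_integrable[OF L] in eventually_elim)
    case (elim x)
    note int' = integrable_truncated[OF int \<delta>, of x]
    have "ennreal (norm (potential f x - truncated \<delta> f x))
        = ennreal (norm (\<integral>y. f y / complex_of_real (dist x y) - f y / complex_of_real (max \<delta> (dist x y)) \<partial>M))"
      unfolding potential_def truncated_def using elim int' by simp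
    also have "\<dots> \<le> (\<integral>\<^sup>+y. ennreal (norm (f y / complex_of_real (dist x y) - f y / complex_of_real (max \<delta> (dist x y)))) \<partial>M)"
      using elim int' by (intro integral_norm_bound_ennreal) auto
    also have "\<dots> \<le> ?g x"
    proof (rule nn_integral_mono_AE, use AE_neq[of x] in eventually_elim)
      case (elim y)
      then have d: "dist x y > 0" by simp
      show ?case
      proof (cases "dist x y < \<delta>")
        case True
        have "f y / complex_of_real (dist x y) - f y / complex_of_real (max \<delta> (dist x y))
            = f y * complex_of_real (1 / dist x y - 1 / \<delta>)"
          using True by (simp add: right_diff_distrib max_def)
        then have "norm (f y / complex_of_real (dist x y) - f y / complex_of_real (max \<delta> (dist x y)))
            = norm (f y) * \<bar>1 / dist x y - 1 / \<delta>\<bar>"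
          by (simp only: norm_mult norm_of_real)
        also have "\<dots> \<le> norm (f y) * (1 / dist x y)"
        proof (rule mult_left_mono)
          have "1 / \<delta> \<le> 1 / dist x y" using True d \<delta> by (intro divide_left_mono mult_pos_pos) auto
          moreover have "0 \<le> 1 / \<delta>" using \<delta> by simp
          ultimately show "\<bar>1 / dist x y - 1 / \<delta>\<bar> \<le> 1 / dist x y" by linarith
        qed simp
        finally have "ennreal (norm (f y / complex_of_real (dist x y) - f y / complex_of_real (max \<delta> (dist x y))))
            \<le> ennreal (inverse (dist x y) * norm (f y))"
          by (intro ennreal_leI) (simp add: field_simps)
        then show ?thesis
          using True d by (simp add: ker_def inverse_ennreal ennreal_mult)
      qed (simp add: ker_def max_def)
    qed
    finally show ?case
      using power_mono[of "ennreal (norm (potential f x - truncated \<delta> f x))" "?g x" 2] by (simp add: ennreal_power)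
  qed
  also have "\<dots> \<le> ennreal ((C * \<delta>)\<^sup>2 * L2_norm_sq M f)"
    by (rule ker_schur[OF \<delta> L])
  finally have *: "(\<integral>\<^sup>+x. ennreal ((norm (potential f x - truncated \<delta> f x))\<^sup>2) \<partial>M) \<le> ennreal ((C * \<delta>)\<^sup>2 * L2_norm_sq M f)" .
  have "truncated \<delta> f \<in> borel_measurable M"
    by (rule continuous_imp_measurable truncated_continuous[OF int \<delta>])+
  then have m: "(\<lambda>x. potential f x - truncated \<delta> f x) \<in> borel_measurable M" by measurable
  show "L2 M (\<lambda>x. potential f x - truncated \<delta> f x)"
    "L2_norm_sq M (\<lambda>x. potential f x - truncated \<delta> f x) \<le> (C * \<delta>)\<^sup>2 * L2_norm_sq M f"
    using L2_norm_sq_leI[OF m *] by (simp_all add: L2_norm_sq_nonneg)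
qed

text \<open>A bound in the square norm bounds the integrals of the norms by \<open>K\<close>, which
  makes each truncated family uniformly bounded and equi-Lipschitz, as Arzela-Ascoli requires. A
  diagonal sequence then serves all cut-offs \<open>1 / real (Suc n)\<close> at once.\<close>

lemma truncated_subsequence:
  fixes F :: "nat \<Rightarrow> 'a \<Rightarrow> complex"
  assumes L: "\<And>j. L2 M (F j)" and B: "\<And>j. L2_norm_sq M (F j) \<le> B"
  shows "\<exists>r :: nat \<Rightarrow> nat. strict_mono r \<and> (\<forall>n. \<exists>g. \<forall>e>0. \<exists>N. \<forall>j\<ge>N. \<forall>x\<in>S.
    norm (truncated (1 / real (Suc n)) (F (r j)) x - g x) < e)"
proof -
  define P where "P n s \<longleftrightarrow> (\<exists>g. \<forall>e>0. \<exists>N. \<forall>j\<ge>N. \<forall>x\<in>S.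
    norm (truncated (1 / real (Suc n)) (F (s j)) x - g x) < e)" for n and s :: "nat \<Rightarrow> nat"
  define K where "K = sqrt (measure M (space M) * B) + 1"
  note int = L2_imp_integrable(1)[OF L]
  have K: "K > 0" "(\<integral>y. norm (F j y) \<partial>M) \<le> K" for j
  proof -
    have "(\<integral>y. norm (F j y) \<partial>M)\<^sup>2 \<le> measure M (space M) * B"
      using L2_imp_integrable(2)[OF L, of j] mult_left_mono[OF B[of j], of "measure M (space M)"] by simp
    then have "(\<integral>y. norm (F j y) \<partial>M) \<le> sqrt (measure M (space M) * B)"
      by (rule real_le_rsqrt)
    then show "(\<integral>y. norm (F j y) \<partial>M) \<le> K" by (simp add: K_def)
    have "(\<integral>y. norm (F j y) \<partial>M) \<ge> 0" by simp
    then show "K > 0" using \<open>(\<integral>y. norm (F j y) \<partial>M) \<le> sqrt (measure M (space M) * B)\<close> unfolding K_def by linarith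
  qed
  interpret subseqs P
  proof
    fix n and s :: "nat \<Rightarrow> nat"
    let ?\<delta> = "1 / real (Suc n)"
    have \<delta>: "?\<delta> > 0" by simp
    obtain g k where "continuous_on S g" "strict_mono (k :: nat \<Rightarrow> nat)"
      "\<And>e. 0 < e \<Longrightarrow> \<exists>N. \<forall>n x. n \<ge> N \<and> x \<in> S \<longrightarrow> norm (truncated ?\<delta> (F (s (k n))) x - g x) < e"
    proof (rule Arzela_Ascoli[OF compact, where \<F> = "\<lambda>j. truncated ?\<delta> (F (s j))" and M = "K / ?\<delta>"])
      fix j x
      have "norm (truncated ?\<delta> (F (s j)) x) \<le> (\<integral>y. norm (F (s j) y) \<partial>M) / ?\<delta>"
        by (rule truncated_bound[OF int \<delta>])
      also have "\<dots> \<le> K / ?\<delta>" using K(2) \<delta> by (intro divide_right_mono) auto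
      finally show "norm (truncated ?\<delta> (F (s j)) x) \<le> K / ?\<delta>" .
    next
      fix x and e :: real assume e: "e > 0"
      \<comment> \<open>Dictated by the Lipschitz constant \<open>K / ?\<delta>\<^sup>2\<close>; the
        1 added in the definition of \<open>K\<close> makes the division legitimate.\<close>
      let ?d = "e * ?\<delta>\<^sup>2 / K"
      have "norm (truncated ?\<delta> (F (s j)) x - truncated ?\<delta> (F (s j)) y) < e" if "norm (x - y) < ?d" for j y
      proof -
        have "norm (truncated ?\<delta> (F (s j)) x - truncated ?\<delta> (F (s j)) y)
            \<le> dist x y / ?\<delta>\<^sup>2 * (\<integral>y. norm (F (s j) y) \<partial>M)"
          by (rule truncated_lipschitz[OF int \<delta>])
        also have "\<dots> \<le> dist x y / ?\<delta>\<^sup>2 * K" by (intro mult_left_mono K) simp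
        also have "\<dots> < e"
        proof -
          have "dist x y * K < e * ?\<delta>\<^sup>2" using that K(1) by (simp add: dist_norm pos_less_divide_eq)
          moreover have "?\<delta>\<^sup>2 > 0" by simp
          ultimately have "dist x y * K / ?\<delta>\<^sup>2 < e" by (simp only: pos_divide_less_eq)
          then show ?thesis by simp
        qed
        finally show ?thesis .
      qed
      moreover have "?d > 0" using e K(1) by (intro divide_pos_pos mult_pos_pos) auto
      ultimately show "\<exists>d>0. \<forall>n y. y \<in> S \<and> norm (x - y) < d \<longrightarrow>
          norm (truncated ?\<delta> (F (s n)) x - truncated ?\<delta> (F (s n)) y) < e" by blast
    qed blast
    then have "strict_mono k \<and> P n (s \<circ> k)" unfolding P_def o_def by meson
    then show "\<exists>r'. strict_mono r' \<and> P n (s \<circ> r')" by blast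
  qed
  \<comment> \<open>The diagonal sequence is guaranteed the \<open>n\<close>-th property only from
    index \<open>Suc n\<close> on; uniform convergence does not depend on the initial terms.\<close>
  have tail: "P n s" if shift: "P n (s \<circ> (+) k)" for n k s
  proof -
    obtain g where g: "\<And>e. e > 0 \<Longrightarrow> \<exists>N. \<forall>j\<ge>N. \<forall>x\<in>S. norm (truncated (1 / real (Suc n)) (F (s (k + j))) x - g x) < e"
      using shift unfolding P_def o_def by blast
    have "\<exists>N. \<forall>j\<ge>N. \<forall>x\<in>S. norm (truncated (1 / real (Suc n)) (F (s j)) x - g x) < e" if e: "e > 0" for e
    proof -
      obtain N where N: "\<forall>j\<ge>N. \<forall>x\<in>S. norm (truncated (1 / real (Suc n)) (F (s (k + j))) x - g x) < e"
        using g[OF e] by blast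
      have "\<forall>x\<in>S. norm (truncated (1 / real (Suc n)) (F (s j)) x - g x) < e" if "j \<ge> k + N" for j
        using N[rule_format, of "j - k"] that by auto
      then show ?thesis by blast
    qed
    then show ?thesis unfolding P_def by blast
  qed
  have "P n (s \<circ> r)" if r: "strict_mono r" and P: "P n s" for r s n
  proof -
    obtain g where g: "\<And>e. e > 0 \<Longrightarrow> \<exists>N. \<forall>j\<ge>N. \<forall>x\<in>S. norm (truncated (1 / real (Suc n)) (F (s j)) x - g x) < e"
      using P unfolding P_def by blast
    have "\<exists>N. \<forall>j\<ge>N. \<forall>x\<in>S. norm (truncated (1 / real (Suc n)) (F (s (r j))) x - g x) < e" if "e > 0" for e
      using g[OF that] seq_suble[OF r] order_trans by meson
    then show ?thesis unfolding P_def o_def by blast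
  qed
  from diagseq_holds[OF this] have "P n (diagseq \<circ> (+) (Suc n))" for n .
  then have "P n diagseq" for n by (rule tail)
  then show ?thesis using subseq_diagseq unfolding P_def by blast
qed

text \<open>Limits of compact operators in operator norm are compact. The difference of two
  potentials splits into two truncation errors, small for small \<delta> uniformly in the sequence,
  and a difference of truncated potentials, small uniformly on \<open>S\<close> along the
  subsequence; completeness supplies the limit.\<close>

theorem potential_compact:
  fixes F :: "nat \<Rightarrow> 'a \<Rightarrow> complex"
  assumes L: "\<And>j. L2 M (F j)" and B: "\<And>j. L2_norm_sq M (F j) \<le> B"
  shows "\<exists>r v. strict_mono r \<and> L2 M v \<and> (\<lambda>j. L2_norm_sq M (\<lambda>x. potential (F (r j)) x - v x)) \<longlonglongrightarrow> 0"
proof -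
  obtain r :: "nat \<Rightarrow> nat" where r: "strict_mono r" and unif: "\<And>n. \<exists>g. \<forall>e>0. \<exists>N. \<forall>j\<ge>N. \<forall>x\<in>S.
      norm (truncated (1 / real (Suc n)) (F (r j)) x - g x) < e"
    using truncated_subsequence[of F B, OF L B] by blast
  note int = L2_imp_integrable(1)[OF L]
  let ?m = "measure M (space M)"
  have "B \<ge> 0" using B L2_norm_sq_nonneg order_trans by blast
  have "\<exists>N. \<forall>i\<ge>N. \<forall>j\<ge>N. L2_norm_sq M (\<lambda>x. potential (F (r i)) x - potential (F (r j)) x) < e"
    if e: "e > 0" for e
  proof -
    \<comment> \<open>Each truncation error has squared norm at most
      \<open>C\<^sup>2 * B * \<delta>\<^sup>2\<close>; two of them, with the factors 2 from
      \<open>L2_diff\<close> and \<open>L2_add\<close>, give 8.\<close>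
    have "(\<lambda>n. 8 * C\<^sup>2 * B * ((1 / real (Suc n)) * (1 / real (Suc n)))) \<longlonglongrightarrow> 8 * C\<^sup>2 * B * (0 * 0)"
      by (intro tendsto_intros lim_inverse_n'[THEN LIMSEQ_Suc])
    then have "\<forall>\<^sub>F n in sequentially. 8 * C\<^sup>2 * B * ((1 / real (Suc n)) * (1 / real (Suc n))) < e / 2"
      using e by (intro order_tendstoD(2)) auto
    then obtain n where n: "8 * C\<^sup>2 * B * ((1 / real (Suc n)) * (1 / real (Suc n))) < e / 2"
      using eventually_happens'[OF sequentially_bot] by blast
    define \<delta> where "\<delta> = 1 / real (Suc n)"
    have \<delta>: "\<delta> > 0" by (simp add: \<delta>_def)
    \<comment> \<open>Chosen so that the uniform error \<open>2 * \<eta>\<close>, squared,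
      integrated and doubled by \<open>L2_add\<close>, is at most \<open>e / 2\<close>; the summand
      1 guards against zero measure.\<close>
    define \<eta> where "\<eta> = sqrt (e / (16 * (?m + 1)))"
    have m1: "?m + 1 > 0" by (simp add: add_nonneg_pos)
    have \<eta>: "\<eta> > 0" "\<eta>\<^sup>2 = e / (16 * (?m + 1))" using e m1 by (simp_all add: \<eta>_def)
    obtain g N where N: "\<forall>j\<ge>N. \<forall>x\<in>S. norm (truncated \<delta> (F (r j)) x - g x) < \<eta>"
      using unif[of n] \<eta>(1) unfolding \<delta>_def by blast
    have "L2_norm_sq M (\<lambda>x. potential (F (r i)) x - potential (F (r j)) x) < e" if ij: "i \<ge> N" "j \<ge> N" for i j
    proof -
      let ?p = "\<lambda>i x. potential (F (r i)) x - truncated \<delta> (F (r i)) x"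
      let ?t = "\<lambda>x. truncated \<delta> (F (r i)) x - truncated \<delta> (F (r j)) x"
      have tm: "truncated \<delta> (F (r k)) \<in> borel_measurable M" for k
        by (rule continuous_imp_measurable truncated_continuous[OF int \<delta>])+
      have p: "L2 M (?p k)" "L2_norm_sq M (?p k) \<le> C\<^sup>2 * B * \<delta>\<^sup>2" for k
      proof -
        show "L2 M (?p k)" by (rule potential_truncated_diff(1)[OF L \<delta>])
        have "L2_norm_sq M (?p k) \<le> (C * \<delta>)\<^sup>2 * L2_norm_sq M (F (r k))"
          by (rule potential_truncated_diff(2)[OF L \<delta>])
        also have "\<dots> \<le> (C * \<delta>)\<^sup>2 * B" by (intro mult_left_mono B) simp
        finally show "L2_norm_sq M (?p k) \<le> C\<^sup>2 * B * \<delta>\<^sup>2" by (simp add: power_mult_distrib mult_ac)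
      qed
      have "norm (?t x) \<le> 2 * \<eta>" if "x \<in> S" for x
      proof -
        have "norm (truncated \<delta> (F (r i)) x - g x) < \<eta>" "norm (truncated \<delta> (F (r j)) x - g x) < \<eta>"
          using N ij that by auto
        then show ?thesis
          using norm_triangle_ineq4[of "truncated \<delta> (F (r i)) x - g x" "truncated \<delta> (F (r j)) x - g x"] by simp
      qed
      then have "(norm (?t x))\<^sup>2 \<le> (2 * \<eta>)\<^sup>2" if "x \<in> S" for x
        using that by (intro power_mono) auto
      then have "(\<integral>\<^sup>+x. ennreal ((norm (?t x))\<^sup>2) \<partial>M) \<le> (\<integral>\<^sup>+x. ennreal ((2 * \<eta>)\<^sup>2) \<partial>M)"
        by (intro nn_integral_mono ennreal_leI) (simp add: space)
      also have "\<dots> = ennreal (4 * \<eta>\<^sup>2 * ?m)"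
        by (simp add: emeasure_eq_measure ennreal_mult[symmetric] power_mult_distrib)
      finally have t: "L2 M ?t" "L2_norm_sq M ?t \<le> 4 * \<eta>\<^sup>2 * ?m"
        using L2_norm_sq_leI[of ?t M "4 * \<eta>\<^sup>2 * ?m"] tm by auto
      have "L2_norm_sq M (\<lambda>x. (?p i x - ?p j x) + ?t x)
          \<le> 2 * L2_norm_sq M (\<lambda>x. ?p i x - ?p j x) + 2 * L2_norm_sq M ?t"
        by (rule L2_add(2)[OF L2_diff(1)[OF p(1) p(1)] t(1)])
      moreover have "L2_norm_sq M (\<lambda>x. ?p i x - ?p j x) \<le> 2 * L2_norm_sq M (?p i) + 2 * L2_norm_sq M (?p j)"
        by (rule L2_diff(2)[OF p(1) p(1)])
      ultimately have "L2_norm_sq M (\<lambda>x. (?p i x - ?p j x) + ?t x) \<le> 8 * (C\<^sup>2 * B * \<delta>\<^sup>2) + 8 * \<eta>\<^sup>2 * ?m"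
        using p(2)[of i] p(2)[of j] t(2) by linarith
      moreover have "8 * \<eta>\<^sup>2 * ?m \<le> e / 2"
      proof -
        have "8 * \<eta>\<^sup>2 * ?m \<le> 8 * \<eta>\<^sup>2 * (?m + 1)" by (intro mult_left_mono) auto
        also have "\<dots> = e / 2" using m1 unfolding \<eta>(2) by (simp add: field_simps)
        finally show ?thesis .
      qed
      moreover have "8 * (C\<^sup>2 * B * \<delta>\<^sup>2) < e / 2" using n by (simp add: \<delta>_def power2_eq_square mult_ac)
      ultimately show ?thesis by (simp add: algebra_simps)
    qed
    then show ?thesis by blast
  qed
  then have "\<exists>v. L2 M v \<and> (\<lambda>j. L2_norm_sq M (\<lambda>x. potential (F (r j)) x - v x)) \<longlonglongrightarrow> 0"
    using L2_potential[OF L] by (intro L2_complete) auto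
  then show ?thesis using r by blast
qed

text \<open>A one-sided limit of functions continuous in \<open>x\<close>: by the Cauchy criterion the set where
  the limit exists is a countable combination of closed sets, and off it \<open>Lim\<close> is a constant.\<close>

lemma measurable_Lim_at_right:
  fixes T :: "'a \<Rightarrow> real \<Rightarrow> complex"
  assumes cont: "\<And>\<delta>. \<delta> > 0 \<Longrightarrow> continuous_on S (\<lambda>x. T x \<delta>)"
  shows "(\<lambda>x. Lim (at_right 0) (T x)) \<in> borel_measurable M"
proof -
  \<comment> \<open>The parameters \<open>s\<close> and \<open>t\<close> range over an uncountable
    set, which is harmless because each condition is closed in \<open>x\<close>; the nonstrict bound
    is what makes it closed.\<close>
  define G where "G m n = {x\<in>S. \<forall>s t. 0 < s \<longrightarrow> s < 1 / real (Suc n) \<longrightarrow> 0 < t \<longrightarrow> t < 1 / real (Suc n) \<longrightarrow>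
    dist (T x s) (T x t) \<le> 1 / real (Suc m)}" for m n
  define E where "E = (\<Inter>m. \<Union>n. G m n)"
  have cl: "closed S" using compact by (rule compact_imp_closed)
  have "closed (G m n)" for m n
  proof -
    have "G m n = S \<inter> (\<Inter>(s, t)\<in>{(s, t). 0 < s \<and> s < 1 / real (Suc n) \<and> 0 < t \<and> t < 1 / real (Suc n)}.
        {x\<in>S. dist (T x s) (T x t) \<le> 1 / real (Suc m)})"
      by (auto simp: G_def)
    moreover have "closed {x\<in>S. dist (T x s) (T x t) \<le> 1 / real (Suc m)}" if "0 < s" "0 < t" for s t
      using cont[OF that(1)] cont[OF that(2)] cl
      by (intro continuous_on_closed_Collect_le continuous_intros) auto
    ultimately show ?thesis using cl by (auto intro!: closed_Int closed_INT)
  qed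
  moreover have "G m n \<subseteq> S" for m n by (auto simp: G_def)
  ultimately have "G m n \<in> sets M" for m n
    using cl by (simp add: sets sets_restrict_space_iff)
  then have E: "E \<in> sets M" unfolding E_def by auto
  have E_iff: "x \<in> E \<longleftrightarrow> (\<exists>l. (T x \<longlongrightarrow> l) (at_right 0))" if x: "x \<in> S" for x
  proof
    assume "\<exists>l. (T x \<longlongrightarrow> l) (at_right 0)"
    then obtain l where l: "(T x \<longlongrightarrow> l) (at_right 0)" by blast
    have "\<exists>n. x \<in> G m n" for m
    proof -
      have "\<forall>\<^sub>F \<delta> in at_right 0. dist (T x \<delta>) l < 1 / real (Suc m) / 2"
        using l by (rule tendstoD) simp
      then obtain b where b: "b > 0" "\<And>s. 0 < s \<Longrightarrow> s < b \<Longrightarrow> dist (T x s) l < 1 / real (Suc m) / 2"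
        by (auto simp: eventually_at_right[of 0 1])
      obtain n where n: "1 / real (Suc n) < b" using b(1) nat_approx_posE by blast
      have "dist (T x s) (T x t) \<le> 1 / real (Suc m)"
        if "0 < s" "s < 1 / real (Suc n)" "0 < t" "t < 1 / real (Suc n)" for s t
        using b(2)[of s] b(2)[of t] that n dist_triangle2[of "T x s" "T x t" l] by linarith
      then show ?thesis using x by (auto simp: G_def)
    qed
    then show "x \<in> E" by (auto simp: E_def)
  next
    assume "x \<in> E"
    then have "\<forall>m. \<exists>n. x \<in> G m n" by (auto simp: E_def)
    then obtain n where n: "\<And>m. x \<in> G m (n m)" by metis
    have inv: "(\<lambda>k. 1 / real (Suc k)) \<longlonglongrightarrow> 0"
      by (rule lim_inverse_n'[THEN LIMSEQ_Suc])
    have near: "dist (T x s) (T x t) \<le> 1 / real (Suc m)"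
      if "0 < s" "s < 1 / real (Suc (n m))" "0 < t" "t < 1 / real (Suc (n m))" for m s t
      using n[of m] that by (auto simp: G_def)
    have small: "\<forall>\<^sub>F k in sequentially. 1 / real (Suc k) < 1 / real (Suc (n m))" for m
      using inv by (intro order_tendstoD(2)) auto
    have arch: "\<exists>m. 1 / real (Suc m) < e" if "e > 0" for e
      using that nat_approx_posE by blast
    have "Cauchy (\<lambda>k. T x (1 / real (Suc k)))"
    proof (rule metric_CauchyI)
      fix e :: real assume "e > 0"
      then obtain m where m: "1 / real (Suc m) < e" using arch by blast
      obtain N where "\<forall>k\<ge>N. 1 / real (Suc k) < 1 / real (Suc (n m))"
        using small[of m] by (auto simp: eventually_sequentially)
      then have "dist (T x (1 / real (Suc i))) (T x (1 / real (Suc j))) < e" if "i \<ge> N" "j \<ge> N" for i j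
        using near[of "1 / real (Suc i)" m "1 / real (Suc j)"] that m by fastforce
      then show "\<exists>N. \<forall>i\<ge>N. \<forall>j\<ge>N. dist (T x (1 / real (Suc i))) (T x (1 / real (Suc j))) < e" by blast
    qed
    then obtain l where l: "(\<lambda>k. T x (1 / real (Suc k))) \<longlonglongrightarrow> l"
      using Cauchy_convergent_iff convergent_def by blast
    have "(T x \<longlongrightarrow> l) (at_right 0)"
    proof (rule tendstoI)
      fix e :: real assume "e > 0"
      then obtain m where m: "1 / real (Suc m) < e" using arch by blast
      have "dist (T x s) l \<le> 1 / real (Suc m)" if s: "0 < s" "s < 1 / real (Suc (n m))" for s
      proof -
        have lim: "(\<lambda>k. dist (T x s) (T x (1 / real (Suc k)))) \<longlonglongrightarrow> dist (T x s) l"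
          by (intro tendsto_intros l)
        obtain N where N: "\<forall>k\<ge>N. 1 / real (Suc k) < 1 / real (Suc (n m))"
          using small[of m] by (auto simp: eventually_sequentially)
        have "\<forall>k\<ge>N. dist (T x s) (T x (1 / real (Suc k))) \<le> 1 / real (Suc m)"
          using near[OF s] N by auto
        then show ?thesis by (rule Lim_bounded[OF lim])
      qed
      then show "\<forall>\<^sub>F s in at_right 0. dist (T x s) l < e"
        using m by (intro eventually_at_rightI[of 0 "1 / real (Suc (n m))"]) (auto intro: le_less_trans)
    qed
    then show "\<exists>l. (T x \<longlongrightarrow> l) (at_right 0)" by blast
  qed
  \<comment> \<open>The default value of \<open>Lim\<close>: where no limit exists, its defining
    predicate is false for every candidate.\<close>
  define c :: complex where "c = (THE l. False)"
  have "Lim (at_right 0) (T x) = (if x \<in> E then lim (\<lambda>k. T x (1 / real (Suc k))) else c)" if x: "x \<in> S" for x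
  proof (cases "x \<in> E")
    case True
    then obtain l where l: "(T x \<longlongrightarrow> l) (at_right 0)" using E_iff[OF x] by blast
    have "filterlim (\<lambda>k. 1 / real (Suc k)) (at_right 0) sequentially"
      using lim_inverse_n'[THEN LIMSEQ_Suc] by (auto simp: filterlim_at intro!: eventuallyI)
    then have "(\<lambda>k. T x (1 / real (Suc k))) \<longlonglongrightarrow> l"
      using l by (rule filterlim_compose[rotated])
    then have "lim (\<lambda>k. T x (1 / real (Suc k))) = l" by (rule limI)
    moreover have "Lim (at_right 0) (T x) = l" using l by (intro tendsto_Lim) auto
    ultimately show ?thesis using True by (simp only: if_True)
  next
    case False
    then show ?thesis using E_iff[OF x] by (simp add: Topological_Spaces.Lim_def c_def)
  qed
  moreover have "(\<lambda>x. if x \<in> E then lim (\<lambda>k. T x (1 / real (Suc k))) else c) \<in> borel_measurable M"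
  proof -
    have [measurable]: "(\<lambda>x. T x (1 / real (Suc k))) \<in> borel_measurable M" for k
      by (intro continuous_imp_measurable cont) simp
    note E[measurable]
    show ?thesis by measurable
  qed
  ultimately show ?thesis
    by (subst measurable_cong[where g = "\<lambda>x. if x \<in> E then lim (\<lambda>k. T x (1 / real (Suc k))) else c"]) (auto simp: space)
qed

end

locale smooth_domain =
  fixes D :: "(real^3) set"
  assumes smooth_domain: "bounded_smooth_domain D"
begin

abbreviation "\<sigma> \<equiv> bdry_measure D"

lemma surface: "is_surface_measure (frontier D) \<sigma>"
  by (rule is_surface_measure_bdry[OF smooth_domain])

text \<open>The locale \<open>singular_measure\<close> takes the constant as a parameter, so the
  sublocale below needs a term that names one.\<close>

definition "singular_bound = (SOME C. C \<ge> 0 \<and> (\<forall>x r. 0 < r \<longrightarrow>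
  (\<integral>\<^sup>+y. indicator (ball x r) y * inverse (ennreal (dist x y)) \<partial>\<sigma>) \<le> ennreal (C * r)))"

sublocale singular_measure "frontier D" \<sigma> singular_bound
proof -
  obtain n B V \<phi> a b where atl: "patch_atlas (frontier D) n B V \<phi> a b"
    using exists_patch_atlas[OF smooth_domain] by blast
  have "\<exists>C. C \<ge> 0 \<and> (\<forall>x r. 0 < r \<longrightarrow>
      (\<integral>\<^sup>+y. indicator (ball x r) y * inverse (ennreal (dist x y)) \<partial>\<sigma>) \<le> ennreal (C * r))"
    using surface_measure_singular_bound[OF surface atl] by blast
  then have "singular_bound \<ge> 0 \<and> (\<forall>x r. 0 < r \<longrightarrow>
      (\<integral>\<^sup>+y. indicator (ball x r) y * inverse (ennreal (dist x y)) \<partial>\<sigma>) \<le> ennreal (singular_bound * r))"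
    unfolding singular_bound_def by (rule someI_ex)
  then show "singular_measure (frontier D) \<sigma> singular_bound"
    using surface_measure_finite[OF surface atl] is_surface_measureD(1,2)[OF surface] smooth_domain
    by unfold_locales (auto simp: bounded_smooth_domain_def intro!: compact_frontier_bounded)
qed

end

section \<open>Weak surface gradients\<close>

text \<open>Boxes generate the Borel sets and are stable under intersection, and the sets of
  integral 0 are closed under complements and countable disjoint unions. So all set integrals
  vanish, which determines real and imaginary part almost everywhere.\<close>

lemma (in singular_measure) AE_zero_of_box_integrals:
  fixes f :: "'a \<Rightarrow> complex"
  assumes f: "integrable M f"
    and box: "\<And>a b. (\<integral>x. indicator (box a b) x *\<^sub>R f x \<partial>M) = 0"
  shows "AE x in M. f x = 0"
proof -
  have cl: "closed S" using compact by (rule compact_imp_closed)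
  let ?G = "range (\<lambda>(a, b). box a b :: 'a set)"
  have M_iff: "A \<in> sets M \<longleftrightarrow> A \<subseteq> S \<and> A \<in> sets borel" for A
    using cl by (simp add: sets sets_restrict_space_iff)
  have ind: "(LINT x:A \<inter> S|M. f x) = (\<integral>x. indicator A x *\<^sub>R f x \<partial>M)" for A
    unfolding set_lebesgue_integral_def
    by (rule Bochner_Integration.integral_cong) (auto simp: space indicator_def)
  have set_int: "set_integrable M A f" if "A \<in> sets M" for A
    using f that by (auto simp: set_integrable_def intro: integrable_mult_indicator)
  \<comment> \<open>Closure under complements requires the total integral to vanish; it does because
    the compact set \<open>S\<close> fits into a box.\<close>
  have all: "(\<integral>x. f x \<partial>M) = 0"
  proof -
    obtain c where "S \<subseteq> box (- c) c"
      using bounded_subset_box_symmetric[OF compact_imp_bounded[OF compact]] by blast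
    then have "(\<integral>x. indicator (box (- c) c) x *\<^sub>R f x \<partial>M) = (\<integral>x. f x \<partial>M)"
      by (intro Bochner_Integration.integral_cong) (auto simp: space indicator_def)
    then show ?thesis using box by simp
  qed
  have zero: "(LINT x:A \<inter> S|M. f x) = 0" if "A \<in> sets borel" for A
  proof -
    have "Int_stable ?G" by (auto simp: Int_stable_def box_Int_box)
    moreover have "?G \<subseteq> Pow UNIV" by simp
    moreover have "A \<in> sigma_sets UNIV ?G" using that by (subst (asm) borel_eq_box) simp
    ultimately show ?thesis
    proof (induction rule: sigma_sets_induct_disjoint)
      case (basic A)
      then show ?case using box by (auto simp: ind)
    next
      case (compl A)
      have "A \<in> sets borel" using compl(1) by (subst borel_eq_box) simp
      then have "integrable M (\<lambda>x. indicator A x *\<^sub>R f x)"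
        using set_int[of "A \<inter> S"] f M_iff[of "A \<inter> S"] cl
        by (intro Bochner_Integration.integrable_bound[OF f])
          (auto simp: indicator_def intro!: borel_measurable_scaleR borel_imp_measurable)
      moreover have "indicator (UNIV - A) x *\<^sub>R f x = f x - indicator A x *\<^sub>R f x" for x
        by (simp add: indicator_def)
      ultimately show ?case
        using compl(2) f all by (simp add: ind)
    next
      case (union A)
      have A: "A i \<in> sets borel" for i using union(2) by (subst borel_eq_box) auto
      have "(LINT x:(\<Union>i. A i \<inter> S)|M. f x) = (\<Sum>i. LINT x:(A i \<inter> S)|M. f x)"
        using union(1) A cl
        by (intro lebesgue_integral_countable_add set_int)
          (auto simp: M_iff disjoint_family_on_def intro!: borel_closed)
      then show ?case using union(3) by simp
    qed (simp add: set_lebesgue_integral_def)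
  qed
  have zero': "(LINT x:A|M. f x) = 0" if "A \<in> sets M" for A
    using zero[of A] that M_iff[of A] by (simp add: Int_absorb2)
  have "AE x in M. Re (f x) = 0"
  proof (rule density_unique_real[where f' = "\<lambda>x. 0"])
    show "(LINT x:A|M. Re (f x)) = (LINT x:A|M. 0)" if "A \<in> sets M" for A
      using zero'[OF that] integral_Re[OF set_int[OF that, unfolded set_integrable_def]]
      by (simp add: set_lebesgue_integral_def)
  qed (use f in auto)
  moreover have "AE x in M. Im (f x) = 0"
  proof (rule density_unique_real[where f' = "\<lambda>x. 0"])
    show "(LINT x:A|M. Im (f x)) = (LINT x:A|M. 0)" if "A \<in> sets M" for A
      using zero'[OF that] integral_Im[OF set_int[OF that, unfolded set_integrable_def]]
      by (simp add: set_lebesgue_integral_def)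
  qed (use f in auto)
  ultimately show ?thesis by eventually_elim (simp add: complex_eq_iff)
qed

lemma L2_nth:
  fixes g :: "'a \<Rightarrow> complex^'n"
  assumes "L2 M g"
  shows "L2 M (\<lambda>x. g x $ i)" and "L2_norm_sq M (\<lambda>x. g x $ i) \<le> L2_norm_sq M g"
proof -
  have [measurable]: "g \<in> borel_measurable M" and int: "integrable M (\<lambda>x. (norm (g x))\<^sup>2)"
    using assms by (auto simp: L2_def)
  have "(\<lambda>x. g x $ i) \<in> borel_measurable M"
    by (rule measurable_compose[OF \<open>g \<in> borel_measurable M\<close>])
      (intro borel_measurable_continuous_onI continuous_intros)
  moreover have le: "(norm (g x $ i))\<^sup>2 \<le> (norm (g x))\<^sup>2" for x
    by (intro power_mono Finite_Cartesian_Product.norm_nth_le) auto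
  ultimately have int_i: "integrable M (\<lambda>x. (norm (g x $ i))\<^sup>2)"
    by (intro Bochner_Integration.integrable_bound[OF int]) auto
  then show "L2 M (\<lambda>x. g x $ i)" using \<open>(\<lambda>x. g x $ i) \<in> borel_measurable M\<close> by (simp add: L2_def)
  show "L2_norm_sq M (\<lambda>x. g x $ i) \<le> L2_norm_sq M g"
    unfolding L2_norm_sq_def by (intro integral_mono int_i int le)
qed

lemma cdot_cvec: "cdot a (cvec v) = (\<Sum>i\<in>UNIV. a $ i * complex_of_real (v $ i))"
  by (simp add: cdot_def cvec_def)

context smooth_domain
begin

lemma normal_extension:
  obtains W N where "open W" "frontier D \<subseteq> W" "smooth_on W N" "\<And>k. Ck_on k W N"
    "\<And>y. y \<in> frontier D \<Longrightarrow> N y = outward_normal D y" "\<And>y. y \<in> frontier D \<Longrightarrow> N y \<bullet> N y = 1"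
    "continuous_on (frontier D) N"
proof -
  obtain W N where W: "open W" "frontier D \<subseteq> W" "smooth_on W N"
    "\<And>y. y \<in> frontier D \<Longrightarrow> N y = outward_normal D y"
    using smooth_normal_extension[OF smooth_domain] by blast
  then have Ck: "Ck_on k W N" for k by (simp add: smooth_on_def)
  then have "continuous_on (frontier D) N"
    using Ck_on_imp_continuous_on W(2) continuous_on_subset by blast
  moreover have "N y \<bullet> N y = 1" if "y \<in> frontier D" for y
    using W(4)[OF that] norm_outward_normal[OF smooth_domain that] by (simp add: dot_square_norm)
  ultimately show ?thesis using that W Ck by blast
qed

lemma Ck_on_nth: "open W \<Longrightarrow> Ck_on k W N \<Longrightarrow> Ck_on k W (\<lambda>y. N y $ i)"
  using Ck_on_linear[OF _ bounded_linear_vec_nth] by blast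

text \<open>A scalar multiple of the tangential projection of a coordinate vector. The extension
  \<open>N\<close> replaces the normal because test fields must be smooth in a neighbourhood of the
  boundary.\<close>

lemma tangential_test_field:
  fixes i :: 3
  assumes N: "open W" "\<And>k. Ck_on k W N" "\<And>y. y \<in> frontier D \<Longrightarrow> N y = outward_normal D y"
      "\<And>y. y \<in> frontier D \<Longrightarrow> N y \<bullet> N y = 1"
    and \<phi>: "\<And>k. Ck_on k W \<phi>"
  defines "\<psi> \<equiv> \<lambda>y. \<phi> y *\<^sub>R (axis i 1 - N y $ i *\<^sub>R N y)"
  shows "smooth_on W \<psi>" "\<forall>y\<in>frontier D. \<psi> y \<bullet> outward_normal D y = 0"
proof -
  show "smooth_on W \<psi>"
    unfolding smooth_on_def \<psi>_def
    by (intro conjI allI N(1) Ck_on_scaleR \<phi> Ck_on_diff Ck_on_const Ck_on_nth N(2))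
  show "\<forall>y\<in>frontier D. \<psi> y \<bullet> outward_normal D y = 0"
    using N(3,4) by (auto simp: \<psi>_def inner_diff_left inner_axis' simp flip: N(3))
qed

text \<open>Removing the normal component of the coordinate vector does not change its product with
  a tangential \<open>g\<close>, so the test field isolates a single component.\<close>

lemma cdot_test_field:
  assumes "normal_part D g y = 0" "n = outward_normal D y"
  shows "cdot (g y) (cvec (c *\<^sub>R (axis i 1 - n $ i *\<^sub>R n))) = complex_of_real c * g y $ i"
proof -
  have "cdot (g y) (cvec (c *\<^sub>R (axis i 1 - n $ i *\<^sub>R n)))
      = complex_of_real c * (g y $ i - complex_of_real (n $ i) * cdot (g y) (cvec n))"
    using exhaust_3[of i] by (auto simp: cdot_cvec sum_3 axis_def algebra_simps)
  then show ?thesis using assms by (simp add: normal_part_def)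
qed

lemma bump_box_tendsto:
  "(\<lambda>k. \<Prod>j\<in>Basis. flat (real (Suc k) * (y \<bullet> j - a \<bullet> j)) * flat (real (Suc k) * (b \<bullet> j - y \<bullet> j)))
    \<longlonglongrightarrow> indicator (box a b) (y :: 'b::euclidean_space)"
proof -
  have "(\<lambda>k. \<Prod>j\<in>Basis. flat (real (Suc k) * (y \<bullet> j - a \<bullet> j)) * flat (real (Suc k) * (b \<bullet> j - y \<bullet> j)))
    \<longlonglongrightarrow> (\<Prod>j\<in>Basis. indicator {0<..} (y \<bullet> j - a \<bullet> j) * indicator {0<..} (b \<bullet> j - y \<bullet> j))"
    by (intro tendsto_prod tendsto_mult flat_mult_tendsto)
  also have "(\<Prod>j\<in>Basis. indicator {0<..} (y \<bullet> j - a \<bullet> j) * indicator {0<..} (b \<bullet> j - y \<bullet> j)) = (indicator (box a b) y :: real)"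
    by (auto simp: indicator_def mem_box prod_zero_iff intro!: prod.neutral)
  finally show ?thesis .
qed

text \<open>The H1 norm uses a weak gradient picked by \<open>SOME\<close>, so for the zero function
  every candidate must be controlled. Test fields with bump factors isolate one component of
  \<open>g\<close>, and letting the bumps tend to the indicator of a box gives vanishing box
  integrals.\<close>

lemma weak_surface_gradient_zero:
  assumes "weak_surface_gradient D (\<lambda>x. 0) g"
  shows "AE x in \<sigma>. g x = 0"
proof -
  obtain W N where W: "open W" "frontier D \<subseteq> W" and Ck: "\<And>k. Ck_on k W N"
    and N: "\<And>y. y \<in> frontier D \<Longrightarrow> N y = outward_normal D y" "\<And>y. y \<in> frontier D \<Longrightarrow> N y \<bullet> N y = 1"
    using normal_extension by metis
  have g: "L2 \<sigma> g" "AE x in \<sigma>. normal_part D g x = 0"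
    using assms by (simp_all add: weak_surface_gradient_def)
  have "AE x in \<sigma>. g x $ i = 0" for i
  proof (rule AE_zero_of_box_integrals)
    note L = L2_nth(1)[OF g(1), of i]
    show int: "integrable \<sigma> (\<lambda>x. g x $ i)" by (rule L2_imp_integrable(1)[OF L])
    have gm: "(\<lambda>x. g x $ i) \<in> borel_measurable \<sigma>" using int by simp
    fix a b :: "real^3"
    define bump where "bump k y = (\<Prod>j\<in>Basis. flat (real (Suc k) * (y \<bullet> j - a \<bullet> j)) * flat (real (Suc k) * (b \<bullet> j - y \<bullet> j)))"
      for k and y :: "real^3"
    have Ck_bump: "Ck_on m U (bump k)" if "open U" for m k U
      unfolding bump_def
      by (intro Ck_on_prod Ck_on_mult Ck_on_flat Ck_on_diff Ck_on_const Ck_on_inner Ck_on_id that)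
    have bump_m: "bump k \<in> borel_measurable \<sigma>" for k
      using Ck_on_imp_continuous_on[OF Ck_bump[OF open_UNIV]] by (intro borel_imp_measurable borel_measurable_continuous_onI) auto
    have bump01: "0 \<le> bump k y" "bump k y \<le> 1" for k y
      unfolding bump_def by (auto intro!: prod_nonneg prod_le_1 mult_nonneg_nonneg mult_le_one simp: flat_bounds)
    have "(\<integral>x. bump k x *\<^sub>R g x $ i \<partial>\<sigma>) = 0" for k
    proof -
      let ?\<psi> = "\<lambda>y. bump k y *\<^sub>R (axis i 1 - N y $ i *\<^sub>R N y)"
      have "smooth_on W ?\<psi>" "\<forall>y\<in>frontier D. ?\<psi> y \<bullet> outward_normal D y = 0"
        using tangential_test_field[OF W(1) Ck N Ck_bump[OF W(1)]] by blast+
      then have "(\<integral>x. cdot (g x) (cvec (?\<psi> x)) \<partial>\<sigma>) = 0"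
        using assms W(2) unfolding weak_surface_gradient_def by fastforce
      moreover have "(\<integral>x. cdot (g x) (cvec (?\<psi> x)) \<partial>\<sigma>) = (\<integral>x. bump k x *\<^sub>R g x $ i \<partial>\<sigma>)"
      proof (rule integral_cong_AE)
        show "AE x in \<sigma>. cdot (g x) (cvec (?\<psi> x)) = bump k x *\<^sub>R g x $ i"
          using g(2) AE_space
        proof eventually_elim
          case (elim x)
          then show ?case
            using cdot_test_field[of g x "N x" "bump k x" i] N(1)[of x] by (simp add: space scaleR_conv_of_real)
        qed
        have "continuous_on (frontier D) (\<lambda>x. ?\<psi> x $ j)" for j
          using Ck_on_imp_continuous_on[OF Ck] W(2) Ck_on_imp_continuous_on[OF Ck_bump[OF open_UNIV]]
          by (intro continuous_intros) (auto intro: continuous_on_subset)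
        then have "(\<lambda>x. complex_of_real (?\<psi> x $ j)) \<in> borel_measurable \<sigma>" for j
          by (intro continuous_imp_measurable continuous_on_of_real)
        moreover have "(\<lambda>x. g x $ j) \<in> borel_measurable \<sigma>" for j
          using L2_nth(1)[OF g(1)] by (simp add: L2_def)
        ultimately show "(\<lambda>x. cdot (g x) (cvec (?\<psi> x))) \<in> borel_measurable \<sigma>"
          unfolding cdot_cvec by (intro borel_measurable_sum borel_measurable_times)
        show "(\<lambda>x. bump k x *\<^sub>R g x $ i) \<in> borel_measurable \<sigma>"
          by (intro borel_measurable_scaleR bump_m gm)
      qed
      ultimately show ?thesis by simp
    qed
    moreover have "(\<lambda>k. \<integral>x. bump k x *\<^sub>R g x $ i \<partial>\<sigma>) \<longlonglongrightarrow> (\<integral>x. indicator (box a b) x *\<^sub>R g x $ i \<partial>\<sigma>)"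
    proof (rule integral_dominated_convergence[where w = "\<lambda>x. norm (g x $ i)"])
      show "AE x in \<sigma>. (\<lambda>k. bump k x *\<^sub>R g x $ i) \<longlonglongrightarrow> indicator (box a b) x *\<^sub>R g x $ i"
        unfolding bump_def by (intro AE_I2 tendsto_scaleR bump_box_tendsto tendsto_const)
      show "AE x in \<sigma>. norm (bump k x *\<^sub>R g x $ i) \<le> norm (g x $ i)" for k
        using bump01[of k] by (intro AE_I2) (simp add: mult_left_le_one_le)
      show "(\<lambda>x. indicator (box a b) x *\<^sub>R g x $ i) \<in> borel_measurable \<sigma>"
        by (intro borel_measurable_scaleR gm borel_imp_measurable borel_measurable_indicator) simp
      show "(\<lambda>x. bump k x *\<^sub>R g x $ i) \<in> borel_measurable \<sigma>" for k
        by (intro borel_measurable_scaleR bump_m gm)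
    qed (use int in simp)
    ultimately show "(\<integral>x. indicator (box a b) x *\<^sub>R g x $ i \<partial>\<sigma>) = 0"
      by (simp add: LIMSEQ_const_iff)
  qed
  then have "AE x in \<sigma>. \<forall>i. g x $ i = 0" by (intro AE_all_countable[THEN iffD2] allI)
  then show ?thesis by eventually_elim (simp add: vec_eq_iff)
qed

lemma H1_zero: "H1 D (\<lambda>x. 0)" "H1_norm_sq D (\<lambda>x. 0) = 0"
proof -
  have zero: "weak_surface_gradient D (\<lambda>x. 0) (\<lambda>x. 0)"
    by (simp add: weak_surface_gradient_def L2_def normal_part_def cdot_def)
  then show "H1 D (\<lambda>x. 0)" by (auto simp: H1_def L2_def)
  define g where "g = (SOME g. weak_surface_gradient D (\<lambda>x. 0) g)"
  have g: "weak_surface_gradient D (\<lambda>x. 0) g"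
    using someI[of "weak_surface_gradient D (\<lambda>x. 0)", OF zero] by (simp add: g_def)
  then have "L2 \<sigma> g" by (simp add: weak_surface_gradient_def)
  then have "(\<integral>x. (norm (g x))\<^sup>2 \<partial>\<sigma>) = (\<integral>x. 0 \<partial>\<sigma>)"
    using weak_surface_gradient_zero[OF g] by (intro integral_cong_AE) (auto simp: L2_def)
  then show "H1_norm_sq D (\<lambda>x. 0) = 0"
    by (simp add: H1_norm_sq_def L2_norm_sq_def g_def[symmetric])
qed

lemma H1_vec_zero: "H1_vec D (\<lambda>x. 0)" "H1_vec_norm_sq D (\<lambda>x. 0) = 0"
  by (simp_all add: H1_vec_def H1_vec_norm_sq_def H1_zero)

end

section \<open>Integration by parts\<close>

context smooth_domain
begin

text \<open>Differentiating the projection produces the term \<open>N' n $ i\<close> both in the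
  full trace and in the normal part, where it cancels. What remains of the derivative of
  \<open>N\<close> is its surface divergence times \<open>n $ i\<close>, a normal contribution that
  later drops out against tangential fields.\<close>

lemma surface_div_test_field:
  fixes N :: "real^3 \<Rightarrow> real^3" and \<phi> :: "real^3 \<Rightarrow> real"
  assumes N: "(N has_derivative N') (at x)" and \<phi>: "\<phi> differentiable (at x)"
    and n: "N x = outward_normal D x" "N x \<bullet> N x = 1"
  defines "n \<equiv> N x"
  shows "surface_div D (\<lambda>y. \<phi> y *\<^sub>R (axis i 1 - N y $ i *\<^sub>R N y)) x
    = grad \<phi> x $ i - n $ i * (grad \<phi> x \<bullet> n)
      - \<phi> x * n $ i * ((\<Sum>j\<in>UNIV. N' (axis j 1) $ j) - N' n \<bullet> n)"
proof -
  let ?L = "\<lambda>h. \<phi> x *\<^sub>R (0 - (N x $ i *\<^sub>R N' h + N' h $ i *\<^sub>R N x))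
    + (grad \<phi> x \<bullet> h) *\<^sub>R (axis i 1 - N x $ i *\<^sub>R N x)"
  have "((\<lambda>y. \<phi> y *\<^sub>R (axis i 1 - N y $ i *\<^sub>R N y)) has_derivative ?L) (at x)"
    by (intro has_derivative_scaleR has_derivative_grad[OF \<phi>] has_derivative_diff has_derivative_const
        bounded_linear.has_derivative[OF bounded_linear_vec_nth N] N)
  then have fd: "frechet_derivative (\<lambda>y. \<phi> y *\<^sub>R (axis i 1 - N y $ i *\<^sub>R N y)) (at x) = ?L"
    by (rule frechet_derivative_at[symmetric])
  have lin: "linear N'" using N by (rule has_derivative_linear)
  define tr where "tr = (\<Sum>j\<in>UNIV. N' (axis j 1) $ j)"
  have nn: "n \<bullet> n = 1" using n by (simp add: n_def)
  have "N' n = (\<Sum>j\<in>UNIV. n $ j *\<^sub>R N' (axis j 1))"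
    using basis_expansion[of n] by (simp add: scalar_mult_eq_scaleR linear_sum[OF lin, symmetric] linear_cmul[OF lin, symmetric])
  then have N'n: "N' n $ i = (\<Sum>j\<in>UNIV. n $ j * N' (axis j 1) $ i)" by simp
  have "(\<Sum>j\<in>UNIV. ?L (axis j 1) $ j)
      = - \<phi> x * (n $ i * tr + (\<Sum>j\<in>UNIV. n $ j * N' (axis j 1) $ i))
        + ((\<Sum>j\<in>UNIV. grad \<phi> x $ j * (axis i 1 $ j)) - n $ i * (\<Sum>j\<in>UNIV. grad \<phi> x $ j * n $ j))"
    unfolding tr_def n_def[symmetric] sum_3 by (simp add: inner_axis algebra_simps)
  also have "(\<Sum>j\<in>UNIV. grad \<phi> x $ j * (axis i 1 $ j)) = grad \<phi> x $ i"
    by (simp add: axis_def if_distrib cong: if_cong)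
  also have "(\<Sum>j\<in>UNIV. grad \<phi> x $ j * n $ j) = grad \<phi> x \<bullet> n"
    by (simp add: inner_vec_def)
  finally have 1: "(\<Sum>j\<in>UNIV. ?L (axis j 1) $ j)
      = - \<phi> x * (n $ i * tr + N' n $ i) + (grad \<phi> x $ i - n $ i * (grad \<phi> x \<bullet> n))"
    by (simp add: N'n)
  have "axis i 1 \<bullet> n = n $ i" by (simp add: inner_axis')
  then have 2: "?L n \<bullet> n = - \<phi> x * (n $ i * (N' n \<bullet> n) + N' n $ i)"
    using nn unfolding n_def[symmetric] by (simp add: inner_diff_left inner_add_left algebra_simps)
  show ?thesis
    unfolding surface_div_def fd n(1)[symmetric] n_def[symmetric] tr_def[symmetric]
    using 1 2 unfolding n_def[symmetric] by (simp add: algebra_simps)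
qed

lemma integrable_mult_continuous:
  fixes f :: "real^3 \<Rightarrow> complex"
  assumes f: "integrable \<sigma> f" and c: "continuous_on (frontier D) c"
  shows "integrable \<sigma> (\<lambda>x. f x * complex_of_real (c x))"
proof -
  obtain B where B: "\<And>x. x \<in> frontier D \<Longrightarrow> norm (c x) \<le> B"
    using compact_imp_bounded[OF compact_continuous_image[OF c compact]] by (auto simp: bounded_iff)
  show ?thesis
  proof (rule Bochner_Integration.integrable_bound)
    show "integrable \<sigma> (\<lambda>x. B * norm (f x))" using f by simp
    show "(\<lambda>x. f x * complex_of_real (c x)) \<in> borel_measurable \<sigma>"
      by (intro borel_measurable_times borel_measurable_integrable[OF f]
          continuous_imp_measurable[OF continuous_on_of_real[OF c]])
    show "AE x in \<sigma>. norm (f x * complex_of_real (c x)) \<le> norm (B * norm (f x))"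
    proof (intro AE_I2)
      fix x assume "x \<in> space \<sigma>"
      then have "norm (c x) \<le> B" using B space by simp
      then show "norm (f x * complex_of_real (c x)) \<le> norm (B * norm (f x))"
        by (simp add: norm_mult abs_mult mult.commute mult_right_mono)
    qed
  qed
qed

text \<open>Test the \<open>i\<close>-th component with \<open>\<phi>\<close> times the tangential projection of the \<open>i\<close>-th unit
  vector and sum over \<open>i\<close>; the curvature terms cancel since the field is tangential.\<close>

lemma surface_integration_by_parts:
  assumes w: "\<And>i. L2 \<sigma> (\<lambda>x. w x $ i)" and g: "\<And>i. weak_surface_gradient D (\<lambda>x. w x $ i) (g i)"
    and tang: "\<And>x. x \<in> frontier D \<Longrightarrow> normal_part D w x = 0"
    and \<phi>: "\<And>k. Ck_on k UNIV \<phi>"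
  shows "(\<integral>x. cdot (w x) (cvec (grad \<phi> x)) \<partial>\<sigma>) = - (\<integral>x. (\<Sum>i\<in>UNIV. g i x $ i) * complex_of_real (\<phi> x) \<partial>\<sigma>)"
proof -
  obtain W N where W: "open W" "frontier D \<subseteq> W" and Ck: "\<And>k. Ck_on k W N"
    and N: "\<And>y. y \<in> frontier D \<Longrightarrow> N y = outward_normal D y" "\<And>y. y \<in> frontier D \<Longrightarrow> N y \<bullet> N y = 1"
    and contN: "continuous_on (frontier D) N"
    using normal_extension by metis
  let ?N' = "\<lambda>x. frechet_derivative N (at x)"
  let ?\<psi> = "\<lambda>i y. \<phi> y *\<^sub>R (axis i 1 - N y $ i *\<^sub>R N y)"
  have N': "(N has_derivative ?N' x) (at x)" if "x \<in> frontier D" for x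
    using Ck_on_Suc_has_derivative[OF Ck[of "Suc 0"]] that W(2) by blast
  have d\<phi>: "\<phi> differentiable (at x)" for x
    using \<phi>[of "Suc 0"] by simp
  have cont\<phi>: "continuous_on A \<phi>" "continuous_on A (grad \<phi>)" for A
    using Ck_on_imp_continuous_on[OF \<phi>] Ck_on_imp_continuous_on[OF Ck_on_grad[OF open_UNIV \<phi>[of "Suc 0"]]]
    by (auto intro: continuous_on_subset)
  \<comment> \<open>The surface divergence of the normal, that is, twice the mean curvature up to
    sign. Its continuity gives the integrability needed to exchange sum and integral.\<close>
  define \<kappa> where "\<kappa> x = (\<Sum>j\<in>UNIV. ?N' x (axis j 1) $ j) - ?N' x (N x) \<bullet> N x" for x
  have div_eq: "surface_div D (?\<psi> i) x
      = grad \<phi> x $ i - N x $ i * (grad \<phi> x \<bullet> N x) - \<phi> x * N x $ i * \<kappa> x" if "x \<in> frontier D" for i x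
    using surface_div_test_field[OF N'[OF that] d\<phi> N(1)[OF that] N(2)[OF that]] by (simp add: \<kappa>_def)
  have contN': "continuous_on (frontier D) (\<lambda>x. ?N' x (axis j 1))" for j
    using Ck[of "Suc 0"] W(2) by (auto simp: axis_in_Basis_iff intro: continuous_on_subset)
  have "continuous_on (frontier D) (\<lambda>x. ?N' x (N x))"
  proof (rule continuous_on_eq)
    show "continuous_on (frontier D) (\<lambda>x. \<Sum>j\<in>UNIV. N x $ j *\<^sub>R ?N' x (axis j 1))"
      by (intro continuous_intros contN contN')
    show "(\<Sum>j\<in>UNIV. N x $ j *\<^sub>R ?N' x (axis j 1)) = ?N' x (N x)" if "x \<in> frontier D" for x
    proof -
      have lin: "linear (?N' x)" using N'[OF that] by (rule has_derivative_linear)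
      show ?thesis
        using basis_expansion[of "N x"]
        by (simp add: scalar_mult_eq_scaleR linear_sum[OF lin, symmetric] linear_cmul[OF lin, symmetric])
    qed
  qed
  then have "continuous_on (frontier D) \<kappa>"
    unfolding \<kappa>_def by (intro continuous_intros contN contN')
  then have "continuous_on (frontier D) (\<lambda>x. grad \<phi> x $ i - N x $ i * (grad \<phi> x \<bullet> N x) - \<phi> x * N x $ i * \<kappa> x)" for i
    by (intro continuous_intros contN cont\<phi>)
  then have cont_div: "continuous_on (frontier D) (surface_div D (?\<psi> i))" for i
    using div_eq by (simp cong: continuous_on_cong)
  have int_w: "integrable \<sigma> (\<lambda>x. w x $ i * complex_of_real (surface_div D (?\<psi> i) x))" for i
    by (intro integrable_mult_continuous L2_imp_integrable(1)[OF w] cont_div)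
  have g2: "L2 \<sigma> (g i)" "AE x in \<sigma>. normal_part D (g i) x = 0" for i
    using g[of i] by (simp_all add: weak_surface_gradient_def)
  have int_g: "integrable \<sigma> (\<lambda>x. g i x $ i * complex_of_real (\<phi> x))" for i
    by (intro integrable_mult_continuous L2_imp_integrable(1)[OF L2_nth(1)[OF g2(1)]] cont\<phi>)
  have test: "(\<integral>x. w x $ i * complex_of_real (surface_div D (?\<psi> i) x) \<partial>\<sigma>)
      = - (\<integral>x. g i x $ i * complex_of_real (\<phi> x) \<partial>\<sigma>)" for i
  proof -
    have "smooth_on W (?\<psi> i)" "\<forall>y\<in>frontier D. ?\<psi> i y \<bullet> outward_normal D y = 0"
      using tangential_test_field[OF W(1) Ck N Ck_on_subset[OF \<phi>]] by blast+
    then have "(\<integral>x. w x $ i * complex_of_real (surface_div D (?\<psi> i) x) \<partial>\<sigma>)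
        = - (\<integral>x. cdot (g i x) (cvec (?\<psi> i x)) \<partial>\<sigma>)"
      using g[of i] W(2) unfolding weak_surface_gradient_def by blast
    also have "(\<integral>x. cdot (g i x) (cvec (?\<psi> i x)) \<partial>\<sigma>) = (\<integral>x. g i x $ i * complex_of_real (\<phi> x) \<partial>\<sigma>)"
    proof (rule integral_cong_AE)
      show "AE x in \<sigma>. cdot (g i x) (cvec (?\<psi> i x)) = g i x $ i * complex_of_real (\<phi> x)"
        using g2(2)[of i] AE_space
      proof eventually_elim
        case (elim x)
        then show ?case
          using cdot_test_field[of "g i" x "N x" "\<phi> x" i] N(1)[of x] by (simp add: space mult.commute)
      qed
      have "continuous_on (frontier D) (\<lambda>x. ?\<psi> i x $ j)" for j
        by (intro continuous_intros contN cont\<phi>)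
      then have "integrable \<sigma> (\<lambda>x. g i x $ j * complex_of_real (?\<psi> i x $ j))" for j
        by (intro integrable_mult_continuous L2_imp_integrable(1)[OF L2_nth(1)[OF g2(1)]])
      then show "(\<lambda>x. cdot (g i x) (cvec (?\<psi> i x))) \<in> borel_measurable \<sigma>"
        unfolding cdot_cvec by (intro borel_measurable_sum) auto
    qed (use int_g in auto)
    finally show ?thesis .
  qed
  have "(\<integral>x. cdot (w x) (cvec (grad \<phi> x)) \<partial>\<sigma>)
      = (\<integral>x. (\<Sum>i\<in>UNIV. w x $ i * complex_of_real (surface_div D (?\<psi> i) x)) \<partial>\<sigma>)"
  proof (rule Bochner_Integration.integral_cong[OF refl])
    fix x assume "x \<in> space \<sigma>"
    then have x: "x \<in> frontier D" by (simp add: space)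
    have "(\<Sum>i\<in>UNIV. w x $ i * complex_of_real (surface_div D (?\<psi> i) x))
        = cdot (w x) (cvec (grad \<phi> x)) - complex_of_real (grad \<phi> x \<bullet> N x + \<phi> x * \<kappa> x) * cdot (w x) (cvec (N x))"
      unfolding div_eq[OF x] cdot_cvec by (simp add: sum_3 algebra_simps)
    moreover have "cdot (w x) (cvec (N x)) = 0"
      using tang[OF x] N(1)[OF x] by (simp add: normal_part_def)
    ultimately show "cdot (w x) (cvec (grad \<phi> x)) = (\<Sum>i\<in>UNIV. w x $ i * complex_of_real (surface_div D (?\<psi> i) x))"
      by simp
  qed
  also have "\<dots> = (\<Sum>i\<in>UNIV. - (\<integral>x. g i x $ i * complex_of_real (\<phi> x) \<partial>\<sigma>))"
    using int_w by (simp add: test)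
  also have "\<dots> = - (\<integral>x. (\<Sum>i\<in>UNIV. g i x $ i) * complex_of_real (\<phi> x) \<partial>\<sigma>)"
    using int_g by (simp add: sum_negf sum_distrib_right)
  finally show ?thesis .
qed

end

text \<open>Smoothed versions of \<open>max t 0\<close> and of its derivative. The latter vanish at \<open>t = 0\<close>, so that the
  gradients of the smoothed kernels also converge on the sphere \<open>dist x y = \<delta>\<close>, which may meet the
  surface in a set of positive measure.\<close>

definition smooth_max :: "nat \<Rightarrow> real \<Rightarrow> real" where
  "smooth_max k t = t * flat (real (Suc k) * t)"

definition smooth_step :: "nat \<Rightarrow> real \<Rightarrow> real" where
  "smooth_step k t = flat (real (Suc k) * t) + real (Suc k) * t * flat_pow 2 (real (Suc k) * t)"

lemma smooth_max_nonneg: "smooth_max k t \<ge> 0"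
  by (cases "t \<le> 0") (auto simp: smooth_max_def flat_bounds flat_def zero_less_mult_iff)

lemma smooth_max_deriv: "(smooth_max k has_real_derivative smooth_step k t) (at t)"
proof -
  have flat_eq: "flat = flat_pow 0" by (auto simp: flat_def flat_pow_def fun_eq_iff)
  have "((\<lambda>t. flat (real (Suc k) * t)) has_real_derivative flat_pow 2 (real (Suc k) * t) * real (Suc k)) (at t)"
    using has_derivative_flat_pow[of 0 "real (Suc k) * t"] unfolding flat_eq[symmetric]
    by (intro DERIV_chain2[where g = "\<lambda>t. real (Suc k) * t"]) (auto intro!: derivative_eq_intros simp: numeral_2_eq_2)
  then show ?thesis
    unfolding smooth_max_def smooth_step_def by (auto intro!: derivative_eq_intros)
qed

text \<open>With \<open>u\<close> the reciprocal of \<open>real (Suc k) * t\<close>, the derivative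
  is \<open>exp (- u) * (1 + u)\<close>. In this form the bound 1 is the inequality
  \<open>1 + u \<le> exp u\<close>, and the limit is that for \<open>u\<close> tending to 0.\<close>

lemma smooth_step_eq: "smooth_step k t = (if t > 0 then exp (- (inverse (real (Suc k)) * inverse t)) * (1 + inverse (real (Suc k)) * inverse t) else 0)"
proof (cases "t > 0")
  case True
  define v where "v = real (Suc k) * t"
  have "v > 0" using True by (simp add: v_def)
  then have "smooth_step k t = exp (- inverse v) * (1 + inverse v)"
    unfolding smooth_step_def v_def[symmetric] flat_def flat_pow_def
    by (simp add: power2_eq_square field_simps)
  then show ?thesis using True by (simp add: v_def inverse_mult_distrib mult.commute)
next
  case False
  then show ?thesis by (simp add: smooth_step_def flat_def flat_pow_def zero_less_mult_iff)
qed

lemma smooth_step_bounds: "0 \<le> smooth_step k t" "smooth_step k t \<le> 1"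
proof -
  have "exp (- u) * (1 + u) \<le> 1" for u :: real
    using exp_ge_add_one_self[of u] by (simp add: exp_minus field_simps)
  then show "smooth_step k t \<le> 1" by (auto simp: smooth_step_eq)
  show "0 \<le> smooth_step k t" by (auto simp: smooth_step_eq)
qed

lemma smooth_step_tendsto: "(\<lambda>k. smooth_step k t) \<longlonglongrightarrow> (if t > 0 then 1 else 0)"
proof -
  have "(\<lambda>k. inverse (real (Suc k)) * inverse t) \<longlonglongrightarrow> 0"
    using tendsto_mult_right[OF LIMSEQ_inverse_real_of_nat, of "inverse t"] by simp
  then have "(\<lambda>k. exp (- (inverse (real (Suc k)) * inverse t)) * (1 + inverse (real (Suc k)) * inverse t)) \<longlonglongrightarrow> exp (- 0) * (1 + 0)"
    by (intro tendsto_intros)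
  then show ?thesis unfolding smooth_step_eq by simp
qed

lemma smooth_max_tendsto: "(\<lambda>k. smooth_max k t) \<longlonglongrightarrow> max t 0"
proof -
  have "(\<lambda>k. t * flat (real (Suc k) * t)) \<longlonglongrightarrow> t * indicator {0<..} t"
    by (intro tendsto_mult tendsto_const flat_mult_tendsto)
  then show ?thesis by (auto simp: smooth_max_def max_def indicator_def)
qed

text \<open>A smooth substitute for \<open>1 / max \<delta> (dist x y)\<close>. The square of that
  maximum is \<open>\<delta>\<^sup>2\<close> plus the positive part of the squared distance minus
  \<open>\<delta>\<^sup>2\<close>; using squares avoids the singularity of the norm at
  \<open>y = x\<close>, and only the positive part has to be smoothed.\<close>

definition smooth_kernel :: "nat \<Rightarrow> real \<Rightarrow> real^3 \<Rightarrow> real^3 \<Rightarrow> real" where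
  "smooth_kernel k \<delta> x y = (\<delta>\<^sup>2 + smooth_max k ((y - x) \<bullet> (y - x) - \<delta>\<^sup>2)) powr (- 1 / 2)"

text \<open>Off the sphere of radius \<delta> about \<open>x\<close> this is the gradient of
  \<open>1 / max \<delta> (dist x y)\<close> in \<open>y\<close>; on the sphere it takes the value
  0, to which the smoothed gradients converge.\<close>

definition sharp_kernel :: "real \<Rightarrow> real^3 \<Rightarrow> real^3 \<Rightarrow> real^3" where
  "sharp_kernel \<delta> x y = (if \<delta> < dist x y then (1 / dist x y ^ 3) *\<^sub>R (x - y) else 0)"

lemma Ck_on_smooth_kernel:
  assumes "\<delta> > 0"
  shows "Ck_on m UNIV (smooth_kernel k \<delta> x)"
proof -
  have "\<delta>\<^sup>2 + smooth_max k t > 0" for t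
    using assms smooth_max_nonneg[of k t] by (simp add: add_pos_nonneg)
  then show ?thesis
    unfolding smooth_kernel_def smooth_max_def
    by (intro Ck_on_powr_compose Ck_on_add Ck_on_const Ck_on_mult Ck_on_flat Ck_on_diff Ck_on_inner Ck_on_id) auto
qed

lemma grad_smooth_kernel:
  fixes x :: "real^3"
  assumes "\<delta> > 0"
  defines "t \<equiv> \<lambda>y. (y - x) \<bullet> (y - x) - \<delta>\<^sup>2"
  shows "grad (smooth_kernel k \<delta> x) y = ((\<delta>\<^sup>2 + smooth_max k (t y)) powr (- 3 / 2) * smooth_step k (t y)) *\<^sub>R (x - y)"
proof (rule grad_unique)
  let ?P = "\<lambda>y. \<delta>\<^sup>2 + smooth_max k (t y)"
  have pos: "?P y > 0"
    using assms smooth_max_nonneg[of k "t y"] by (simp add: add_pos_nonneg)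
  have "(t has_derivative (\<lambda>h. 2 * ((y - x) \<bullet> h))) (at y)"
    unfolding t_def by (auto intro!: derivative_eq_intros simp: inner_commute)
  then have "((\<lambda>y. smooth_max k (t y)) has_derivative (\<lambda>h. 2 * ((y - x) \<bullet> h) * smooth_step k (t y))) (at y)"
    by (rule DERIV_compose_FDERIV[OF smooth_max_deriv])
  then have "(?P has_derivative (\<lambda>h. 2 * ((y - x) \<bullet> h) * smooth_step k (t y))) (at y)"
    using has_derivative_add[OF has_derivative_const[of "\<delta>\<^sup>2"]] by fastforce
  then have "((\<lambda>y. ?P y powr (- 1 / 2)) has_derivative
      (\<lambda>h. 2 * ((y - x) \<bullet> h) * smooth_step k (t y) * (- 1 / 2 * ?P y powr (- 1 / 2 - 1)))) (at y)"
    by (rule DERIV_compose_FDERIV[where f = "\<lambda>z. z powr (- 1 / 2)" and g = ?P, OF has_real_derivative_powr[OF pos]])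
  moreover have "2 * ((y - x) \<bullet> h) * smooth_step k (t y) * (- 1 / 2 * ?P y powr (- 1 / 2 - 1))
      = ((?P y powr (- 3 / 2) * smooth_step k (t y)) *\<^sub>R (x - y)) \<bullet> h" for h
    by (simp add: inner_diff_left algebra_simps)
  ultimately show "(smooth_kernel k \<delta> x has_derivative
      (\<lambda>h. ((?P y powr (- 3 / 2) * smooth_step k (t y)) *\<^sub>R (x - y)) \<bullet> h)) (at y)"
    by (simp add: smooth_kernel_def[abs_def] t_def)
qed

lemma max_square:
  assumes "\<delta> > 0"
  shows "\<delta>\<^sup>2 + max ((y - x) \<bullet> (y - x) - \<delta>\<^sup>2) 0 = (max \<delta> (dist x y))\<^sup>2"
proof -
  have "(y - x) \<bullet> (y - x) = (dist x y)\<^sup>2"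
    by (simp add: dot_square_norm dist_norm norm_minus_commute)
  moreover have "\<delta> \<le> dist x y \<longleftrightarrow> \<delta>\<^sup>2 \<le> (dist x y)\<^sup>2"
    using assms by (simp add: abs_le_square_iff[symmetric])
  ultimately show ?thesis by (auto simp: max_def)
qed

lemma smooth_kernel_tendsto:
  assumes \<delta>: "\<delta> > 0"
  shows "(\<lambda>k. smooth_kernel k \<delta> x y) \<longlonglongrightarrow> 1 / max \<delta> (dist x y)"
    and "(\<lambda>k. grad (smooth_kernel k \<delta> x) y) \<longlonglongrightarrow> sharp_kernel \<delta> x y"
proof -
  let ?t = "(y - x) \<bullet> (y - x) - \<delta>\<^sup>2" and ?m = "max \<delta> (dist x y)"
  have m: "?m > 0" using \<delta> by simp
  have P: "(\<lambda>k. \<delta>\<^sup>2 + smooth_max k ?t) \<longlonglongrightarrow> ?m\<^sup>2"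
    unfolding max_square[OF \<delta>, symmetric] by (intro tendsto_intros smooth_max_tendsto)
  have pow: "(?m\<^sup>2) powr (- 1 / 2) = 1 / ?m" "(?m\<^sup>2) powr (- 3 / 2) = 1 / ?m ^ 3"
  proof -
    have "?m\<^sup>2 = ?m powr 2" using m by simp
    then have "(?m\<^sup>2) powr a = ?m powr (2 * a)" for a by (simp only: powr_powr)
    then show "(?m\<^sup>2) powr (- 1 / 2) = 1 / ?m" "(?m\<^sup>2) powr (- 3 / 2) = 1 / ?m ^ 3"
      using m by (simp_all add: powr_minus_divide)
  qed
  show "(\<lambda>k. smooth_kernel k \<delta> x y) \<longlonglongrightarrow> 1 / ?m"
    unfolding smooth_kernel_def pow(1)[symmetric] using m by (intro tendsto_powr P tendsto_const) auto
  have "(\<lambda>k. ((\<delta>\<^sup>2 + smooth_max k ?t) powr (- 3 / 2) * smooth_step k ?t) *\<^sub>R (x - y))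
      \<longlonglongrightarrow> ((?m\<^sup>2) powr (- 3 / 2) * (if ?t > 0 then 1 else 0)) *\<^sub>R (x - y)"
    using m by (intro tendsto_scaleR tendsto_mult tendsto_powr P tendsto_const smooth_step_tendsto) auto
  moreover have "?t > 0 \<longleftrightarrow> \<delta> < dist x y"
  proof -
    have "(y - x) \<bullet> (y - x) = (dist x y)\<^sup>2"
      by (simp add: dot_square_norm dist_norm norm_minus_commute)
    moreover have "(dist x y)\<^sup>2 \<le> \<delta>\<^sup>2 \<longleftrightarrow> dist x y \<le> \<delta>" using \<delta> by (intro power_mono_iff) auto
    ultimately show ?thesis by auto
  qed
  ultimately show "(\<lambda>k. grad (smooth_kernel k \<delta> x) y) \<longlonglongrightarrow> sharp_kernel \<delta> x y"
    unfolding grad_smooth_kernel[OF \<delta>] pow(2) sharp_kernel_def by (auto simp: max_def split: if_splits)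
qed

text \<open>Bounds independent of \<open>k\<close>, which provide the dominating functions when
  \<open>k\<close> tends to infinity.\<close>

lemma smooth_kernel_bounds:
  assumes \<delta>: "\<delta> > 0"
  shows "\<bar>smooth_kernel k \<delta> x y\<bar> \<le> \<delta>\<^sup>2 powr (- 1 / 2)"
    and "norm (grad (smooth_kernel k \<delta> x) y) \<le> \<delta>\<^sup>2 powr (- 3 / 2) * dist x y"
proof -
  have mono: "(\<delta>\<^sup>2 + smooth_max k t) powr a \<le> \<delta>\<^sup>2 powr a" if "a \<le> 0" for t a
    using \<delta> smooth_max_nonneg[of k t] that by (intro powr_mono2') auto
  show "\<bar>smooth_kernel k \<delta> x y\<bar> \<le> \<delta>\<^sup>2 powr (- 1 / 2)"
    unfolding smooth_kernel_def using mono[of "- 1 / 2"] by simp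
  let ?t = "(y - x) \<bullet> (y - x) - \<delta>\<^sup>2"
  have "\<bar>(\<delta>\<^sup>2 + smooth_max k ?t) powr (- 3 / 2) * smooth_step k ?t\<bar> \<le> \<delta>\<^sup>2 powr (- 3 / 2) * 1"
    unfolding abs_mult using smooth_step_bounds[of k ?t] mono[of "- 3 / 2" ?t] by (intro mult_mono) auto
  then show "norm (grad (smooth_kernel k \<delta> x) y) \<le> \<delta>\<^sup>2 powr (- 3 / 2) * dist x y"
    unfolding grad_smooth_kernel[OF \<delta>] norm_scaleR dist_norm by (intro mult_right_mono) auto
qed

context smooth_domain
begin

lemma norm_cdot_cvec_le: "norm (cdot a (cvec v)) \<le> (\<Sum>i\<in>UNIV. norm (a $ i)) * norm v"
proof -
  have "norm (cdot a (cvec v)) \<le> (\<Sum>i\<in>UNIV. norm (a $ i * complex_of_real (v $ i)))"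
    unfolding cdot_cvec by (rule norm_sum)
  also have "\<dots> \<le> (\<Sum>i\<in>UNIV. norm (a $ i) * norm v)"
    using component_le_norm_cart[of v] by (intro sum_mono) (simp add: norm_mult mult_left_mono)
  finally show ?thesis by (simp add: sum_distrib_right)
qed

lemma sharp_kernel_integrable:
  assumes w: "\<And>i. integrable \<sigma> (\<lambda>x. w x $ i)" and \<delta>: "\<delta> > 0"
  shows "integrable \<sigma> (\<lambda>y. cdot (w y) (cvec (sharp_kernel \<delta> x y)))"
proof (rule Bochner_Integration.integrable_bound)
  show "integrable \<sigma> (\<lambda>y. (1 / \<delta>\<^sup>2) * (\<Sum>i\<in>UNIV. norm (w y $ i)))"
    using w by auto
  \<comment> \<open>Measurability comes for free: the discontinuous kernel is a pointwise limit of
    continuous gradients.\<close>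
  have [measurable]: "(\<lambda>y. sharp_kernel \<delta> x y $ i) \<in> borel_measurable borel" for i
  proof (rule borel_measurable_LIMSEQ_metric)
    have "continuous_on UNIV (grad (smooth_kernel k \<delta> x))" for k
      by (rule Ck_on_imp_continuous_on[OF Ck_on_grad[OF open_UNIV Ck_on_smooth_kernel[OF \<delta>, of "Suc 0"]]])
    then show "(\<lambda>y. grad (smooth_kernel k \<delta> x) y $ i) \<in> borel_measurable borel" for k
      by (intro borel_measurable_continuous_onI continuous_on_component)
    show "(\<lambda>k. grad (smooth_kernel k \<delta> x) y $ i) \<longlonglongrightarrow> sharp_kernel \<delta> x y $ i" for y
      by (intro tendsto_vec_nth smooth_kernel_tendsto[OF \<delta>])
  qed
  have "(\<lambda>y. complex_of_real (sharp_kernel \<delta> x y $ i)) \<in> borel_measurable borel" for i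
    by measurable
  then show "(\<lambda>y. cdot (w y) (cvec (sharp_kernel \<delta> x y))) \<in> borel_measurable \<sigma>"
    unfolding cdot_cvec
    by (intro borel_measurable_sum borel_measurable_times borel_measurable_integrable[OF w] borel_imp_measurable)
  show "AE y in \<sigma>. norm (cdot (w y) (cvec (sharp_kernel \<delta> x y))) \<le> norm ((1 / \<delta>\<^sup>2) * (\<Sum>i\<in>UNIV. norm (w y $ i)))"
  proof (intro AE_I2)
    fix y
    have "norm (sharp_kernel \<delta> x y) \<le> 1 / \<delta>\<^sup>2"
    proof (cases "\<delta> < dist x y")
      case True
      then have d: "dist x y > 0" using \<delta> by linarith
      have "norm (sharp_kernel \<delta> x y) = 1 / (dist x y)\<^sup>2"
        using True d by (simp add: sharp_kernel_def dist_norm[symmetric] power2_eq_square power3_eq_cube)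
      also have "\<dots> \<le> 1 / \<delta>\<^sup>2"
        using True d \<delta> by (intro divide_left_mono power_mono mult_pos_pos) auto
      finally show ?thesis .
    qed (simp add: sharp_kernel_def)
    then have "(\<Sum>i\<in>UNIV. norm (w y $ i)) * norm (sharp_kernel \<delta> x y) \<le> (\<Sum>i\<in>UNIV. norm (w y $ i)) * (1 / \<delta>\<^sup>2)"
      by (intro mult_left_mono sum_nonneg) auto
    then have "norm (cdot (w y) (cvec (sharp_kernel \<delta> x y))) \<le> (\<Sum>i\<in>UNIV. norm (w y $ i)) * (1 / \<delta>\<^sup>2)"
      by (rule order_trans[OF norm_cdot_cvec_le])
    then show "norm (cdot (w y) (cvec (sharp_kernel \<delta> x y))) \<le> norm ((1 / \<delta>\<^sup>2) * (\<Sum>i\<in>UNIV. norm (w y $ i)))"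
      by (simp add: sum_nonneg abs_of_nonneg)
  qed
qed

text \<open>Integration by parts is available for the smooth kernels, which are defined on all of
  space. Dominated convergence on both sides then passes to the sharp cut-off and the truncated
  potential.\<close>

lemma sharp_kernel_by_parts:
  assumes w: "\<And>i. L2 \<sigma> (\<lambda>x. w x $ i)" and g: "\<And>i. weak_surface_gradient D (\<lambda>x. w x $ i) (g i)"
    and tang: "\<And>x. x \<in> frontier D \<Longrightarrow> normal_part D w x = 0" and \<delta>: "\<delta> > 0"
  shows "(\<integral>y. cdot (w y) (cvec (sharp_kernel \<delta> x y)) \<partial>\<sigma>) = - truncated \<delta> (\<lambda>y. \<Sum>i\<in>UNIV. g i y $ i) x"
proof -
  let ?q = "\<lambda>y. \<Sum>i\<in>UNIV. g i y $ i"
  have int_w: "integrable \<sigma> (\<lambda>x. w x $ i)" for i by (rule L2_imp_integrable(1)[OF w])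
  have "integrable \<sigma> (\<lambda>y. g i y $ i)" for i
    using g[of i] by (intro L2_imp_integrable(1) L2_nth(1)) (simp add: weak_surface_gradient_def)
  then have int_q: "integrable \<sigma> ?q" by simp
  have Ck: "Ck_on m UNIV (smooth_kernel k \<delta> x)" for m k by (rule Ck_on_smooth_kernel[OF \<delta>])
  have contk: "continuous_on A (smooth_kernel k \<delta> x)" "continuous_on A (grad (smooth_kernel k \<delta> x))" for A k
    using Ck_on_imp_continuous_on[OF Ck] Ck_on_imp_continuous_on[OF Ck_on_grad[OF open_UNIV Ck[of "Suc 0"]]]
    by (auto intro: continuous_on_subset)
  obtain R where R: "\<And>y. y \<in> frontier D \<Longrightarrow> dist x y \<le> R"
    using compact_imp_bounded[OF compact] bounded_any_center[of "frontier D" x] by blast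
  have parts: "(\<integral>y. cdot (w y) (cvec (grad (smooth_kernel k \<delta> x) y)) \<partial>\<sigma>)
      = - (\<integral>y. ?q y * complex_of_real (smooth_kernel k \<delta> x y) \<partial>\<sigma>)" for k
    by (rule surface_integration_by_parts[OF w g tang Ck])
  have lim: "(\<lambda>k. \<integral>y. cdot (w y) (cvec (grad (smooth_kernel k \<delta> x) y)) \<partial>\<sigma>) \<longlonglongrightarrow> (\<integral>y. cdot (w y) (cvec (sharp_kernel \<delta> x y)) \<partial>\<sigma>)"
  proof (rule integral_dominated_convergence[where w = "\<lambda>y. (\<Sum>i\<in>UNIV. norm (w y $ i)) * (\<delta>\<^sup>2 powr (- 3 / 2) * R)"])
    show "(\<lambda>y. cdot (w y) (cvec (sharp_kernel \<delta> x y))) \<in> borel_measurable \<sigma>"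
      using sharp_kernel_integrable[OF int_w \<delta>] by simp
    show "(\<lambda>y. cdot (w y) (cvec (grad (smooth_kernel k \<delta> x) y))) \<in> borel_measurable \<sigma>" for k
      unfolding cdot_cvec
      by (intro borel_measurable_sum borel_measurable_times borel_measurable_integrable[OF int_w]
          continuous_imp_measurable[OF continuous_on_of_real] continuous_on_component contk)
    show "integrable \<sigma> (\<lambda>y. (\<Sum>i\<in>UNIV. norm (w y $ i)) * (\<delta>\<^sup>2 powr (- 3 / 2) * R))"
      using int_w by auto
    show "AE y in \<sigma>. (\<lambda>k. cdot (w y) (cvec (grad (smooth_kernel k \<delta> x) y))) \<longlonglongrightarrow> cdot (w y) (cvec (sharp_kernel \<delta> x y))"
      unfolding cdot_cvec by (intro AE_I2 tendsto_intros smooth_kernel_tendsto[OF \<delta>])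
    show "AE y in \<sigma>. norm (cdot (w y) (cvec (grad (smooth_kernel k \<delta> x) y))) \<le> (\<Sum>i\<in>UNIV. norm (w y $ i)) * (\<delta>\<^sup>2 powr (- 3 / 2) * R)" for k
    proof (rule AE_I2)
      fix y assume "y \<in> space \<sigma>"
      then have "norm (grad (smooth_kernel k \<delta> x) y) \<le> \<delta>\<^sup>2 powr (- 3 / 2) * R"
        using R[of y] by (intro order_trans[OF smooth_kernel_bounds(2)[OF \<delta>]] mult_left_mono) (auto simp: space)
      then show "norm (cdot (w y) (cvec (grad (smooth_kernel k \<delta> x) y))) \<le> (\<Sum>i\<in>UNIV. norm (w y $ i)) * (\<delta>\<^sup>2 powr (- 3 / 2) * R)"
        by (intro order_trans[OF norm_cdot_cvec_le] mult_left_mono sum_nonneg) auto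
    qed
  qed
  have lim': "(\<lambda>k. - (\<integral>y. ?q y * complex_of_real (smooth_kernel k \<delta> x y) \<partial>\<sigma>)) \<longlonglongrightarrow> - truncated \<delta> ?q x"
    unfolding truncated_def
  proof (intro tendsto_minus integral_dominated_convergence[where w = "\<lambda>y. norm (?q y) * \<delta>\<^sup>2 powr (- 1 / 2)"])
    show "(\<lambda>y. ?q y / complex_of_real (max \<delta> (dist x y))) \<in> borel_measurable \<sigma>"
      using integrable_truncated[OF int_q \<delta>] by (rule borel_measurable_integrable)
    show "(\<lambda>y. ?q y * complex_of_real (smooth_kernel k \<delta> x y)) \<in> borel_measurable \<sigma>" for k
      by (intro borel_measurable_times borel_measurable_integrable[OF int_q]
          continuous_imp_measurable[OF continuous_on_of_real] contk)
    show "integrable \<sigma> (\<lambda>y. norm (?q y) * \<delta>\<^sup>2 powr (- 1 / 2))" using int_q by auto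
    show "AE y in \<sigma>. (\<lambda>k. ?q y * complex_of_real (smooth_kernel k \<delta> x y)) \<longlonglongrightarrow> ?q y / complex_of_real (max \<delta> (dist x y))"
    proof (rule AE_I2)
      fix y
      have "(\<lambda>k. ?q y * complex_of_real (smooth_kernel k \<delta> x y)) \<longlonglongrightarrow> ?q y * complex_of_real (1 / max \<delta> (dist x y))"
        by (intro tendsto_intros smooth_kernel_tendsto[OF \<delta>])
      then show "(\<lambda>k. ?q y * complex_of_real (smooth_kernel k \<delta> x y)) \<longlonglongrightarrow> ?q y / complex_of_real (max \<delta> (dist x y))"
        by simp
    qed
    show "AE y in \<sigma>. norm (?q y * complex_of_real (smooth_kernel k \<delta> x y)) \<le> norm (?q y) * \<delta>\<^sup>2 powr (- 1 / 2)" for k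
      unfolding norm_mult norm_of_real by (intro AE_I2 mult_left_mono smooth_kernel_bounds \<delta>) auto
  qed
  show ?thesis
    by (rule LIMSEQ_unique[OF lim[unfolded parts] lim'])
qed

end

section \<open>The operator \<open>J\<close>\<close>

lemma L2_cong:
  assumes "\<And>x. x \<in> space M \<Longrightarrow> f x = g x"
  shows "L2 M f \<longleftrightarrow> L2 M g" and "L2_norm_sq M f = L2_norm_sq M g"
proof -
  have "f \<in> borel_measurable M \<longleftrightarrow> g \<in> borel_measurable M"
    using assms by (rule measurable_cong)
  moreover have "integrable M (\<lambda>x. (norm (f x))\<^sup>2) \<longleftrightarrow> integrable M (\<lambda>x. (norm (g x))\<^sup>2)"
    using assms by (intro Bochner_Integration.integrable_cong) auto
  ultimately show "L2 M f \<longleftrightarrow> L2 M g" by (simp add: L2_def)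
  show "L2_norm_sq M f = L2_norm_sq M g"
    unfolding L2_norm_sq_def using assms by (intro Bochner_Integration.integral_cong) auto
qed

lemma grad_inverse_norm:
  assumes "x \<noteq> y"
  shows "grad (\<lambda>z. 1 / norm (z - y)) x = - ((1 / dist x y ^ 3) *\<^sub>R (x - y))"
proof (rule grad_unique)
  have ne: "norm (x - y) > 0" using assms by simp
  have "((\<lambda>z. z - y) has_derivative (\<lambda>h. h)) (at x)"
    by (auto intro!: derivative_eq_intros)
  then have "((\<lambda>z. norm (z - y)) has_derivative (\<lambda>h. h \<bullet> sgn (x - y))) (at x)"
    using has_derivative_compose[of "\<lambda>z. z - y" "\<lambda>h. h" x UNIV norm "\<lambda>h. h \<bullet> sgn (x - y)"]
      has_derivative_norm[of "x - y"] assms by simp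
  then have "((\<lambda>z. inverse (norm (z - y))) has_derivative (\<lambda>h. (h \<bullet> sgn (x - y)) * - (inverse (norm (x - y)) ^ Suc (Suc 0)))) (at x)"
    using ne by (intro DERIV_compose_FDERIV[where f = inverse and g = "\<lambda>z. norm (z - y)", OF DERIV_inverse]) auto
  moreover have "(h \<bullet> sgn (x - y)) * - (inverse (norm (x - y)) ^ Suc (Suc 0))
      = - ((1 / dist x y ^ 3) *\<^sub>R (x - y)) \<bullet> h" for h
    by (simp add: sgn_div_norm dist_norm power3_eq_cube inner_commute divide_inverse mult_ac)
  ultimately show "((\<lambda>z. 1 / norm (z - y)) has_derivative (\<lambda>h. - ((1 / dist x y ^ 3) *\<^sub>R (x - y)) \<bullet> h)) (at x)"
    by (simp add: inverse_eq_divide)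
qed

text \<open>Cyclic symmetry of the triple product moves the normal from the kernel to the field. The
  sign in front of \<open>k\<close> accounts for the opposite gradients of
  \<open>1 / dist x y\<close> in its two arguments.\<close>

lemma cdot_cross3:
  "cdot (cvec (cross3 (- k) n)) a = cdot (ccross a (cvec n)) (cvec k)"
  by (simp add: cdot_def cvec_def ccross_def cross3_def sum_3 vector_3 algebra_simps)

lemma ccross_self: "ccross (c *s a) a = 0"
  by (simp add: ccross_def vec_eq_iff forall_3 algebra_simps)

lemma cdot_ccross_self: "cdot (ccross a b) b = 0"
  by (simp add: cdot_def ccross_def sum_3 algebra_simps)

lemma normal_part_cross_normal: "normal_part D (cross_normal D h) x = 0"
  by (simp add: normal_part_def cross_normal_def cdot_ccross_self)

lemma cdot_D_kernel:
  assumes "\<delta> > 0" "\<delta> < dist x y"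
  shows "cdot (cvec (D_kernel D x y)) (h y) = cdot (cross_normal D h y) (cvec (sharp_kernel \<delta> x y))"
proof -
  have "x \<noteq> y" using assms by auto
  then have "cdot (cvec (D_kernel D x y)) (h y)
      = cdot (cross_normal D h y) (cvec ((1 / dist x y ^ 3) *\<^sub>R (x - y)))"
    unfolding D_kernel_def cross_normal_def by (simp only: grad_inverse_norm cdot_cross3 not_False_eq_True)
  then show ?thesis using assms(2) by (simp add: sharp_kernel_def)
qed

text \<open>The weak surface divergence of a tangential field. It is built from the same choice of
  gradients as \<open>H1_norm_sq\<close>, so its square norm is controlled by the H1 norm as
  defined.\<close>

definition boundary_div :: "(real^3) set \<Rightarrow> (real^3 \<Rightarrow> complex^3) \<Rightarrow> real^3 \<Rightarrow> complex" where
  "boundary_div D w y = (\<Sum>i\<in>UNIV. (SOME g. weak_surface_gradient D (\<lambda>x. w x $ i) g) y $ i)"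

lemma weak_surface_gradient_L2: "weak_surface_gradient D u g \<Longrightarrow> L2 (bdry_measure D) g"
  by (simp add: weak_surface_gradient_def)

lemma H1_norm_sq_nonneg: "H1_norm_sq D u \<ge> 0"
  by (simp add: H1_norm_sq_def L2_norm_sq_nonneg)

context smooth_domain
begin

lemma H1_vecD:
  assumes "H1_vec D w"
  shows "L2 \<sigma> (\<lambda>x. w x $ i)"
    "weak_surface_gradient D (\<lambda>x. w x $ i) (SOME g. weak_surface_gradient D (\<lambda>x. w x $ i) g)"
proof -
  have "L2 \<sigma> (\<lambda>x. w x $ i)" "\<exists>g. weak_surface_gradient D (\<lambda>x. w x $ i) g"
    using assms by (simp_all add: H1_vec_def H1_def)
  then show "L2 \<sigma> (\<lambda>x. w x $ i)"
    "weak_surface_gradient D (\<lambda>x. w x $ i) (SOME g. weak_surface_gradient D (\<lambda>x. w x $ i) g)"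
    by (simp_all add: someI_ex)
qed

lemma boundary_div_L2:
  assumes "H1_vec D w"
  shows "L2 \<sigma> (boundary_div D w)" "L2_norm_sq \<sigma> (boundary_div D w) \<le> 4 * H1_vec_norm_sq D w"
proof -
  let ?g = "\<lambda>i. SOME g. weak_surface_gradient D (\<lambda>x. w x $ i) g"
  have g: "L2 \<sigma> (?g i)" for i
    by (rule weak_surface_gradient_L2[OF H1_vecD(2)[OF assms]])
  note gi = L2_nth[OF g]
  have le: "L2_norm_sq \<sigma> (\<lambda>x. ?g i x $ i) \<le> H1_norm_sq D (\<lambda>x. w x $ i)" for i
    using gi(2)[of i i] by (simp add: H1_norm_sq_def L2_norm_sq_nonneg add_increasing)
  have eq: "boundary_div D w = (\<lambda>x. (?g 1 x $ 1 + ?g 2 x $ 2) + ?g 3 x $ 3)"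
    by (simp add: boundary_div_def fun_eq_iff sum_3)
  \<comment> \<open>Adding three terms in two steps applies the factor 2 twice, whence the constant
    4.\<close>
  note s1 = L2_add[OF gi(1)[of 1 1] gi(1)[of 2 2]]
  note s2 = L2_add[OF s1(1) gi(1)[of 3 3]]
  show "L2 \<sigma> (boundary_div D w)" unfolding eq by (rule s2(1))
  show "L2_norm_sq \<sigma> (boundary_div D w) \<le> 4 * H1_vec_norm_sq D w"
    unfolding eq using s1(2) s2(2) le[of 1] le[of 2] le[of 3] H1_norm_sq_nonneg[of D "\<lambda>x. w x $ 3"]
    by (simp add: H1_vec_norm_sq_def sum_3)
qed

text \<open>The cut-off is strict on both sides, so this is an identity at every point, on the
  sphere \<open>dist x y = \<delta>\<close> as well.\<close>

lemma D_truncated_integrand: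
  assumes "\<delta> > 0"
  shows "indicator {y. \<delta> < dist x y} y *\<^sub>R cdot (cvec (D_kernel D x y)) (h y)
    = cdot (cross_normal D h y) (cvec (sharp_kernel \<delta> x y))"
  using cdot_D_kernel[OF assms, of x y D h]
  by (auto simp: indicator_def sharp_kernel_def cdot_cvec)

lemma D_truncated_integrable:
  assumes "H1_vec D (cross_normal D h)" "\<delta> > 0"
  shows "set_integrable \<sigma> {y. \<delta> < dist x y} (\<lambda>y. cdot (cvec (D_kernel D x y)) (h y))"
  unfolding set_integrable_def D_truncated_integrand[OF assms(2)]
  by (intro sharp_kernel_integrable L2_imp_integrable(1) H1_vecD(1) assms)

lemma D_truncated_eq:
  assumes "H1_vec D (cross_normal D h)" "\<delta> > 0"
  shows "D_truncated D h x \<delta> = - (1 / (4 * complex_of_real pi) * truncated \<delta> (boundary_div D (cross_normal D h)) x)"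
  unfolding D_truncated_def set_lebesgue_integral_def D_truncated_integrand[OF assms(2)]
    boundary_div_def[abs_def]
  by (subst sharp_kernel_by_parts[OF H1_vecD[OF assms(1)] normal_part_cross_normal assms(2)]) simp

text \<open>The truncated integrals are multiples of truncated potentials at every \<open>x\<close>;
  the exceptional null set comes only from points where the potential of the divergence does not
  converge absolutely.\<close>

lemma D_truncated_tendsto:
  assumes h: "H1_vec D (cross_normal D h)"
  shows "AE x in \<sigma>. (D_truncated D h x \<longlongrightarrow>
    - (1 / (4 * complex_of_real pi) * potential (boundary_div D (cross_normal D h)) x)) (at_right 0)"
proof -
  let ?q = "boundary_div D (cross_normal D h)"
  have q: "L2 \<sigma> ?q" by (rule boundary_div_L2(1)[OF h])
  then have qm: "?q \<in> borel_measurable \<sigma>" by (simp add: L2_def)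
  show ?thesis
    using AE_potential_integrable[OF q]
  proof eventually_elim
    case (elim x)
    have "((\<lambda>\<delta>. - (1 / (4 * complex_of_real pi) * truncated \<delta> ?q x)) \<longlongrightarrow>
        - (1 / (4 * complex_of_real pi) * potential ?q x)) (at_right 0)"
      by (intro tendsto_minus tendsto_mult tendsto_const truncated_tendsto_potential elim qm)
    then show ?case
      by (rule Lim_transform_eventually)
        (use D_truncated_eq[OF h] in \<open>auto simp: eventually_at_right[of 0 1] intro: exI[of _ 1]\<close>)
  qed
qed

lemma D_op_AE:
  assumes "H1_vec D (cross_normal D h)"
  shows "AE x in \<sigma>. D_op D h x = - (1 / (4 * complex_of_real pi) * potential (boundary_div D (cross_normal D h)) x)"
  using D_truncated_tendsto[OF assms]
  by eventually_elim (auto simp: D_op_def intro: tendsto_Lim)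

text \<open>The formula valid almost everywhere says nothing about the values of \<open>Lim\<close>
  on the exceptional null set. Measurability is instead obtained from the truncations, which are
  continuous in \<open>x\<close> because they are multiples of truncated potentials.\<close>

lemma D_op_measurable:
  assumes h: "H1_vec D (cross_normal D h)"
  shows "D_op D h \<in> borel_measurable \<sigma>"
  unfolding D_op_def
proof (rule measurable_Lim_at_right)
  fix \<delta> :: real assume \<delta>: "\<delta> > 0"
  have "integrable \<sigma> (boundary_div D (cross_normal D h))"
    by (intro L2_imp_integrable(1) boundary_div_L2(1) h)
  then show "continuous_on (frontier D) (\<lambda>x. D_truncated D h x \<delta>)"
    unfolding D_truncated_eq[OF h \<delta>] by (intro continuous_intros truncated_continuous \<delta>)
qed

lemma S_op_eq: "S_op D f x = 1 / (4 * complex_of_real pi) * potential f x"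
  by (simp add: S_op_def potential_def dist_norm)

lemma J_defined_AE:
  assumes "(e, h) \<in> X_space D"
  shows "AE x in \<sigma>. J_defined_at D (e, h) x"
proof -
  have X: "H1_vec D (cross_normal D e)" "H1_vec D (cross_normal D h)"
    "L2 \<sigma> (normal_part D e)" "L2 \<sigma> (normal_part D h)"
    using assms by (auto simp: X_space_def)
  show ?thesis
    using D_truncated_tendsto[OF X(1)] D_truncated_tendsto[OF X(2)]
      AE_potential_integrable[OF X(3)] AE_potential_integrable[OF X(4)]
  proof eventually_elim
    case (elim x)
    then show ?case
      using D_truncated_integrable X(1,2) by (auto simp: J_defined_at_def dist_norm)
  qed
qed

section \<open>The components of \<open>J\<close> as single layer potentials\<close>

definition J_part :: "complex \<Rightarrow> complex \<Rightarrow> (real^3 \<Rightarrow> complex^3) \<Rightarrow> (real^3 \<Rightarrow> complex^3) \<Rightarrow> real^3 \<Rightarrow> complex" where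
  "J_part a b e h x = a * S_op D (normal_part D e) x + b * D_op D h x"

text \<open>The density that turns a whole component of \<open>J\<close> into one single layer
  potential; the minus sign is the one from integration by parts.\<close>

definition J_source :: "complex \<Rightarrow> complex \<Rightarrow> (real^3 \<Rightarrow> complex^3) \<Rightarrow> (real^3 \<Rightarrow> complex^3) \<Rightarrow> real^3 \<Rightarrow> complex" where
  "J_source a b e h y = a * normal_part D e y - b * boundary_div D (cross_normal D h) y"

lemma J_source_L2:
  assumes e: "L2 \<sigma> (normal_part D e)" and h: "H1_vec D (cross_normal D h)"
  shows "L2 \<sigma> (J_source a b e h)"
    and "L2_norm_sq \<sigma> (J_source a b e h) \<le> 2 * (norm a)\<^sup>2 * L2_norm_sq \<sigma> (normal_part D e)
      + 8 * (norm b)\<^sup>2 * H1_vec_norm_sq D (cross_normal D h)"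
proof -
  note d = L2_diff[OF L2_cmult(1)[OF e, of a] L2_cmult(1)[OF boundary_div_L2(1)[OF h], of b]]
  show "L2 \<sigma> (J_source a b e h)" unfolding J_source_def[abs_def] by (rule d(1))
  have "(norm b)\<^sup>2 * L2_norm_sq \<sigma> (boundary_div D (cross_normal D h)) \<le> (norm b)\<^sup>2 * (4 * H1_vec_norm_sq D (cross_normal D h))"
    by (intro mult_left_mono boundary_div_L2(2)[OF h]) simp
  then show "L2_norm_sq \<sigma> (J_source a b e h) \<le> 2 * (norm a)\<^sup>2 * L2_norm_sq \<sigma> (normal_part D e)
      + 8 * (norm b)\<^sup>2 * H1_vec_norm_sq D (cross_normal D h)"
    using d(2) unfolding J_source_def[abs_def] L2_cmult(2)[OF e] L2_cmult(2)[OF boundary_div_L2(1)[OF h]] by simp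
qed

text \<open>Where both potentials converge absolutely, linearity of the integral merges the single
  layer term and the reduced singular term.\<close>

lemma J_part_AE:
  assumes e: "L2 \<sigma> (normal_part D e)" and h: "H1_vec D (cross_normal D h)"
  shows "AE x in \<sigma>. J_part a b e h x = 1 / (4 * complex_of_real pi) * potential (J_source a b e h) x"
  using D_op_AE[OF h] AE_potential_integrable[OF e] AE_potential_integrable[OF boundary_div_L2(1)[OF h]]
proof eventually_elim
  case (elim x)
  let ?u = "normal_part D e" and ?q = "boundary_div D (cross_normal D h)"
  have "potential (J_source a b e h) x
      = (\<integral>y. a * (?u y / complex_of_real (dist x y)) - b * (?q y / complex_of_real (dist x y)) \<partial>\<sigma>)"
    unfolding potential_def J_source_def by (simp add: diff_divide_distrib)
  also have "\<dots> = a * potential ?u x - b * potential ?q x"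
    using elim(2,3) by (simp add: potential_def del: times_divide_eq_right)
  finally have pot: "potential (J_source a b e h) x = a * potential ?u x - b * potential ?q x" .
  show ?case
    unfolding J_part_def S_op_eq elim(1) pot by (simp add: algebra_simps diff_divide_distrib)
qed

lemma J_part_measurable:
  assumes "L2 \<sigma> (normal_part D e)" "H1_vec D (cross_normal D h)"
  shows "J_part a b e h \<in> borel_measurable \<sigma>"
proof -
  have "normal_part D e \<in> borel_measurable \<sigma>" using assms(1) by (simp add: L2_def)
  note measurable_potential[OF this, measurable] and D_op_measurable[OF assms(2), measurable]
  show ?thesis unfolding J_part_def[abs_def] S_op_eq by measurable
qed

lemma J_part_L2:
  assumes "L2 \<sigma> (normal_part D e)" "H1_vec D (cross_normal D h)"
  shows "L2 \<sigma> (J_part a b e h)"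
proof (rule L2_cong_AE(1)[OF L2_cmult(1)[OF L2_potential[OF J_source_L2(1)[OF assms]]]])
  show "AE x in \<sigma>. 1 / (4 * complex_of_real pi) * potential (J_source a b e h) x = J_part a b e h x"
    using J_part_AE[OF assms, where a = a and b = b] by eventually_elim simp
qed (rule J_part_measurable[OF assms])

lemma normal_part_linear:
  "normal_part D (\<lambda>x. a *s e x + b *s e' x) = (\<lambda>y. a * normal_part D e y + b * normal_part D e' y)"
  by (simp add: normal_part_def cdot_def fun_eq_iff sum_3 algebra_simps)

text \<open>Integrals and limits are additive wherever they exist, which is what
  \<open>J_defined_at\<close> records. The formula in \<open>J_part_AE\<close> would be less direct,
  since its density contains chosen weak gradients. There are two conclusions because the components
  of \<open>J\<close> exchange the two fields.\<close>

lemma J_part_linear: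
  assumes "J_defined_at D (e, h) x" "J_defined_at D (e', h') x"
  shows "J_part c d (\<lambda>x. a *s e x + b *s e' x) (\<lambda>x. a *s h x + b *s h' x) x
    = a * J_part c d e h x + b * J_part c d e' h' x" (is ?th1)
    and "J_part c d (\<lambda>x. a *s h x + b *s h' x) (\<lambda>x. a *s e x + b *s e' x) x
    = a * J_part c d h e x + b * J_part c d h' e' x" (is ?th2)
proof -
  have S: "S_op D (normal_part D (\<lambda>x. a *s u x + b *s v x)) x
      = a * S_op D (normal_part D u) x + b * S_op D (normal_part D v) x"
    if uv: "u \<in> {e, h}" "v \<in> {e', h'}" for u v
  proof -
    have int: "integrable \<sigma> (\<lambda>y. normal_part D u y / complex_of_real (norm (x - y)))"
      "integrable \<sigma> (\<lambda>y. normal_part D v y / complex_of_real (norm (x - y)))"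
      using assms uv by (auto simp: J_defined_at_def)
    have "(\<integral>y. normal_part D (\<lambda>x. a *s u x + b *s v x) y / complex_of_real (norm (x - y)) \<partial>\<sigma>)
        = (\<integral>y. a * (normal_part D u y / complex_of_real (norm (x - y))) + b * (normal_part D v y / complex_of_real (norm (x - y))) \<partial>\<sigma>)"
      by (simp add: normal_part_linear add_divide_distrib)
    also have "\<dots> = a * (\<integral>y. normal_part D u y / complex_of_real (norm (x - y)) \<partial>\<sigma>)
        + b * (\<integral>y. normal_part D v y / complex_of_real (norm (x - y)) \<partial>\<sigma>)"
      using int by (simp del: times_divide_eq_right)
    finally show ?thesis by (simp add: S_op_def algebra_simps)
  qed
  have Dop: "D_op D (\<lambda>x. a *s u x + b *s v x) x = a * D_op D u x + b * D_op D v x"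
    if uv: "u \<in> {e, h}" "v \<in> {e', h'}" for u v
  proof -
    obtain l l' where l: "(D_truncated D u x \<longlongrightarrow> l) (at_right 0)" "(D_truncated D v x \<longlongrightarrow> l') (at_right 0)"
      using assms uv unfolding J_defined_at_def by blast
    have eq: "D_truncated D (\<lambda>x. a *s u x + b *s v x) x \<delta> = a * D_truncated D u x \<delta> + b * D_truncated D v x \<delta>"
      if \<delta>: "\<delta> > 0" for \<delta>
    proof -
      have int: "set_integrable \<sigma> {y. \<delta> < dist x y} (\<lambda>y. cdot (cvec (D_kernel D x y)) (u y))"
        "set_integrable \<sigma> {y. \<delta> < dist x y} (\<lambda>y. cdot (cvec (D_kernel D x y)) (v y))"
        using assms uv \<delta> by (auto simp: J_defined_at_def)
      have "cdot k (a *s u y + b *s v y) = a * cdot k (u y) + b * cdot k (v y)" for k y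
        by (simp add: cdot_def sum_3 algebra_simps)
      then show ?thesis
        using int by (simp add: D_truncated_def algebra_simps)
    qed
    have lim: "((\<lambda>\<delta>. a * D_truncated D u x \<delta> + b * D_truncated D v x \<delta>) \<longlongrightarrow> a * l + b * l') (at_right 0)"
      by (intro tendsto_intros l)
    have "(D_truncated D (\<lambda>x. a *s u x + b *s v x) x \<longlongrightarrow> a * l + b * l') (at_right 0)"
      by (rule Lim_transform_eventually[OF lim])
        (use eq in \<open>auto simp: eventually_at_right[of 0 1] intro: exI[of _ 1]\<close>)
    then show ?thesis
      using l by (simp add: D_op_def tendsto_Lim)
  qed
  show ?th1 ?th2 by (simp_all add: J_part_def S Dop algebra_simps)
qed

section \<open>Fields along the normal inside \<open>X\<close>\<close>

definition normal_field :: "(real^3 \<Rightarrow> complex) \<Rightarrow> real^3 \<Rightarrow> complex^3" where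
  "normal_field f x = f x *s cvec (outward_normal D x)"

lemma J_op_eq:
  "J_op D \<omega> \<epsilon> \<mu> u = (normal_field (J_part (complex_of_real (\<omega>\<^sup>2 * \<epsilon>)) (\<i> * complex_of_real \<omega>) (fst u) (snd u)),
     normal_field (J_part (complex_of_real (\<omega>\<^sup>2 * \<mu>)) (- (\<i> * complex_of_real \<omega>)) (snd u) (fst u)))"
  by (simp add: J_op_def normal_field_def[abs_def] J_part_def case_prod_beta)

lemma cross_normal_field: "cross_normal D (normal_field f) = (\<lambda>x. 0)"
  by (simp add: cross_normal_def normal_field_def ccross_self fun_eq_iff)

lemma normal_part_normal_field:
  assumes "x \<in> space \<sigma>"
  shows "normal_part D (normal_field f) x = f x"
proof -
  let ?n = "outward_normal D x"
  have "?n \<bullet> ?n = 1"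
    using norm_outward_normal[OF smooth_domain] assms by (simp add: space dot_square_norm)
  then have "(\<Sum>i\<in>UNIV. complex_of_real (?n $ i) * complex_of_real (?n $ i)) = 1"
    by (simp add: inner_vec_def flip: of_real_mult of_real_sum)
  then show ?thesis
    by (simp add: normal_part_def normal_field_def cdot_def cvec_def mult.assoc flip: sum_distrib_left)
qed

lemma L2_normal_part_normal_field:
  "L2 \<sigma> (normal_part D (normal_field f)) \<longleftrightarrow> L2 \<sigma> f"
  "L2_norm_sq \<sigma> (normal_part D (normal_field f)) = L2_norm_sq \<sigma> f"
  by (rule L2_cong; rule normal_part_normal_field; assumption)+

lemma normal_fields_in_X_space:
  "L2 \<sigma> f \<Longrightarrow> L2 \<sigma> g \<Longrightarrow> (normal_field f, normal_field g) \<in> X_space D"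
  by (simp add: X_space_def cross_normal_field H1_vec_zero L2_normal_part_normal_field)

lemma X_norm_normal_fields:
  "X_norm D (normal_field f, normal_field g) = sqrt (L2_norm_sq \<sigma> f + L2_norm_sq \<sigma> g)"
  by (simp add: X_norm_def cross_normal_field H1_vec_zero L2_normal_part_normal_field)

lemma lincomb_normal_fields:
  "lincomb a (normal_field f, normal_field g) b (normal_field f', normal_field g')
    = (normal_field (\<lambda>x. a * f x + b * f' x), normal_field (\<lambda>x. a * g x + b * g' x))"
  by (simp add: lincomb_def normal_field_def fun_eq_iff vec_eq_iff algebra_simps)

lemma X_dist_normal_fields:
  "X_dist D (normal_field f, normal_field g) (normal_field f', normal_field g')
    = sqrt (L2_norm_sq \<sigma> (\<lambda>x. f x - f' x) + L2_norm_sq \<sigma> (\<lambda>x. g x - g' x))"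
  by (simp add: X_dist_def lincomb_normal_fields X_norm_normal_fields)

lemma L2_norm_sq_AE_zero: "AE x in \<sigma>. f x = g x \<Longrightarrow> L2_norm_sq \<sigma> (\<lambda>x. f x - g x) = 0"
  unfolding L2_norm_sq_def by (rule integral_eq_zero_AE) auto

text \<open>Transfers convergence of potentials to the components of \<open>J\<close>; the factor
  \<open>1 / (4 * complex_of_real pi)\<close> is absorbed into the limit.\<close>

lemma J_part_convergence:
  assumes "L2 \<sigma> (normal_part D e)" "H1_vec D (cross_normal D h)" "L2 \<sigma> v"
  shows "L2_norm_sq \<sigma> (\<lambda>x. J_part a b e h x - 1 / (4 * complex_of_real pi) * v x)
    = (norm (1 / (4 * complex_of_real pi)))\<^sup>2 * L2_norm_sq \<sigma> (\<lambda>x. potential (J_source a b e h) x - v x)"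
proof -
  let ?c = "1 / (4 * complex_of_real pi)"
  note d = L2_diff(1)[OF L2_potential[OF J_source_L2(1)[OF assms(1,2)]] assms(3)]
  have "AE x in \<sigma>. ?c * (potential (J_source a b e h) x - v x) = J_part a b e h x - ?c * v x"
    using J_part_AE[OF assms(1,2), where a = a and b = b] by eventually_elim (simp add: right_diff_distrib diff_divide_distrib)
  moreover have "(\<lambda>x. J_part a b e h x - ?c * v x) \<in> borel_measurable \<sigma>"
    using J_part_measurable[OF assms(1,2)] assms(3) by (auto simp: L2_def)
  ultimately have "L2_norm_sq \<sigma> (\<lambda>x. J_part a b e h x - ?c * v x)
      = L2_norm_sq \<sigma> (\<lambda>x. ?c * (potential (J_source a b e h) x - v x))"
    using L2_cong_AE(2)[OF L2_cmult(1)[OF d]] by blast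
  then show ?thesis by (simp only: L2_cmult(2)[OF d])
qed

lemma X_spaceD:
  assumes "u \<in> X_space D"
  shows "H1_vec D (cross_normal D (fst u))" "H1_vec D (cross_normal D (snd u))"
    "L2 \<sigma> (normal_part D (fst u))" "L2 \<sigma> (normal_part D (snd u))"
  using assms by (auto simp: X_space_def)

lemma X_norm_bounds:
  assumes "X_norm D u \<le> B"
  shows "H1_vec_norm_sq D (cross_normal D (fst u)) \<le> B\<^sup>2" "H1_vec_norm_sq D (cross_normal D (snd u)) \<le> B\<^sup>2"
    "L2_norm_sq \<sigma> (normal_part D (fst u)) \<le> B\<^sup>2" "L2_norm_sq \<sigma> (normal_part D (snd u)) \<le> B\<^sup>2"
proof -
  have nonneg: "H1_vec_norm_sq D w \<ge> 0" for w
    by (simp add: H1_vec_norm_sq_def H1_norm_sq_nonneg sum_nonneg)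
  let ?s = "H1_vec_norm_sq D (cross_normal D (fst u)) + H1_vec_norm_sq D (cross_normal D (snd u))
    + L2_norm_sq \<sigma> (normal_part D (fst u)) + L2_norm_sq \<sigma> (normal_part D (snd u))"
  have "?s \<le> B\<^sup>2"
    using assms by (intro sqrt_le_D) (simp add: X_norm_def case_prod_beta)
  then show "H1_vec_norm_sq D (cross_normal D (fst u)) \<le> B\<^sup>2" "H1_vec_norm_sq D (cross_normal D (snd u)) \<le> B\<^sup>2"
    "L2_norm_sq \<sigma> (normal_part D (fst u)) \<le> B\<^sup>2" "L2_norm_sq \<sigma> (normal_part D (snd u)) \<le> B\<^sup>2"
    using nonneg[of "cross_normal D (fst u)"] nonneg[of "cross_normal D (snd u)"]
      L2_norm_sq_nonneg[of \<sigma> "normal_part D (fst u)"] L2_norm_sq_nonneg[of \<sigma> "normal_part D (snd u)"]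
    by linarith+
qed

lemma J_source_bound:
  assumes u: "u \<in> X_space D" "X_norm D u \<le> B"
  shows "L2_norm_sq \<sigma> (J_source a b (fst u) (snd u)) \<le> (2 * (norm a)\<^sup>2 + 8 * (norm b)\<^sup>2) * B\<^sup>2"
    and "L2_norm_sq \<sigma> (J_source a b (snd u) (fst u)) \<le> (2 * (norm a)\<^sup>2 + 8 * (norm b)\<^sup>2) * B\<^sup>2"
proof -
  note X = X_spaceD[OF u(1)] and N = X_norm_bounds[OF u(2)]
  have *: "2 * (norm a)\<^sup>2 * s + 8 * (norm b)\<^sup>2 * t \<le> (2 * (norm a)\<^sup>2 + 8 * (norm b)\<^sup>2) * B\<^sup>2"
    if "s \<le> B\<^sup>2" "t \<le> B\<^sup>2" for s t
    unfolding distrib_right using that by (intro add_mono mult_left_mono) auto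
  show "L2_norm_sq \<sigma> (J_source a b (fst u) (snd u)) \<le> (2 * (norm a)\<^sup>2 + 8 * (norm b)\<^sup>2) * B\<^sup>2"
    by (rule order_trans[OF J_source_L2(2)[OF X(3,2)] *[OF N(3,2)]])
  show "L2_norm_sq \<sigma> (J_source a b (snd u) (fst u)) \<le> (2 * (norm a)\<^sup>2 + 8 * (norm b)\<^sup>2) * B\<^sup>2"
    by (rule order_trans[OF J_source_L2(2)[OF X(4,1)] *[OF N(4,1)]])
qed

text \<open>A bound in \<open>X\<close> bounds both source densities in the square norm, so
  \<open>potential_compact\<close> applies to each component. Linearity is asked for at distance 0,
  so identities valid almost everywhere suffice.\<close>

lemma J_op_compact: "compact_linear_operator_on_X D (J_op D \<omega> \<epsilon> \<mu>)"
proof -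
  define a1 where "a1 = complex_of_real (\<omega>\<^sup>2 * \<epsilon>)"
  define a2 where "a2 = complex_of_real (\<omega>\<^sup>2 * \<mu>)"
  define b1 where "b1 = \<i> * complex_of_real \<omega>"
  define b2 where "b2 = - (\<i> * complex_of_real \<omega>)"
  have J: "J_op D \<omega> \<epsilon> \<mu> u = (normal_field (J_part a1 b1 (fst u) (snd u)), normal_field (J_part a2 b2 (snd u) (fst u)))" for u
    by (simp add: J_op_eq a1_def a2_def b1_def b2_def)
  have L2J: "L2 \<sigma> (J_part a b (fst u) (snd u))" "L2 \<sigma> (J_part a b (snd u) (fst u))"
    if "u \<in> X_space D" for a b u
    using J_part_L2 X_spaceD[OF that] by blast+
  have "J_op D \<omega> \<epsilon> \<mu> u \<in> X_space D" if "u \<in> X_space D" for u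
    unfolding J by (intro normal_fields_in_X_space L2J that)
  moreover have "X_dist D (J_op D \<omega> \<epsilon> \<mu> (lincomb a u b v)) (lincomb a (J_op D \<omega> \<epsilon> \<mu> u) b (J_op D \<omega> \<epsilon> \<mu> v)) = 0"
    if u: "u \<in> X_space D" and v: "v \<in> X_space D" for a b u v
  proof -
    have ae: "AE x in \<sigma>. J_defined_at D (fst u, snd u) x" "AE x in \<sigma>. J_defined_at D (fst v, snd v) x"
      using J_defined_AE[of "fst u" "snd u"] J_defined_AE[of "fst v" "snd v"] u v by simp_all
    have "AE x in \<sigma>. J_part a1 b1 (fst (lincomb a u b v)) (snd (lincomb a u b v)) x
        = a * J_part a1 b1 (fst u) (snd u) x + b * J_part a1 b1 (fst v) (snd v) x"
      using ae by eventually_elim (simp add: lincomb_def J_part_linear(1))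
    moreover have "AE x in \<sigma>. J_part a2 b2 (snd (lincomb a u b v)) (fst (lincomb a u b v)) x
        = a * J_part a2 b2 (snd u) (fst u) x + b * J_part a2 b2 (snd v) (fst v) x"
      using ae by eventually_elim (simp add: lincomb_def J_part_linear(2))
    ultimately show ?thesis
      unfolding J lincomb_normal_fields X_dist_normal_fields by (simp add: L2_norm_sq_AE_zero)
  qed
  moreover have "\<exists>r v. strict_mono r \<and> v \<in> X_space D \<and> (\<lambda>k. X_dist D (J_op D \<omega> \<epsilon> \<mu> (f (r k))) v) \<longlonglongrightarrow> 0"
    if f: "\<And>k. f k \<in> X_space D" and B: "\<And>k. X_norm D (f k) \<le> B" for f :: "nat \<Rightarrow> field_pair" and B
  proof -
    let ?F1 = "\<lambda>k. J_source a1 b1 (fst (f k)) (snd (f k))" and ?F2 = "\<lambda>k. J_source a2 b2 (snd (f k)) (fst (f k))"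
    note X = X_spaceD[OF f]
    obtain r1 v1 where r1: "strict_mono r1" and v1: "L2 \<sigma> v1"
      and lim1: "(\<lambda>j. L2_norm_sq \<sigma> (\<lambda>x. potential (?F1 (r1 j)) x - v1 x)) \<longlonglongrightarrow> 0"
      using potential_compact[of ?F1, OF J_source_L2(1)[OF X(3,2)] J_source_bound(1)[OF f B]] by blast
    \<comment> \<open>The second extraction refines the first, so both components converge along
      \<open>r1 \<circ> r2\<close>.\<close>
    obtain r2 v2 where r2: "strict_mono r2" and v2: "L2 \<sigma> v2"
      and lim2: "(\<lambda>j. L2_norm_sq \<sigma> (\<lambda>x. potential (?F2 (r1 (r2 j))) x - v2 x)) \<longlonglongrightarrow> 0"
      using potential_compact[of "\<lambda>k. ?F2 (r1 k)", OF J_source_L2(1)[OF X(4,1)] J_source_bound(2)[OF f B]] by blast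
    let ?c = "1 / (4 * complex_of_real pi)"
    let ?v = "(normal_field (\<lambda>x. ?c * v1 x), normal_field (\<lambda>x. ?c * v2 x))"
    let ?L1 = "\<lambda>j. L2_norm_sq \<sigma> (\<lambda>x. potential (?F1 (r1 (r2 j))) x - v1 x)"
    let ?L2 = "\<lambda>j. L2_norm_sq \<sigma> (\<lambda>x. potential (?F2 (r1 (r2 j))) x - v2 x)"
    have "?L1 \<longlonglongrightarrow> 0" using LIMSEQ_subseq_LIMSEQ[OF lim1 r2] by (simp add: o_def)
    then have "(\<lambda>j. sqrt ((norm ?c)\<^sup>2 * ?L1 j + (norm ?c)\<^sup>2 * ?L2 j)) \<longlonglongrightarrow> sqrt ((norm ?c)\<^sup>2 * 0 + (norm ?c)\<^sup>2 * 0)"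
      using lim2 by (intro tendsto_intros)
    moreover have "X_dist D (J_op D \<omega> \<epsilon> \<mu> (f (r1 (r2 j)))) ?v = sqrt ((norm ?c)\<^sup>2 * ?L1 j + (norm ?c)\<^sup>2 * ?L2 j)" for j
      unfolding J X_dist_normal_fields J_part_convergence[OF X(3,2) v1] J_part_convergence[OF X(4,1) v2] ..
    ultimately have "(\<lambda>k. X_dist D (J_op D \<omega> \<epsilon> \<mu> (f ((r1 \<circ> r2) k))) ?v) \<longlonglongrightarrow> 0" by simp
    moreover have "strict_mono (r1 \<circ> r2)" using r1 r2 by (rule strict_mono_o)
    moreover have "?v \<in> X_space D" by (intro normal_fields_in_X_space L2_cmult(1) v1 v2)
    ultimately show ?thesis by blast
  qed
  ultimately show ?thesis unfolding compact_linear_operator_on_X_def by blast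
qed

end

theorem proposition3p2:
  fixes D :: "(real^3) set" and \<omega> \<epsilon> \<mu> :: real
  assumes "bounded_smooth_domain D"
    and "\<omega> > 0" and "\<epsilon> > 0" and "\<mu> > 0"
  shows "(\<forall>u\<in>X_space D. AE x in bdry_measure D. J_defined_at D u x) \<and>
         compact_linear_operator_on_X D (J_op D \<omega> \<epsilon> \<mu>)"
proof -
  interpret smooth_domain D
    using assms(1) by unfold_locales
  have "AE x in bdry_measure D. J_defined_at D u x" if "u \<in> X_space D" for u
    using J_defined_AE[of "fst u" "snd u"] that by simp
  then show ?thesis using J_op_compact by blast
qed


end
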